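(* Let $f(x)=\sum_{k=0}^\infty a_k\tau_k(x;0)$ be a transcendental entire function of order $\sigma<\frac13$, let $\gamma\in(3,\frac1\sigma)$, and let $\delta>0$. Then there exists a set $E\subset[1,\infty)$ of finite logarithmic measure such that for every $n\in\mathbb{N}$, we have $$\left(\frac{x}{N}\right)^n(\mathcal{D}_{\mathrm W}^nf)(x)=f(x)+O\left(\frac{\kappa}{N}\right)M(r;f)$$ as $r\to\infty$ with $r\in(0,\infty)\setminus E$, where $r=|x|$, $N=\nu_{\mathrm W}(r;f)$ and $\kappa=\left[\sqrt{N(\ln N)^2(\ln\ln N)^{1+\delta}}\right]$.
   Context: $\mathbb{N}=\{1,2,3,\dots\}$. The order of an entire function $f$ is $\sigma=\limsup_{r\to\infty}\frac{\ln^+\ln^+M(r;f)}{\ln r}$, where $M(r;f)=\max_{|x|=r}|f(x)|$ and $\ln^+t=\max\{\ln t,0\}$ (with $\ln^+0=0$). If $\sigma=0$, then $\frac1\sigma$ means $+\infty$. Transcendental means not a polynomial. The Wilson operator is $(\mathcal{D}_{\mathrm W}f)(x)=\dfrac{f((\sqrt x+\frac i2)^2)-f((\sqrt x-\frac i2)^2)}{2i\sqrt x}$ for $x\ne0$ (independent of the choice of $\sqrt x$), and $(\mathcal{D}_{\mathrm W}f)(0)=f'(-\frac14)$ (the limit as $x\to0$). If $f$ is entire, so is $\mathcal{D}_{\mathrm W}f$; $\mathcal{D}_{\mathrm W}^n$ is the $n$-fold iterate. The Wilson basis at $0$ is $\tau_0(x;0)=1$ and $\tau_k(x;0)=\prod_{j=0}^{k-1}(-j^2-x)$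 for $k\ge1$. Every entire function $f$ of order smaller than $\frac12$ has a unique expansion $f(x)=\sum_{k=0}^\infty a_k\tau_k(x;0)$ converging uniformly on compact subsets of $\mathbb{C}$. For such $f\not\equiv0$ and $r>0$, the Wilson maximal term is $\mu_{\mathrm W}(r;f)=\max_{n\ge0}|a_n|\,r(r+1^2)\cdots(r+(n-1)^2)$ and the Wilson central index is $\nu_{\mathrm W}(r;f)=\max\{n\ge0:|a_n|\,r(r+1^2)\cdots(r+(n-1)^2)=\mu_{\mathrm W}(r;f)\}$ (the empty product is $1$). For transcendental $f$, $\nu_{\mathrm W}(r;f)\to\infty$ as $r\to\infty$, so $\kappa$ is defined for all large $r$. $[\,\cdot\,]$ is the integer part. The $O$-term is uniform over all $x$ with $|x|=r$ (its implied constant may depend on $f,\gamma,\delta,n$). The logarithmic measure of a measurable set $E\subseteq[1,\infty)$ is $\int_E\frac{dx}{x}$ (Lebesgue). *)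

theory Defs
  imports
    "HOL-Analysis.Analysis"
    "HOL-Computational_Algebra.Polynomial"
    "HOL-Library.Landau_Symbols"
begin

definition entire :: "(complex \<Rightarrow> complex) \<Rightarrow> bool" where
  "entire f \<longleftrightarrow> f holomorphic_on UNIV"

definition transcendental_entire :: "(complex \<Rightarrow> complex) \<Rightarrow> bool" where
  "transcendental_entire f \<longleftrightarrow> entire f \<and> \<not> (\<exists>p :: complex poly. \<forall>x. f x = poly p x)"

text \<open>For continuous \<open>f\<close> and \<open>r \<ge> 0\<close> the supremum is attained, the circle being compact.\<close>

definition max_modulus :: "real \<Rightarrow> (complex \<Rightarrow> complex) \<Rightarrow> real" where
  "max_modulus r f = (SUP x\<in>sphere 0 r. cmod (f x))"

definition ln_plus :: "real \<Rightarrow> real" where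
  "ln_plus t = (if t = 0 then 0 else max (ln t) 0)"

definition order_of_growth :: "(complex \<Rightarrow> complex) \<Rightarrow> ereal" where
  "order_of_growth f =
     Limsup at_top (\<lambda>r. ereal (ln_plus (ln_plus (max_modulus r f)) / ln r))"

definition wilson_op :: "(complex \<Rightarrow> complex) \<Rightarrow> complex \<Rightarrow> complex" where
  "wilson_op f x =
     (if x = 0 then deriv f (- 1/4)
      else (f ((csqrt x + \<i>/2)\<^sup>2) - f ((csqrt x - \<i>/2)\<^sup>2)) / (2 * \<i> * csqrt x))"

text \<open>The principal branch \<^const>\<open>csqrt\<close> plays no role:\<close>

lemma wilson_op_any_sqrt:
  assumes "x \<noteq> 0" and "w\<^sup>2 = x"
  shows "wilson_op f x = (f ((w + \<i>/2)\<^sup>2) - f ((w - \<i>/2)\<^sup>2)) / (2 * \<i> * w)"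
proof -
  have "csqrt x = w \<or> csqrt x = - w"
    using assms(2) by (metis power2_csqrt power2_eq_iff)
  moreover have "(- w + \<i>/2)\<^sup>2 = (w - \<i>/2)\<^sup>2" "(- w - \<i>/2)\<^sup>2 = (w + \<i>/2)\<^sup>2"
    by (simp_all add: power2_eq_square algebra_simps)
  ultimately show ?thesis
    using assms by (auto simp: wilson_op_def field_simps)
qed

definition wilson_basis :: "nat \<Rightarrow> complex \<Rightarrow> complex" where
  "wilson_basis k x = (\<Prod>j<k. - (of_nat j)\<^sup>2 - x)"

definition wilson_expansion :: "(complex \<Rightarrow> complex) \<Rightarrow> (nat \<Rightarrow> complex) \<Rightarrow> bool" where
  "wilson_expansion f a \<longleftrightarrow>
     (\<forall>K. compact K \<longrightarrow>
        uniform_limit K (\<lambda>m x. \<Sum>k<m. a k * wilson_basis k x) f sequentially)"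

definition wilson_term :: "(nat \<Rightarrow> complex) \<Rightarrow> real \<Rightarrow> nat \<Rightarrow> real" where
  "wilson_term a r n = cmod (a n) * (\<Prod>j<n. r + (real j)\<^sup>2)"

text \<open>
  The next two notions are functions of the coefficients \<open>a\<close>. If \<open>a\<close> is the expansion of
  some \<open>f \<noteq> 0\<close> and \<open>r > 0\<close>, then \<open>wilson_term a r n\<close> is the modulus of the \<open>n\<close>-th summand
  at the point \<open>x = r\<close>, so it tends to \<open>0\<close> and is not identically \<open>0\<close>. Hence the supremum
  is attained, and at only finitely many indices.
\<close>

definition wilson_max_term :: "(nat \<Rightarrow> complex) \<Rightarrow> real \<Rightarrow> real" where
  "wilson_max_term a r = (SUP n. wilson_term a r n)"

definition wilson_central_index :: "(nat \<Rightarrow> complex) \<Rightarrow> real \<Rightarrow> nat" where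
  "wilson_central_index a r = Max {n. wilson_term a r n = wilson_max_term a r}"

definition wilson_kappa :: "real \<Rightarrow> nat \<Rightarrow> int" where
  "wilson_kappa \<delta> N =
     \<lfloor>sqrt (real N * (ln (real N))\<^sup>2 * (ln (ln (real N))) powr (1 + \<delta>))\<rfloor>"

definition log_measure :: "real set \<Rightarrow> ennreal" where
  "log_measure E = (\<integral>\<^sup>+x\<in>E. ennreal (1 / x) \<partial>lebesgue)"

end

theory Submission
  imports Defs "HOL-Complex_Analysis.Complex_Analysis" "HOL-Real_Asymp.Real_Asymp"
begin

text \<open>
  Write \<open>t k = \<bar>a k\<bar> * (r + 0\<^sup>2) * \<dots> * (r + (k-1)\<^sup>2)\<close> for the terms at radius \<open>r\<close>, and \<open>\<kappa>\<close> for the integer in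
  the error term. The proof is of Wiman--Valiron type: for most \<open>r\<close> only the terms with
  \<open>\<bar>k - N\<bar> \<le> \<kappa>\<close> matter, and on this window \<open>(x/N)\<^sup>n D\<^sup>n\<close>, where \<open>D\<close> is the Wilson
  operator, changes each summand of the series only by a factor close to \<open>1\<close>.

  Concentration. Let \<open>\<beta>\<close> be a bounded increasing sequence with values \<open>\<ge> 1\<close>, and for \<open>s > 0\<close>
  let \<open>N\<close> be the last index that maximises \<open>\<bar>a k\<bar> * (\<Prod>j<k. \<beta> j * (s + j\<^sup>2))\<close>. At the radius \<open>r\<close>
  with \<open>r + N\<^sup>2 = \<beta> N * (s + N\<^sup>2)\<close> one then has \<open>t k \<le> t N * (\<Prod>j. \<beta> N / \<beta> j)\<close> for \<open>k > N\<close>, with the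
  product over \<open>N \<le> j < k\<close>, and a similar inequality for \<open>k < N\<close>; so \<open>N\<close> is the central index of \<open>r\<close>
  and the terms decay on both sides of it. The radii that are not reached in this way fill the
  jumps of \<open>r\<close> at those \<open>s\<close> where \<open>N\<close> changes. As \<open>\<beta>\<close> is bounded and \<open>N \<le> s powr (1/3)\<close>
  eventually, the logarithmic lengths of the jumps are summable; this is lemma \<open>exceptional_set\<close>.
  With \<open>ln (\<beta> j) = const - (ln (ln j)) powr (-\<delta>/2)\<close> the increments of \<open>ln \<circ> \<beta>\<close> near \<open>N\<close> are so
  large that the terms outside the window sum up to \<open>O(t N / N)\<close> (\<open>prod_weight_ratio_le\<close>,
  \<open>tail_bound\<close>).

  Use of the order. Cauchy's estimate for divided differences (\<open>wilson_coefficient_bound\<close>) and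
  the order of growth give \<open>\<bar>a k\<bar> \<le> 2 * (2 * e / k powr \<gamma>) ^ k\<close> for large \<open>k\<close>, whence
  \<open>N powr \<theta> \<le> r\<close> for some \<open>\<theta> > 3\<close>. Therefore \<open>N\<^sup>3 / r\<close> tends to \<open>0\<close>. The basis polynomial of degree \<open>k\<close> is
  \<open>(-x)\<^sup>k\<close> times the product of the \<open>1 + j\<^sup>2 / x\<close> with \<open>j < k\<close>, and as \<open>\<Sum>j<k. j\<^sup>2 / r\<close> is small, these
  products are bounded above and below and hardly vary over the window. The same fact and
  Cauchy's estimate at the radius \<open>r\<close> itself bound \<open>t N\<close> by a multiple of the maximum modulus.

  The window. The \<open>n\<close>-th iterate of the operator sends the basis polynomial of degree \<open>k\<close> to
  \<open>(-1)\<^sup>n k (k-1) \<dots> (k-n+1)\<close> times a shifted basis polynomial of degree \<open>k - n\<close>. After multiplication by \<open>(x/N)\<^sup>n\<close> the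
  \<open>k\<close>-th summand of \<open>f\<close> is reproduced up to a relative error \<open>O(N\<^sup>2 / r)\<close> and the factor
  \<open>k (k-1) \<dots> (k-n+1) / N\<^sup>n = 1 + O(\<kappa> / N)\<close>. To estimate the effect of this factor summand by summand
  would cost another factor \<open>\<kappa>\<close>. But multiplication of the \<open>k\<close>-th coefficient by \<open>k - N\<close> is a
  differentiation, and Bernstein's inequality for polynomials of degree \<open>2 * \<kappa>\<close> bounds it by
  \<open>O(\<kappa>)\<close> in the maximum norm on the circle (\<open>bernstein_window\<close>, \<open>window_estimate\<close>).
\<close>

section \<open>Cauchy estimates for the Wilson coefficients\<close>

text \<open>
  Partial fractions: for two distinct poles \<open>p\<close>, \<open>q\<close> in \<open>S\<close> the product is, up to a constant, the
  difference of the two products without \<open>q\<close> and without \<open>p\<close>, whose integrals agree by induction.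
\<close>

lemma has_contour_integral_prod_inverse:
  fixes S :: "complex set"
  assumes "finite S" "S \<noteq> {}" "\<And>p. p \<in> S \<Longrightarrow> cmod p < r" "r > 0"
  shows "((\<lambda>z. \<Prod>p\<in>S. inverse (z - p)) has_contour_integral
           (if card S = 1 then 2 * of_real pi * \<i> else 0)) (circlepath 0 r)"
  using assms(1-3)
proof (induction "card S" arbitrary: S rule: less_induct)
  case less
  have off: "z - p \<noteq> 0" if "z \<in> path_image (circlepath 0 r)" "p \<in> S" for z p
    using that less.prems(3)[of p] assms(4) by (auto simp: path_image_circlepath)
  show ?case
  proof (cases "card S = 1")
    case True
    then obtain p where p: "S = {p}" by (auto simp: card_1_singleton_iff)
    have "((\<lambda>z. 1 / (z - p)) has_contour_integral 2 * of_real pi * \<i> * 1) (circlepath 0 r)"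
      using less.prems(3)[of p] p by (intro Cauchy_integral_circlepath_simple) (auto intro: holomorphic_intros)
    thus ?thesis using p by (simp add: field_simps)
  next
    case False
    obtain p where p: "p \<in> S" using less.prems by auto
    have c0: "card S \<ge> 2" using False less.prems by (metis card_0_eq One_nat_def Suc_1 less_2_cases_iff not_less_eq_eq not_less)
    have cp: "card (S - {p}) = card S - 1" using p less.prems by simp
    hence "S - {p} \<noteq> {}" using c0 by (metis card.empty One_nat_def Suc_1 diff_is_0_eq not_less_eq_eq)
    then obtain q where q: "q \<in> S" "q \<noteq> p" by auto
    have cq: "card (S - {q}) = card S - 1" using q less.prems by simp
    have Ip: "((\<lambda>z. \<Prod>p\<in>S-{p}. inverse (z - p)) has_contour_integral
           (if card S = 2 then 2 * of_real pi * \<i> else 0)) (circlepath 0 r)"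
    proof -
      have "card (S - {p}) < card S" using cp c0 by simp
      hence "((\<lambda>z. \<Prod>p\<in>S-{p}. inverse (z - p)) has_contour_integral
           (if card (S - {p}) = 1 then 2 * of_real pi * \<i> else 0)) (circlepath 0 r)"
        by (rule less.hyps) (use less.prems p q in auto)
      moreover have "card (S - {p}) = 1 \<longleftrightarrow> card S = 2" using cp c0 by arith
      ultimately show ?thesis by (simp only:)
    qed
    have Iq: "((\<lambda>z. \<Prod>p\<in>S-{q}. inverse (z - p)) has_contour_integral
           (if card S = 2 then 2 * of_real pi * \<i> else 0)) (circlepath 0 r)"
    proof -
      have "card (S - {q}) < card S" using cq c0 by simp
      hence "((\<lambda>z. \<Prod>p\<in>S-{q}. inverse (z - p)) has_contour_integral
           (if card (S - {q}) = 1 then 2 * of_real pi * \<i> else 0)) (circlepath 0 r)"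
        by (rule less.hyps) (use less.prems p q in auto)
      moreover have "card (S - {q}) = 1 \<longleftrightarrow> card S = 2" using cq c0 by arith
      ultimately show ?thesis by (simp only:)
    qed
    have J: "((\<lambda>z. inverse (p - q) * ((\<Prod>p\<in>S-{q}. inverse (z - p)) - (\<Prod>p\<in>S-{p}. inverse (z - p)))) has_contour_integral
           inverse (p - q) * 0) (circlepath 0 r)"
      by (rule has_contour_integral_lmul) (use has_contour_integral_diff[OF Iq Ip] in simp)
    have "inverse (p - q) * ((\<Prod>p\<in>S-{q}. inverse (z - p)) - (\<Prod>p\<in>S-{p}. inverse (z - p)))
        = (\<Prod>p\<in>S. inverse (z - p))" if z: "z \<in> path_image (circlepath 0 r)" for z
    proof -
      let ?R = "\<Prod>p\<in>S-{p}-{q}. inverse (z - p)"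
      have 1: "(\<Prod>p\<in>S-{q}. inverse (z - p)) = inverse (z - p) * ?R"
        using p q less.prems by (subst prod.remove[of _ p]) (auto simp: Diff_insert2[symmetric] insert_commute)
      have 2: "(\<Prod>p\<in>S-{p}. inverse (z - p)) = inverse (z - q) * ?R"
        using p q less.prems by (subst prod.remove[of _ q]) auto
      have 3: "(\<Prod>p\<in>S. inverse (z - p)) = inverse (z - p) * (inverse (z - q) * ?R)"
        using p q less.prems by (subst prod.remove[of _ p]) (auto simp: 2)
      have *: "inverse (p - q) * (inverse (z - p) - inverse (z - q)) = inverse (z - p) * inverse (z - q)"
        using off[OF z p] off[OF z q(1)] q by (simp add: field_simps)
      show ?thesis unfolding 1 2 3 using arg_cong[OF *, of "\<lambda>u. u * ?R"] by (simp add: algebra_simps)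
    qed
    from has_contour_integral_eq[OF J this] show ?thesis using False by simp
  qed
qed

lemma ivl_disj_un_le: "k \<le> n \<Longrightarrow> {..<k} \<union> {k..n} = {..<Suc n}" for k n :: nat
  by auto

lemma ivl_disj_un_lt: "\<not> k \<le> n \<Longrightarrow> {..<Suc n} \<union> {Suc n..<k} = {..<k}" for k n :: nat
  by auto

text \<open>
  The Wilson coefficients are divided differences at the nodes \<open>0, -1, -4, \<dots>\<close>; this
  biorthogonality expresses them as contour integrals.
\<close>

lemma has_contour_integral_wilson_basis_div:
  assumes r: "real n ^ 2 < r"
  shows "((\<lambda>z. wilson_basis k z / wilson_basis (Suc n) z) has_contour_integral
           (if k = n then - (2 * of_real pi * \<i>) else 0)) (circlepath 0 r)"
proof -
  have r0: "r > 0" using r by (smt (verit) zero_le_power2)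
  have nz: "- (of_nat j)\<^sup>2 - z \<noteq> (0::complex)" if "z \<in> path_image (circlepath 0 r)" "j \<le> n" for z j
  proof
    assume "- (of_nat j)\<^sup>2 - z = 0"
    hence "z = - (of_nat j)\<^sup>2" by (simp add: algebra_simps)
    hence "cmod z = real j ^ 2" by (simp add: norm_power)
    moreover have "real j ^ 2 \<le> real n ^ 2" using that by (intro power_mono) auto
    moreover have "cmod z = r" using that r0 by (simp add: path_image_circlepath)
    ultimately show False using r by linarith
  qed
  show ?thesis
  proof (cases "k \<le> n")
    case True
    let ?S = "(\<lambda>j. - (of_nat j)\<^sup>2 :: complex) ` {k..n}"
    have inj: "inj_on (\<lambda>j. - (of_nat j)\<^sup>2 :: complex) {k..n}"
    proof (rule inj_onI)
      fix i j assume "- (of_nat i)\<^sup>2 = (- (of_nat j)\<^sup>2 :: complex)"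
      hence "(of_nat (i^2) :: complex) = of_nat (j^2)" by simp
      hence "i^2 = j^2" by (subst (asm) of_nat_eq_iff)
      thus "i = j" by simp
    qed
    have card: "card ?S = Suc n - k" using inj by (simp add: card_image)
    have I: "((\<lambda>z. \<Prod>p\<in>?S. inverse (z - p)) has_contour_integral
           (if card ?S = 1 then 2 * of_real pi * \<i> else 0)) (circlepath 0 r)"
    proof (rule has_contour_integral_prod_inverse)
      fix p assume "p \<in> ?S"
      then obtain j where j: "p = - (of_nat j)\<^sup>2" "j \<le> n" by auto
      have "real j ^ 2 \<le> real n ^ 2" using j by (intro power_mono) auto
      thus "cmod p < r" using r unfolding j norm_minus_cancel norm_power norm_of_nat by linarith
    qed (use True r0 in auto)
    have val: "(-1) ^ (Suc n - k) * (if card ?S = 1 then 2 * of_real pi * \<i> else 0)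
        = (if k = n then - (2 * of_real pi * \<i>) else 0)" using card True by auto
    have "(-1) ^ (Suc n - k) * (\<Prod>p\<in>?S. inverse (z - p)) = wilson_basis k z / wilson_basis (Suc n) z"
      if z: "z \<in> path_image (circlepath 0 r)" for z
    proof -
      have "(\<Prod>j\<in>{..<Suc n}. - (of_nat j)\<^sup>2 - z) = (\<Prod>j\<in>{..<k}. - (of_nat j)\<^sup>2 - z) * (\<Prod>j\<in>{k..n}. - (of_nat j)\<^sup>2 - z)"
        using True by (subst ivl_disj_un_le[symmetric]) (auto intro!: prod.union_disjoint)
      moreover have "(\<Prod>j\<in>{..<k}. - (of_nat j)\<^sup>2 - z) \<noteq> 0" using nz[OF z] True by simp
      ultimately have "wilson_basis k z / wilson_basis (Suc n) z = inverse (\<Prod>j\<in>{k..n}. - (of_nat j)\<^sup>2 - z)"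
        by (simp add: wilson_basis_def field_simps)
      also have "\<dots> = (\<Prod>j\<in>{k..n}. (-1) * inverse (z - (- (of_nat j)\<^sup>2)))"
      proof (simp only: prod_inversef[symmetric] o_def, rule prod.cong)
        fix j
        have "- (of_nat j)\<^sup>2 - z = - (z - (- (of_nat j)\<^sup>2))" by simp
        thus "inverse (- (of_nat j)\<^sup>2 - z) = (-1) * inverse (z - (- (of_nat j)\<^sup>2))"
          by (simp only: inverse_minus_eq mult_minus1)
      qed simp
      also have "\<dots> = (-1) ^ (Suc n - k) * (\<Prod>j\<in>{k..n}. inverse (z - (- (of_nat j)\<^sup>2)))"
        unfolding prod.distrib by simp
      also have "(\<Prod>j\<in>{k..n}. inverse (z - (- (of_nat j)\<^sup>2))) = (\<Prod>p\<in>?S. inverse (z - p))"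
        by (subst prod.reindex[OF inj]) simp
      finally show ?thesis by simp
    qed
    from has_contour_integral_eq[OF has_contour_integral_lmul[OF I, of "(-1) ^ (Suc n - k)"] this]
    show ?thesis unfolding val by simp
  next
    case False
    have I: "((\<lambda>z. \<Prod>j\<in>{Suc n..<k}. - (of_nat j)\<^sup>2 - z) has_contour_integral 0) (circlepath 0 r)"
      by (rule Cauchy_theorem_convex_simple[where S=UNIV]) (auto intro!: holomorphic_intros)
    have "(\<Prod>j\<in>{Suc n..<k}. - (of_nat j)\<^sup>2 - z) = wilson_basis k z / wilson_basis (Suc n) z"
      if z: "z \<in> path_image (circlepath 0 r)" for z
    proof -
      have "(\<Prod>j\<in>{..<k}. - (of_nat j)\<^sup>2 - z) = (\<Prod>j\<in>{..<Suc n}. - (of_nat j)\<^sup>2 - z) * (\<Prod>j\<in>{Suc n..<k}. - (of_nat j)\<^sup>2 - z)"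
        using False by (subst ivl_disj_un_lt[symmetric]) (auto intro!: prod.union_disjoint simp del: lessThan_Suc prod.lessThan_Suc)
      moreover have "(\<Prod>j\<in>{..<Suc n}. - (of_nat j)\<^sup>2 - z) \<noteq> 0" using nz[OF z] by simp
      ultimately show ?thesis by (simp add: wilson_basis_def field_simps del: lessThan_Suc prod.lessThan_Suc)
    qed
    from has_contour_integral_eq[OF I this] show ?thesis using False by simp
  qed
qed

lemma wilson_coefficient_bound:
  assumes f: "wilson_expansion f a" and r: "real n ^ 2 < r"
    and M: "\<And>z. cmod z = r \<Longrightarrow> cmod (f z) \<le> M"
  shows "cmod (a n) * (\<Prod>j\<le>n. r - (real j)\<^sup>2) \<le> r * M"
proof -
  have r0: "r > 0" using r by (smt (verit) zero_le_power2)
  define D where "D = (\<Prod>j\<le>n. r - (real j)\<^sup>2)"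
  have pos: "r - (real j)\<^sup>2 > 0" if "j \<le> n" for j
  proof -
    have "real j ^ 2 \<le> real n ^ 2" using that by (intro power_mono) auto
    thus ?thesis using r by linarith
  qed
  have D0: "D > 0" unfolding D_def by (intro prod_pos) (use pos in auto)
  have D_le: "D \<le> cmod (wilson_basis (Suc n) z)" if "cmod z = r" for z
    unfolding D_def wilson_basis_def prod_norm[symmetric] lessThan_Suc_atMost
  proof (rule prod_mono, intro conjI)
    fix j assume "j \<in> {..n}"
    thus "0 \<le> r - (real j)\<^sup>2" using pos[of j] by simp
    have "cmod z \<le> cmod (- (of_nat j)\<^sup>2 - z) + cmod (- (of_nat j)\<^sup>2)"
      by (metis add.commute norm_minus_commute norm_triangle_sub)
    also have "cmod (- (of_nat j)\<^sup>2) = (real j)\<^sup>2" by (simp add: norm_power)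
    finally show "r - (real j)\<^sup>2 \<le> cmod (- (of_nat j)\<^sup>2 - z)" using that by simp
  qed
  have bd: "cmod (a n) \<le> r * (M + e) / D" if e: "e > 0" for e
  proof -
    have "uniform_limit (sphere 0 r) (\<lambda>m x. \<Sum>k<m. a k * wilson_basis k x) f sequentially"
      using f unfolding wilson_expansion_def by simp
    hence "\<forall>\<^sub>F m in sequentially. \<forall>x\<in>sphere 0 r. dist (\<Sum>k<m. a k * wilson_basis k x) (f x) < e"
      using e by (rule uniform_limitD)
    moreover have "\<forall>\<^sub>F m in sequentially. m > n" by (rule eventually_gt_at_top)
    ultimately have "\<forall>\<^sub>F m in sequentially. (\<forall>x\<in>sphere 0 r. dist (\<Sum>k<m. a k * wilson_basis k x) (f x) < e) \<and> m > n"
      by (rule eventually_conj)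
    then obtain m where "(\<forall>x\<in>sphere 0 r. dist (\<Sum>k<m. a k * wilson_basis k x) (f x) < e) \<and> m > n"
      using eventually_happens'[OF sequentially_bot] by blast
    hence m: "m > n"
      and d: "\<And>x. cmod x = r \<Longrightarrow> dist (\<Sum>k<m. a k * wilson_basis k x) (f x) < e"
      by auto
    let ?F = "\<lambda>x. \<Sum>k<m. a k * (wilson_basis k x / wilson_basis (Suc n) x)"
    have "(?F has_contour_integral (\<Sum>k<m. a k * (if k = n then - (2 * of_real pi * \<i>) else 0))) (circlepath 0 r)"
      by (intro has_contour_integral_sum has_contour_integral_lmul has_contour_integral_wilson_basis_div r) auto
    also have "(\<Sum>k<m. a k * (if k = n then - (2 * of_real pi * \<i>) else 0)) = - (2 * of_real pi * \<i> * a n)"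
      using m by (simp add: if_distrib cong: if_cong)
    finally have I: "(?F has_contour_integral - (2 * of_real pi * \<i> * a n)) (circlepath 0 r)" .
    have "cmod (- (2 * of_real pi * \<i> * a n)) \<le> (M + e) / D * (2 * pi * r)"
    proof (rule has_contour_integral_bound_circlepath[OF I])
      have "M \<ge> 0" using M[of "of_real r"] r0 by (smt (verit) norm_ge_zero norm_of_real)
      thus "0 \<le> (M + e) / D" using D0 e by simp
      fix x :: complex assume "cmod (x - 0) = r"
      hence x: "cmod x = r" by simp
      have "cmod (\<Sum>k<m. a k * wilson_basis k x) \<le> M + e"
        using d[OF x] M[OF x] unfolding dist_norm by (smt (verit) norm_triangle_sub)
      moreover have "?F x = (\<Sum>k<m. a k * wilson_basis k x) / wilson_basis (Suc n) x"
        by (simp add: sum_divide_distrib)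
      ultimately show "cmod (?F x) \<le> (M + e) / D"
        using D_le[OF x] D0 by (simp only: norm_divide) (intro frac_le, auto intro: order_trans[OF norm_ge_zero])
    qed (use r0 in auto)
    hence "(2 * pi) * cmod (a n) \<le> (2 * pi) * (r * (M + e) / D)" by (simp add: norm_mult mult_ac)
    thus ?thesis by (rule mult_left_le_imp_le) simp
  qed
  have eps: "cmod (a n) * D / r - M \<le> 0 + e" if "e > 0" for e
    using bd[OF that] D0 r0 by (simp add: pos_le_divide_eq pos_divide_le_eq diff_le_eq mult_ac add_ac)
  have "cmod (a n) * D / r - M \<le> 0" by (rule field_le_epsilon) (rule eps)
  thus ?thesis using r0 by (simp add: field_simps D_def)
qed

section \<open>A Bernstein inequality on a window of exponents\<close>

text \<open>
  The maximum principle for the reversed polynomial \<open>w ^ D * p (1 / w)\<close> on the disc of radius \<open>1 / r\<close>.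
\<close>

lemma polynomial_bound_outside_circle:
  fixes c :: "nat \<Rightarrow> complex"
  assumes r: "r > 0" and M: "\<And>z. cmod z = r \<Longrightarrow> cmod (\<Sum>k\<le>D. c k * z ^ k) \<le> M"
    and z: "cmod z \<ge> r"
  shows "cmod (\<Sum>k\<le>D. c k * z ^ k) \<le> M * (cmod z / r) ^ D"
proof -
  have rev: "w ^ D * (\<Sum>k\<le>D. c k * inverse w ^ k) = (\<Sum>k\<le>D. c k * w ^ (D - k))" if "w \<noteq> 0" for w :: complex
    unfolding sum_distrib_left
  proof (rule sum.cong)
    fix k assume "k \<in> {..D}"
    hence "w ^ D = w ^ k * w ^ (D - k)" by (simp flip: power_add)
    thus "w ^ D * (c k * inverse w ^ k) = c k * w ^ (D - k)" using that by (simp add: field_simps)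
  qed simp
  have z0: "z \<noteq> 0" using r z by auto
  have "cmod (\<Sum>k\<le>D. c k * inverse z ^ (D - k)) \<le> M * (1 / r) ^ D"
  proof (rule maximum_modulus_frontier[where S = "cball 0 (1 / r)" and \<xi> = "inverse z"
      and f = "\<lambda>w. \<Sum>k\<le>D. c k * w ^ (D - k)"])
    show "(\<lambda>w. \<Sum>k\<le>D. c k * w ^ (D - k)) holomorphic_on interior (cball 0 (1 / r))"
      by (intro holomorphic_intros)
    show "continuous_on (closure (cball 0 (1 / r))) (\<lambda>w. \<Sum>k\<le>D. c k * w ^ (D - k))"
      by (intro continuous_intros)
    show "inverse z \<in> cball 0 (1 / r)" using z r by (simp add: norm_inverse inverse_eq_divide[of "cmod z"] frac_le)
    fix w :: complex assume "w \<in> frontier (cball 0 (1 / r))"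
    hence w: "cmod w = 1 / r" using r by simp
    hence w0: "w \<noteq> 0" using r by auto
    have "cmod (\<Sum>k\<le>D. c k * inverse w ^ k) \<le> M"
      using w r by (intro M) (simp add: norm_inverse)
    thus "cmod (\<Sum>k\<le>D. c k * w ^ (D - k)) \<le> M * (1 / r) ^ D"
      unfolding rev[OF w0, symmetric] norm_mult norm_power w using r by (simp add: field_simps)
  qed simp
  hence "cmod (inverse z ^ D * (\<Sum>k\<le>D. c k * z ^ k)) \<le> M * (1 / r) ^ D"
    using rev[of "inverse z"] z0 by simp
  thus ?thesis using z0 r
    by (simp add: norm_mult norm_power norm_inverse power_divide) (simp add: field_simps)
qed

text \<open>
  Cauchy's inequality for the derivative on discs of radius \<open>r / D\<close>: there the polynomial exceeds its
  maximum on the circle by at most the factor \<open>(1 + 1 / D) ^ D \<le> e\<close>.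
\<close>

lemma bernstein_polynomial:
  fixes c :: "nat \<Rightarrow> complex"
  assumes r: "r > 0" and M: "\<And>z. cmod z = r \<Longrightarrow> cmod (\<Sum>k\<le>D. c k * z ^ k) \<le> M"
    and x: "cmod x = r"
  shows "cmod (\<Sum>k\<le>D. of_nat k * c k * x ^ k) \<le> 3 * real D * M"
proof (cases "D = 0")
  case True thus ?thesis using M[OF x] by simp
next
  case False
  have M0: "M \<ge> 0" using M[OF x] by (smt (verit) norm_ge_zero)
  define F where "F = (\<lambda>z. \<Sum>k\<le>D. c k * z ^ k)"
  have hol: "F holomorphic_on A" for A unfolding F_def by (intro holomorphic_intros)
  let ?h = "r / real D"
  have inner: "cmod (F z) \<le> M" if "cmod z \<le> r" for z
  proof (rule maximum_modulus_frontier[where S = "cball 0 r" and f = F])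
    show "continuous_on (closure (cball 0 r)) F" unfolding F_def by (intro continuous_intros)
  qed (use that hol M r in \<open>auto simp: F_def\<close>)
  have e: "(1 + 1 / real D) ^ D \<le> 3"
  proof -
    have "(1 + 1 / real D) ^ D \<le> exp (1 / real D) ^ D"
      by (intro power_mono) (auto simp: exp_ge_add_one_self)
    also have "\<dots> = exp 1" using False by (simp flip: exp_of_nat_mult)
    finally show ?thesis using exp_le by linarith
  qed
  have B: "cmod ((deriv ^^ 1) F x) \<le> fact 1 * (3 * M) / ?h ^ 1"
  proof (rule Cauchy_inequality)
    show "F holomorphic_on ball x ?h" by (rule hol)
    show "continuous_on (cball x ?h) F" unfolding F_def by (intro continuous_intros)
    show "0 < ?h" using r False by simp
    fix z assume z: "cmod (x - z) = ?h"
    show "cmod (F z) \<le> 3 * M"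
    proof (cases "cmod z \<le> r")
      case True thus ?thesis using inner M0 by (smt (verit))
    next
      case zr: False
      hence "cmod (F z) \<le> M * (cmod z / r) ^ D"
        unfolding F_def by (intro polynomial_bound_outside_circle r M) auto
      also have "\<dots> \<le> M * (1 + 1 / real D) ^ D"
      proof (intro mult_left_mono power_mono M0)
        have "cmod z \<le> r + ?h" using x z by (metis norm_minus_commute norm_triangle_sub)
        thus "cmod z / r \<le> 1 + 1 / real D" using r False by (simp add: field_simps)
      qed (use r in auto)
      also have "\<dots> \<le> M * 3" by (intro mult_left_mono e M0)
      finally show ?thesis by simp
    qed
  qed
  have "(F has_field_derivative (\<Sum>k\<le>D. c k * (of_nat k * x ^ (k - Suc 0)))) (at x)"
    unfolding F_def
    by (rule DERIV_sum, rule DERIV_cmult[OF DERIV_power[OF DERIV_ident, unfolded mult_1], THEN DERIV_cong]) auto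
  hence "deriv F x = (\<Sum>k\<le>D. c k * (of_nat k * x ^ (k - Suc 0)))" by (rule DERIV_imp_deriv)
  hence "x * deriv F x = (\<Sum>k\<le>D. x * (c k * (of_nat k * x ^ (k - Suc 0))))"
    by (simp only: sum_distrib_left)
  also have "\<dots> = (\<Sum>k\<le>D. of_nat k * c k * x ^ k)"
  proof (intro sum.cong refl)
    fix k show "x * (c k * (of_nat k * x ^ (k - Suc 0))) = of_nat k * c k * x ^ k"
      by (cases k) (auto simp: mult_ac)
  qed
  finally have "(\<Sum>k\<le>D. of_nat k * c k * x ^ k) = x * deriv F x" by simp
  hence "cmod (\<Sum>k\<le>D. of_nat k * c k * x ^ k) = r * cmod (deriv F x)"
    using x by (simp only: norm_mult)
  thus ?thesis using B r False by (simp add: field_simps)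
qed

text \<open>
  Division by \<open>x ^ (N - K)\<close> leaves a polynomial of degree \<open>2 * K\<close>, so the bound grows with the width
  of the window and not with \<open>N\<close>.
\<close>

lemma bernstein_window:
  fixes c :: "nat \<Rightarrow> complex"
  assumes r: "r > 0" and M: "\<And>z. cmod z = r \<Longrightarrow> cmod (\<Sum>k=N-K..N+K. c k * z ^ k) \<le> M"
    and x: "cmod x = r" and KN: "K \<le> N"
  shows "cmod (\<Sum>k=N-K..N+K. (of_nat k - of_nat N) * c k * x ^ k) \<le> 7 * real K * M"
proof -
  have sh: "(\<Sum>k=N-K..N+K. g k) = (\<Sum>k\<le>2*K. g (k + (N - K)))" for g :: "nat \<Rightarrow> complex"
  proof -
    have "{N-K..N+K} = {0 + (N-K)..2*K + (N-K)}" using KN by auto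
    thus ?thesis by (simp only: sum.shift_bounds_cl_nat_ivl atLeast0AtMost)
  qed
  have ring: "(u - v) * c * (p * q) = q * (u * c * p) - q * (v * (c * p))" for u v c p q :: complex
    by (simp add: algebra_simps)
  let ?d = "\<lambda>k. c (k + (N - K)) "
  have r0: "cmod (z ^ (N - K)) = r ^ (N - K)" if "cmod z = r" for z using that by (simp add: norm_power)
  have fac: "(\<Sum>k=N-K..N+K. c k * z ^ k) = z ^ (N - K) * (\<Sum>k\<le>2*K. ?d k * z ^ k)" for z
    unfolding sh sum_distrib_left by (simp add: power_add mult_ac)
  have M': "cmod (\<Sum>k\<le>2*K. ?d k * z ^ k) \<le> M / r ^ (N - K)" if "cmod z = r" for z
    using M[OF that] r unfolding fac norm_mult r0[OF that] by (simp add: field_simps)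
  have "(\<Sum>k=N-K..N+K. (of_nat k - of_nat N) * c k * x ^ k)
      = x ^ (N - K) * ((\<Sum>k\<le>2*K. of_nat k * ?d k * x ^ k) - of_nat K * (\<Sum>k\<le>2*K. ?d k * x ^ k))"
    unfolding sh sum_distrib_left right_diff_distrib sum_subtractf[symmetric]
  proof (intro sum.cong refl)
    fix k
    have "of_nat (k + (N - K)) - of_nat N = (of_nat k - of_nat K :: complex)"
      using KN by (simp add: of_nat_diff)
    thus "(of_nat (k + (N - K)) - of_nat N) * c (k + (N - K)) * x ^ (k + (N - K)) =
      x ^ (N - K) * (of_nat k * c (k + (N - K)) * x ^ k) - x ^ (N - K) * (of_nat K * (c (k + (N - K)) * x ^ k))"
      by (simp only: power_add ring)
  qed
  hence "cmod (\<Sum>k=N-K..N+K. (of_nat k - of_nat N) * c k * x ^ k) =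
      r ^ (N - K) * cmod ((\<Sum>k\<le>2*K. of_nat k * ?d k * x ^ k) - of_nat K * (\<Sum>k\<le>2*K. ?d k * x ^ k))"
    by (simp only: norm_mult r0[OF x])
  also have "\<dots> \<le> r ^ (N - K) * (cmod (\<Sum>k\<le>2*K. of_nat k * ?d k * x ^ k) + real K * cmod (\<Sum>k\<le>2*K. ?d k * x ^ k))"
    using norm_triangle_ineq4[of "\<Sum>k\<le>2*K. of_nat k * ?d k * x ^ k" "of_nat K * (\<Sum>k\<le>2*K. ?d k * x ^ k)"] r
    unfolding norm_mult[of "of_nat K"] norm_of_nat by (intro mult_left_mono) auto
  also have "\<dots> \<le> r ^ (N - K) * (3 * real (2 * K) * (M / r ^ (N - K)) + real K * (M / r ^ (N - K)))"
    by (intro mult_left_mono add_mono bernstein_polynomial[OF r M' x] M'[OF x]) (use r in auto)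
  also have "\<dots> = 7 * real K * M" using r by (simp add: field_simps)
  finally show ?thesis .
qed

section \<open>Iterated Wilson operators of a Wilson series\<close>

text \<open>
  The Wilson basis at the base point \<open>- h\<^sup>2\<close>. One application of the Wilson operator increases \<open>h\<close>
  by \<open>1/2\<close>.
\<close>

definition wilson_basis_at :: "complex \<Rightarrow> nat \<Rightarrow> complex \<Rightarrow> complex" where
  "wilson_basis_at h k x = (\<Prod>j<k. - (of_nat j + h)\<^sup>2 - x)"

lemma wilson_basis_at_0: "wilson_basis_at 0 k x = wilson_basis k x"
  by (simp add: wilson_basis_at_def wilson_basis_def)

text \<open>
  Factorisation of each \<open>- (j + h)\<^sup>2 - (w + \<i>/2)\<^sup>2\<close> into linear factors in \<open>w\<close>; all but the two outer ones
  pair up to factors of the next basis polynomial.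
\<close>

lemma wilson_basis_at_shift:
  "wilson_basis_at h (Suc k) ((w + \<i>/2)\<^sup>2) =
     - ((w + \<i> * (of_nat k + h + 1/2)) * (w - \<i> * (h - 1/2))) * wilson_basis_at (h + 1/2) k (w\<^sup>2)"
proof (induction k)
  case 0
  have "- h\<^sup>2 - (w + \<i>/2)\<^sup>2 = - ((w + \<i> * (h + 1/2)) * (w - \<i> * (h - 1/2)))"
    by (simp add: algebra_simps power2_eq_square)
  thus ?case by (simp add: wilson_basis_at_def)
next
  case (Suc k)
  let ?g = "of_nat k + h + 1/2"
  have 1: "- (of_nat (Suc k) + h)\<^sup>2 - (w + \<i>/2)\<^sup>2 = - ((w + \<i> * (of_nat (Suc k) + h + 1/2)) * (w - \<i> * ?g))"
    by (simp add: algebra_simps power2_eq_square)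
  have 2: "(w + \<i> * ?g) * (w - \<i> * ?g) = - (- (of_nat k + (h + 1/2))\<^sup>2 - w\<^sup>2)"
    by (simp add: algebra_simps power2_eq_square)
  have "wilson_basis_at h (Suc (Suc k)) ((w + \<i>/2)\<^sup>2) =
      wilson_basis_at h (Suc k) ((w + \<i>/2)\<^sup>2) * (- (of_nat (Suc k) + h)\<^sup>2 - (w + \<i>/2)\<^sup>2)"
    by (simp add: wilson_basis_at_def)
  also have "\<dots> = ((w + \<i> * (of_nat (Suc k) + h + 1/2)) * (w - \<i> * (h - 1/2)))
      * wilson_basis_at (h + 1/2) k (w\<^sup>2) * ((w + \<i> * ?g) * (w - \<i> * ?g))"
    unfolding Suc.IH 1 by (simp only: mult_ac mult_minus_left mult_minus_right minus_minus)
  also have "\<dots> = - ((w + \<i> * (of_nat (Suc k) + h + 1/2)) * (w - \<i> * (h - 1/2)))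
      * wilson_basis_at (h + 1/2) (Suc k) (w\<^sup>2)"
    unfolding 2 by (simp only: wilson_basis_at_def prod.lessThan_Suc mult_ac mult_minus_left mult_minus_right)
  finally show ?case .
qed

lemma wilson_difference_basis_at:
  assumes "w \<noteq> 0"
  shows "(wilson_basis_at h k ((w + \<i>/2)\<^sup>2) - wilson_basis_at h k ((w - \<i>/2)\<^sup>2)) / (2 * \<i> * w) =
     - of_nat k * wilson_basis_at (h + 1/2) (k - 1) (w\<^sup>2)"
proof (cases k)
  case 0 thus ?thesis by (simp add: wilson_basis_at_def)
next
  case (Suc m)
  have sq: "(w - \<i>/2)\<^sup>2 = (- w + \<i>/2)\<^sup>2" by (simp add: power2_eq_square algebra_simps)
  have "wilson_basis_at h k ((w + \<i>/2)\<^sup>2) - wilson_basis_at h k ((w - \<i>/2)\<^sup>2) =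
     (- ((w + \<i> * (of_nat m + h + 1/2)) * (w - \<i> * (h - 1/2))) + ((- w + \<i> * (of_nat m + h + 1/2)) * (- w - \<i> * (h - 1/2))))
       * wilson_basis_at (h + 1/2) m (w\<^sup>2)"
    unfolding sq Suc wilson_basis_at_shift by (simp only: power2_minus) (simp add: algebra_simps)
  also have "- ((w + \<i> * (of_nat m + h + 1/2)) * (w - \<i> * (h - 1/2))) + ((- w + \<i> * (of_nat m + h + 1/2)) * (- w - \<i> * (h - 1/2)))
      = (2 * \<i> * w) * (- of_nat k)"
    unfolding Suc by (simp add: algebra_simps)
  finally show ?thesis using assms Suc by simp
qed

definition falling_factorial :: "nat \<Rightarrow> nat \<Rightarrow> complex" where
  "falling_factorial n k = (\<Prod>i<n. of_nat k - of_nat i)"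

lemma falling_factorial_eq_0: "k < n \<Longrightarrow> falling_factorial n k = 0"
  by (auto simp: falling_factorial_def)

lemma norm_falling_factorial_le: "cmod (falling_factorial n k) \<le> real k ^ n"
proof (cases "k < n")
  case False
  have "cmod (falling_factorial n k) = (\<Prod>i<n. real (k - i))"
    unfolding falling_factorial_def prod_norm[symmetric]
    using False by (intro prod.cong) (auto simp flip: of_nat_diff)
  also have "\<dots> \<le> (\<Prod>i<n. real k)" by (intro prod_mono) auto
  finally show ?thesis by simp
qed (simp add: falling_factorial_eq_0)

lemma wilson_expansion_sums:
  assumes "wilson_expansion f a"
  shows "(\<lambda>k. a k * wilson_basis k x) sums f x"
proof -
  have "uniform_limit {x} (\<lambda>m x. \<Sum>k<m. a k * wilson_basis k x) f sequentially"
    by (rule assms[unfolded wilson_expansion_def, rule_format]) simp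
  from tendsto_uniform_limitI[OF this] show ?thesis unfolding sums_def by simp
qed

text \<open>
  The condition on \<open>w\<close> keeps \<open>0\<close> out of the points at which the operator is evaluated in the course of
  the iteration, so that it is a difference quotient each time and acts on the series term by term.
\<close>

lemma wilson_op_iterate_sums:
  assumes f: "wilson_expansion f a" and w: "cmod w > real n / 2"
  shows "(\<lambda>k. a k * ((-1) ^ n * falling_factorial n k * wilson_basis_at (of_nat n / 2) (k - n) (w\<^sup>2)))
           sums (wilson_op ^^ n) f (w\<^sup>2)"
  using w
proof (induction n arbitrary: w)
  case 0
  thus ?case using wilson_expansion_sums[OF f, of "w\<^sup>2"]
    by (simp add: falling_factorial_def wilson_basis_at_0)
next
  case (Suc n)
  have w0: "w \<noteq> 0" using Suc.prems by auto
  let ?t = "\<lambda>k x. a k * ((-1) ^ n * falling_factorial n k * wilson_basis_at (of_nat n / 2) (k - n) x)"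
  have "cmod w \<le> cmod (w + \<i>/2) + cmod (\<i>/2)" by (metis add_diff_cancel_right' norm_triangle_ineq4)
  hence "cmod (w + \<i>/2) > real n / 2" using Suc.prems by (simp add: norm_divide)
  note p = Suc.IH[OF this]
  have "cmod w \<le> cmod (w - \<i>/2) + cmod (\<i>/2)" by (metis add.commute norm_triangle_sub)
  hence "cmod (w - \<i>/2) > real n / 2" using Suc.prems by (simp add: norm_divide)
  note m = Suc.IH[OF this]
  have "(\<lambda>k. (?t k ((w + \<i>/2)\<^sup>2) - ?t k ((w - \<i>/2)\<^sup>2)) / (2 * \<i> * w)) sums
      (((wilson_op ^^ n) f ((w + \<i>/2)\<^sup>2) - (wilson_op ^^ n) f ((w - \<i>/2)\<^sup>2)) / (2 * \<i> * w))"
    by (intro sums_divide sums_diff p m)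
  also have "((wilson_op ^^ n) f ((w + \<i>/2)\<^sup>2) - (wilson_op ^^ n) f ((w - \<i>/2)\<^sup>2)) / (2 * \<i> * w)
      = (wilson_op ^^ Suc n) f (w\<^sup>2)"
    using w0 by (subst funpow.simps, subst o_apply, subst wilson_op_any_sqrt[of _ w]) auto
  also have "(\<lambda>k. (?t k ((w + \<i>/2)\<^sup>2) - ?t k ((w - \<i>/2)\<^sup>2)) / (2 * \<i> * w)) =
     (\<lambda>k. a k * ((-1) ^ Suc n * falling_factorial (Suc n) k * wilson_basis_at (of_nat (Suc n) / 2) (k - Suc n) (w\<^sup>2)))"
  proof
    fix k
    have "(?t k ((w + \<i>/2)\<^sup>2) - ?t k ((w - \<i>/2)\<^sup>2)) / (2 * \<i> * w) = a k * ((-1) ^ n * falling_factorial n k *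
       ((wilson_basis_at (of_nat n / 2) (k - n) ((w + \<i>/2)\<^sup>2) - wilson_basis_at (of_nat n / 2) (k - n) ((w - \<i>/2)\<^sup>2)) / (2 * \<i> * w)))"
      by (simp add: diff_divide_distrib right_diff_distrib)
    also have "\<dots> = a k * ((-1) ^ Suc n * (falling_factorial n k * of_nat (k - n)) * wilson_basis_at (of_nat (Suc n) / 2) (k - Suc n) (w\<^sup>2))"
      unfolding wilson_difference_basis_at[OF w0] by (simp add: add_divide_distrib add.commute)
    also have "falling_factorial n k * of_nat (k - n) = falling_factorial (Suc n) k"
      by (cases "k < n") (auto simp: falling_factorial_eq_0 falling_factorial_def of_nat_diff)
    finally show "(?t k ((w + \<i>/2)\<^sup>2) - ?t k ((w - \<i>/2)\<^sup>2)) / (2 * \<i> * w) =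
       a k * ((-1) ^ Suc n * falling_factorial (Suc n) k * wilson_basis_at (of_nat (Suc n) / 2) (k - Suc n) (w\<^sup>2))" .
  qed
  finally show ?case .
qed

lemma norm_wilson_basis_le: "cmod (wilson_basis k x) \<le> (\<Prod>j<k. cmod x + (real j)\<^sup>2)"
  unfolding wilson_basis_def prod_norm[symmetric]
proof (rule prod_mono, intro conjI)
  fix j
  have "cmod (- (of_nat j)\<^sup>2 - x) \<le> cmod (- (of_nat j)\<^sup>2) + cmod x" by (rule norm_triangle_ineq4)
  thus "cmod (- (of_nat j)\<^sup>2 - x) \<le> cmod x + (real j)\<^sup>2" by (simp add: norm_power)
qed simp

text \<open>
  Hence the terms of the differentiated series are dominated by \<open>(k / N) ^ n\<close> times the terms that
  define the central index, and the tail estimate for the latter covers both series.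
\<close>

lemma norm_wilson_basis_at_le:
  assumes "n \<le> k"
  shows "cmod x ^ n * cmod (wilson_basis_at (of_nat n / 2) (k - n) x) \<le> (\<Prod>j<k. cmod x + (real j)\<^sup>2)"
proof -
  have "cmod (wilson_basis_at (of_nat n / 2) (k - n) x) \<le> (\<Prod>j<k-n. cmod x + (real (j + n))\<^sup>2)"
    unfolding wilson_basis_at_def prod_norm[symmetric]
  proof (rule prod_mono, intro conjI)
    fix j
    have "cmod (- (of_nat j + of_nat n / 2)\<^sup>2 - x) \<le> cmod (- (of_nat j + of_nat n / 2)\<^sup>2) + cmod x"
      by (rule norm_triangle_ineq4)
    also have "cmod (- (of_nat j + of_nat n / 2 :: complex)\<^sup>2) = (real j + real n / 2)\<^sup>2"
    proof -
      have "(of_nat j + of_nat n / 2 :: complex) = of_real (real j + real n / 2)" by simp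
      thus ?thesis by (simp only: norm_minus_cancel norm_power norm_of_real power2_abs)
    qed
    also have "\<dots> \<le> (real (j + n))\<^sup>2" by (intro power_mono) auto
    finally show "cmod (- (of_nat j + of_nat n / 2)\<^sup>2 - x) \<le> cmod x + (real (j + n))\<^sup>2" by simp
  qed simp
  also have "(\<Prod>j<k-n. cmod x + (real (j + n))\<^sup>2) = (\<Prod>j\<in>{n..<k}. cmod x + (real j)\<^sup>2)"
    using assms by (intro prod.reindex_bij_witness[of _ "\<lambda>j. j - n" "\<lambda>j. j + n"]) auto
  finally have 1: "cmod (wilson_basis_at (of_nat n / 2) (k - n) x) \<le> \<dots>" .
  have "cmod x ^ n = (\<Prod>j<n. cmod x)" by simp
  also have "\<dots> \<le> (\<Prod>j<n. cmod x + (real j)\<^sup>2)" by (intro prod_mono) auto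
  finally have "cmod x ^ n * cmod (wilson_basis_at (of_nat n / 2) (k - n) x)
      \<le> (\<Prod>j<n. cmod x + (real j)\<^sup>2) * (\<Prod>j\<in>{n..<k}. cmod x + (real j)\<^sup>2)"
    using 1 by (intro mult_mono prod_nonneg) auto
  also have "\<dots> = (\<Prod>j\<in>{..<n} \<union> {n..<k}. cmod x + (real j)\<^sup>2)"
    by (rule prod.union_disjoint[symmetric]) auto
  also have "{..<n} \<union> {n..<k} = {..<k}" using assms by auto
  finally show ?thesis .
qed

section \<open>Basis polynomials at degrees close to the central index\<close>

lemma norm_prod_diff_le:
  fixes z w :: "'i \<Rightarrow> complex"
  assumes "finite A" "c \<ge> 1" "\<And>j. j \<in> A \<Longrightarrow> cmod (z j) \<le> c" "\<And>j. j \<in> A \<Longrightarrow> cmod (w j) \<le> c"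
  shows "cmod (prod z A - prod w A) \<le> c ^ card A * (\<Sum>j\<in>A. cmod (z j - w j))"
  using assms(1,3,4)
proof (induction A rule: finite_induct)
  case (insert i A)
  have IH: "cmod (prod z A - prod w A) \<le> c ^ card A * (\<Sum>j\<in>A. cmod (z j - w j))"
    by (rule insert.IH) (use insert.prems in auto)
  have pz: "cmod (prod z A) \<le> c ^ card A"
  proof -
    have "cmod (prod z A) = (\<Prod>j\<in>A. cmod (z j))" by (rule prod_norm[symmetric])
    also have "\<dots> \<le> (\<Prod>j\<in>A. c)" by (rule prod_mono) (use insert.prems in auto)
    finally show ?thesis by simp
  qed
  have c1: "c ^ card A \<le> c ^ Suc (card A)" using assms(2) by (intro power_increasing) auto
  have "prod z (insert i A) - prod w (insert i A) = (z i - w i) * prod z A + w i * (prod z A - prod w A)"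
    using insert.hyps by (simp add: algebra_simps)
  hence "cmod (prod z (insert i A) - prod w (insert i A)) \<le> cmod (z i - w i) * cmod (prod z A) + cmod (w i) * cmod (prod z A - prod w A)"
    by (metis norm_mult norm_triangle_ineq)
  also have "\<dots> \<le> cmod (z i - w i) * c ^ Suc (card A) + c * (c ^ card A * (\<Sum>j\<in>A. cmod (z j - w j)))"
    using order_trans[OF pz c1] IH insert.prems(2)[of i] assms(2) by (intro add_mono mult_mono) auto
  also have "\<dots> = c ^ card (insert i A) * (\<Sum>j\<in>insert i A. cmod (z j - w j))"
    using insert.hyps by (simp add: algebra_simps)
  finally show ?case .
qed simp

text \<open>
  All factors \<open>1 + (j + h)\<^sup>2 / x\<close> with \<open>j + h \<le> 2 * N\<close> have modulus at most \<open>1 + 4 * N\<^sup>2 / r\<close>, so this bounds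
  every partial product of them by a constant.
\<close>

lemma one_plus_small_power_le:
  assumes "real N ^ 3 \<le> r" "N > 0"
  shows "(1 + 4 * real N ^ 2 / r) ^ (2 * N) \<le> exp 8"
proof -
  have r: "r > 0" using assms by (smt (verit) of_nat_0_less_iff zero_less_power)
  have "(1 + 4 * real N ^ 2 / r) ^ (2 * N) \<le> exp (4 * real N ^ 2 / r) ^ (2 * N)"
    using r by (intro power_mono exp_ge_add_one_self) auto
  also have "\<dots> = exp (8 * (real N ^ 3 / r))"
    by (simp add: exp_of_nat_mult[symmetric] power3_eq_cube power2_eq_square)
  also have "\<dots> \<le> exp 8"
  proof -
    have "real N ^ 3 / r \<le> 1" using assms r by simp
    thus ?thesis by (simp only: exp_le_cancel_iff)
  qed
  finally show ?thesis .
qed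

lemma prod_if_less:
  fixes g :: "nat \<Rightarrow> complex"
  assumes "k \<le> m"
  shows "(\<Prod>j<m. if j < k then g j else 1) = (\<Prod>j<k. g j)"
  by (rule prod.mono_neutral_cong_right) (use assms in auto)

text \<open>
  The quotient of the basis polynomial by \<open>(- x) ^ k\<close>.
\<close>

definition reduced_basis :: "complex \<Rightarrow> nat \<Rightarrow> complex \<Rightarrow> complex" where
  "reduced_basis h k x = (\<Prod>j<k. 1 + (of_nat j + h)\<^sup>2 / x)"

lemma wilson_basis_at_reduced:
  assumes "x \<noteq> 0"
  shows "wilson_basis_at h k x = (- x) ^ k * reduced_basis h k x"
proof -
  have "- (of_nat j + h)\<^sup>2 - x = (- x) * (1 + (of_nat j + h)\<^sup>2 / x)" for j
    using assms by (simp add: field_simps)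
  thus ?thesis unfolding wilson_basis_at_def reduced_basis_def
    by (simp only: prod.distrib prod_constant card_lessThan)
qed

lemma norm_reduced_factor_le:
  assumes x: "cmod x = r" "r > 0" and j: "real j + real n / 2 \<le> 2 * real N"
  shows "cmod (1 + (of_nat j + of_nat n / 2)\<^sup>2 / x) \<le> 1 + 4 * real N ^ 2 / r"
proof -
  have "cmod (1 + (of_nat j + of_nat n / 2)\<^sup>2 / x) \<le> 1 + cmod ((of_nat j + of_nat n / 2)\<^sup>2 / x)"
    by (metis norm_one norm_triangle_ineq)
  also have "cmod ((of_nat j + of_nat n / 2)\<^sup>2 / x) = (real j + real n / 2)\<^sup>2 / r"
  proof -
    have "(of_nat j + of_nat n / 2 :: complex) = of_real (real j + real n / 2)" by simp
    thus ?thesis using x by (simp only: norm_divide norm_power norm_of_real power2_abs)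
  qed
  also have "\<dots> \<le> (2 * real N)\<^sup>2 / r" using j x by (intro divide_right_mono power_mono) auto
  finally show ?thesis by (simp add: power_mult_distrib)
qed

lemma reduced_basis_diff_degree:
  assumes x: "cmod x = r" and r: "real N ^ 3 \<le> r" "N > 0" and k: "k \<in> {N-K..N+K}" "K \<le> N"
  shows "cmod (reduced_basis 0 k x - reduced_basis 0 N x) \<le> 4 * exp 8 * (real K * real N ^ 2 / r)"
proof -
  have r0: "r > 0" using r by (smt (verit) of_nat_0_less_iff zero_less_power)
  let ?z = "\<lambda>j. if j < k then 1 + (of_nat j)\<^sup>2 / x else 1"
  let ?w = "\<lambda>j. if j < N then 1 + (of_nat j)\<^sup>2 / x else 1"
  let ?c = "1 + 4 * real N ^ 2 / r"
  have fac: "cmod (1 + (of_nat j)\<^sup>2 / x) \<le> ?c" if "j < 2 * N" for j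
    using norm_reduced_factor_le[OF x r0, of j 0 N] that by simp
  have c1: "?c \<ge> 1" using r0 by simp
  have "reduced_basis 0 k x = prod ?z {..<2*N}"
    unfolding reduced_basis_def using k by (subst prod_if_less) auto
  moreover have "reduced_basis 0 N x = prod ?w {..<2*N}"
    unfolding reduced_basis_def using k by (subst prod_if_less) auto
  ultimately have "cmod (reduced_basis 0 k x - reduced_basis 0 N x) \<le> ?c ^ card {..<2*N} * (\<Sum>j<2*N. cmod (?z j - ?w j))"
    using norm_prod_diff_le[of "{..<2*N}" ?c ?z ?w] c1 fac by auto
  also have "\<dots> \<le> exp 8 * (real K * (4 * real N ^ 2 / r))"
  proof (intro mult_mono sum_nonneg)
    show "?c ^ card {..<2*N} \<le> exp 8" using one_plus_small_power_le[OF r] by simp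
    have "(\<Sum>j<2*N. cmod (?z j - ?w j)) \<le> (\<Sum>j<2*N. if j \<in> {min k N..<max k N} then 4 * real N ^ 2 / r else 0)"
    proof (rule sum_mono)
      fix j assume j: "j \<in> {..<2*N}"
      have "cmod ((of_nat j)\<^sup>2 / x) = (real j)\<^sup>2 / r" using x by (simp add: norm_divide norm_power)
      also have "\<dots> \<le> (2 * real N)\<^sup>2 / r" using j r0 by (intro divide_right_mono power_mono) auto
      finally have "cmod ((of_nat j)\<^sup>2 / x) \<le> 4 * real N ^ 2 / r" by (simp add: power_mult_distrib)
      thus "cmod (?z j - ?w j) \<le> (if j \<in> {min k N..<max k N} then 4 * real N ^ 2 / r else 0)"
        by (auto simp: norm_minus_commute)
    qed
    also have "\<dots> = real (card ({..<2*N} \<inter> {min k N..<max k N})) * (4 * real N ^ 2 / r)"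
      by (subst sum.inter_restrict[symmetric]) auto
    also have "\<dots> \<le> real K * (4 * real N ^ 2 / r)"
    proof (intro mult_right_mono)
      have "card ({..<2*N} \<inter> {min k N..<max k N}) \<le> card {min k N..<max k N}" by (intro card_mono) auto
      also have "\<dots> \<le> K" using k by auto
      finally show "real (card ({..<2*N} \<inter> {min k N..<max k N})) \<le> real K" by simp
    qed (use r0 in auto)
    finally show "(\<Sum>j<2*N. cmod (?z j - ?w j)) \<le> real K * (4 * real N ^ 2 / r)" .
  qed (use r0 in auto)
  finally show ?thesis by (simp add: mult_ac)
qed

lemma reduced_basis_diff_shift:
  assumes x: "cmod x = r" and r: "real N ^ 3 \<le> r" "N > 0" and k: "k \<le> 2 * N" "n \<le> k"
  shows "cmod (reduced_basis (of_nat n / 2) (k - n) x - reduced_basis 0 k x)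
    \<le> exp 8 * (8 * real n + 2 * real n ^ 2) * (real N ^ 2 / r)"
proof -
  have r0: "r > 0" using r by (smt (verit) of_nat_0_less_iff zero_less_power)
  let ?z = "\<lambda>j. if j < k - n then 1 + (of_nat j + of_nat n / 2)\<^sup>2 / x else 1"
  let ?w = "\<lambda>j. if j < k then 1 + (of_nat j)\<^sup>2 / x else 1"
  let ?c = "1 + 4 * real N ^ 2 / r"
  have facw: "cmod (1 + (of_nat j)\<^sup>2 / x) \<le> ?c" if "j < 2 * N" for j
    using norm_reduced_factor_le[OF x r0, of j 0 N] that by simp
  have facz: "cmod (1 + (of_nat j + of_nat n / 2)\<^sup>2 / x) \<le> ?c" if "j < k - n" for j
    by (rule norm_reduced_factor_le[OF x r0]) (use that k in linarith)
  have c1: "?c \<ge> 1" using r0 by simp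
  have "reduced_basis (of_nat n / 2) (k - n) x = prod ?z {..<2*N}"
    unfolding reduced_basis_def using k by (subst prod_if_less) auto
  moreover have "reduced_basis 0 k x = prod ?w {..<2*N}"
    unfolding reduced_basis_def using k by (subst prod_if_less) auto
  ultimately have "cmod (reduced_basis (of_nat n / 2) (k - n) x - reduced_basis 0 k x) \<le> ?c ^ card {..<2*N} * (\<Sum>j<2*N. cmod (?z j - ?w j))"
    using norm_prod_diff_le[of "{..<2*N}" ?c ?z ?w] c1 facw facz by auto
  also have "\<dots> \<le> exp 8 * ((8 * real n + 2 * real n ^ 2) * (real N ^ 2 / r))"
  proof (intro mult_mono sum_nonneg)
    show "?c ^ card {..<2*N} \<le> exp 8" using one_plus_small_power_le[OF r] by simp
    have "(\<Sum>j<2*N. cmod (?z j - ?w j)) \<le> (\<Sum>j<2*N. (2 * real n * real N + real n ^ 2) / r + (if j \<in> {k-n..<k} then 4 * real N ^ 2 / r else 0))"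
    proof (rule sum_mono)
      fix j assume j: "j \<in> {..<2*N}"
      have "cmod ((of_nat j)\<^sup>2 / x) = (real j)\<^sup>2 / r" using x by (simp add: norm_divide norm_power)
      also have "\<dots> \<le> (2 * real N)\<^sup>2 / r" using j r0 by (intro divide_right_mono power_mono) auto
      finally have 1: "cmod ((of_nat j)\<^sup>2 / x) \<le> 4 * real N ^ 2 / r" by (simp add: power_mult_distrib)
      have "((of_nat j + of_nat n / 2)\<^sup>2 / x - (of_nat j)\<^sup>2 / x) = of_real (real j * real n + real n ^ 2 / 4) / x"
        by (simp add: power2_eq_square algebra_simps add_divide_distrib)
      hence "cmod ((of_nat j + of_nat n / 2)\<^sup>2 / x - (of_nat j)\<^sup>2 / x) = (real j * real n + real n ^ 2 / 4) / r"
        using x by (simp only: norm_divide norm_of_real) simp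
      also have "\<dots> \<le> (2 * real n * real N + real n ^ 2) / r"
        using j r0 mult_left_mono[of "real j" "2 * real N" "real n"]
        by (intro divide_right_mono add_mono) (auto simp: mult_ac)
      finally have 2: "cmod ((of_nat j + of_nat n / 2)\<^sup>2 / x - (of_nat j)\<^sup>2 / x) \<le> (2 * real n * real N + real n ^ 2) / r" .
      have 3: "(2 * real n * real N + real n ^ 2) / r \<ge> 0" using r0 by simp
      show "cmod (?z j - ?w j) \<le> (2 * real n * real N + real n ^ 2) / r + (if j \<in> {k-n..<k} then 4 * real N ^ 2 / r else 0)"
        using 1 2 3 k by auto
    qed
    also have "\<dots> = 2 * real N * ((2 * real n * real N + real n ^ 2) / r) + real (card ({..<2*N} \<inter> {k-n..<k})) * (4 * real N ^ 2 / r)"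
      by (subst sum.distrib, subst sum.inter_restrict[symmetric]) auto
    also have "\<dots> \<le> 2 * real N * ((2 * real n * real N + real n ^ 2 * real N) / r) + real n * (4 * real N ^ 2 / r)"
    proof (intro add_mono mult_right_mono mult_left_mono divide_right_mono)
      have "card ({..<2*N} \<inter> {k-n..<k}) \<le> card {k-n..<k}" by (intro card_mono) auto
      also have "\<dots> \<le> n" using k by auto
      finally show "real (card ({..<2*N} \<inter> {k-n..<k})) \<le> real n" by simp
      have "real n ^ 2 * 1 \<le> real n ^ 2 * real N" using r by (intro mult_left_mono) auto
      thus "real n ^ 2 \<le> real n ^ 2 * real N" by simp
    qed (use r0 in auto)
    also have "\<dots> = (8 * real n + 2 * real n ^ 2) * (real N ^ 2 / r)"
      using r0 by (simp add: field_simps power2_eq_square)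
    finally show "(\<Sum>j<2*N. cmod (?z j - ?w j)) \<le> (8 * real n + 2 * real n ^ 2) * (real N ^ 2 / r)" .
  qed (use r0 in auto)
  finally show ?thesis by (simp add: mult_ac)
qed

lemma sum_squares_le: "(\<Sum>j<m. (real j)\<^sup>2) \<le> real m ^ 3 / 3"
proof (induction m)
  case (Suc m)
  have "(\<Sum>j<Suc m. (real j)\<^sup>2) \<le> real m ^ 3 / 3 + real m ^ 2" using Suc.IH by simp
  also have "\<dots> \<le> real (Suc m) ^ 3 / 3" by (simp add: power3_eq_cube power2_eq_square algebra_simps)
  finally show ?case .
qed simp

lemma one_minus_sum_le_prod:
  fixes u :: "nat \<Rightarrow> real"
  assumes "\<And>j. j < m \<Longrightarrow> 0 \<le> u j \<and> u j \<le> 1"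
  shows "1 - (\<Sum>j<m. u j) \<le> (\<Prod>j<m. 1 - u j)"
  using assms
proof (induction m)
  case (Suc m)
  have "(\<Prod>j<m. 1 - u j) \<le> 1" by (rule prod_le_1) (use Suc.prems in auto)
  hence "u m * (\<Prod>j<m. 1 - u j) \<le> u m * 1" using Suc.prems[of m] by (intro mult_left_mono) auto
  moreover have "1 - (\<Sum>j<m. u j) \<le> (\<Prod>j<m. 1 - u j)" using Suc by auto
  ultimately show ?case by (simp add: algebra_simps)
qed simp

text \<open>
  The lower bound makes it possible to divide by this factor and so to pass from a bound for the
  window sum of \<open>f\<close> to a bound for the corresponding power sum, to which Bernstein's inequality applies.
\<close>

lemma norm_reduced_basis_bounds:
  assumes x: "cmod x = r" and r: "real N ^ 3 \<le> r" "N > 0"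
  shows "cmod (reduced_basis 0 N x) \<le> exp 8" "cmod (reduced_basis 0 N x) \<ge> 1 / 2"
proof -
  have r0: "r > 0" using r by (smt (verit) of_nat_0_less_iff zero_less_power)
  let ?c = "1 + 4 * real N ^ 2 / r"
  have "cmod (reduced_basis 0 N x) = (\<Prod>j<N. cmod (1 + (of_nat j)\<^sup>2 / x))"
    unfolding reduced_basis_def by (simp add: prod_norm)
  also have "\<dots> \<le> (\<Prod>j<N. ?c)"
    using norm_reduced_factor_le[OF x r0, of _ 0 N] by (intro prod_mono) auto
  also have "\<dots> \<le> ?c ^ (2 * N)" using r0 by (simp, intro power_increasing) auto
  also have "\<dots> \<le> exp 8" by (rule one_plus_small_power_le[OF r])
  finally show "cmod (reduced_basis 0 N x) \<le> exp 8" .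
  have u: "(real j)\<^sup>2 / r \<in> {0..1}" if "j < N" for j
  proof -
    have "(real j)\<^sup>2 \<le> real N ^ 2" using that by (intro power_mono) auto
    also have "\<dots> \<le> real N ^ 3" using r by (intro power_increasing) auto
    finally show ?thesis using r r0 by simp
  qed
  have "1 - (\<Sum>j<N. (real j)\<^sup>2 / r) \<le> (\<Prod>j<N. 1 - (real j)\<^sup>2 / r)"
    by (rule one_minus_sum_le_prod) (use u in auto)
  also have "\<dots> \<le> (\<Prod>j<N. cmod (1 + (of_nat j)\<^sup>2 / x))"
  proof (intro prod_mono conjI)
    fix j assume "j \<in> {..<N}"
    thus "0 \<le> 1 - (real j)\<^sup>2 / r" using u[of j] by simp
    have "cmod ((of_nat j)\<^sup>2 / x) = (real j)\<^sup>2 / r" using x by (simp add: norm_divide norm_power)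
    thus "1 - (real j)\<^sup>2 / r \<le> cmod (1 + (of_nat j)\<^sup>2 / x)"
      by (metis add.commute diff_le_eq norm_add_leD norm_one add_diff_cancel_left' norm_diff_ineq)
  qed
  also have "\<dots> = cmod (reduced_basis 0 N x)"
    unfolding reduced_basis_def by (simp add: prod_norm)
  finally have "1 - (\<Sum>j<N. (real j)\<^sup>2 / r) \<le> cmod (reduced_basis 0 N x)" .
  moreover have "(\<Sum>j<N. (real j)\<^sup>2 / r) \<le> 1 / 2"
  proof -
    have "(\<Sum>j<N. (real j)\<^sup>2) / r \<le> (r / 3) / r" using sum_squares_le[of N] r r0 by (intro divide_right_mono) auto
    thus ?thesis using r0 by (simp add: sum_divide_distrib)
  qed
  ultimately show "cmod (reduced_basis 0 N x) \<ge> 1 / 2" by simp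
qed

lemma falling_factorial_ratio:
  assumes k: "k \<in> {N-K..N+K}" "n \<le> k" and K: "1 \<le> K" "K \<le> N"
  shows "cmod (falling_factorial n k / of_nat N ^ n) \<le> 2 ^ n"
    and "cmod (falling_factorial n k / of_nat N ^ n - 1) \<le> 2 ^ n * real n * (1 + real n) * (real K / real N)"
proof -
  let ?z = "\<lambda>i. (of_nat k - of_nat i) / of_nat N :: complex"
  have eq: "falling_factorial n k / of_nat N ^ n = (\<Prod>i<n. ?z i)"
    unfolding falling_factorial_def prod_dividef by simp
  have z: "cmod (?z i) \<le> 2" if "i < n" for i
  proof -
    have "?z i = of_real ((real k - real i) / real N)" by simp
    hence "cmod (?z i) = \<bar>(real k - real i) / real N\<bar>" by (simp only: norm_of_real)
    also have "\<dots> \<le> 2" using that k K by (auto simp: abs_le_iff field_simps)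
    finally show ?thesis .
  qed
  have "(\<Prod>i<n. cmod (?z i)) \<le> (\<Prod>i<n. 2)" by (intro prod_mono) (use z in auto)
  thus "cmod (falling_factorial n k / of_nat N ^ n) \<le> 2 ^ n" unfolding eq prod_norm by simp
  have "cmod ((\<Prod>i<n. ?z i) - (\<Prod>i<n. 1)) \<le> 2 ^ card {..<n} * (\<Sum>i<n. cmod (?z i - 1))"
    by (rule norm_prod_diff_le) (use z in auto)
  also have "\<dots> \<le> 2 ^ n * (\<Sum>i<n. (1 + real n) * (real K / real N))"
  proof (simp only: card_lessThan, intro mult_left_mono sum_mono)
    fix i assume i: "i \<in> {..<n}"
    have "?z i - 1 = of_real ((real k - real i - real N) / real N)" using K by (simp add: field_simps)
    hence "cmod (?z i - 1) = \<bar>(real k - real i - real N) / real N\<bar>" by (simp only: norm_of_real)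
    also have "\<dots> = \<bar>real k - real i - real N\<bar> / real N" by simp
    also have "\<dots> \<le> (real K + real n * real K) / real N"
    proof (intro divide_right_mono)
      have "real n * 1 \<le> real n * real K" using K by (intro mult_left_mono) auto
      moreover have "\<bar>real k - real i - real N\<bar> \<le> real K + real n" using i k K by (auto simp: abs_le_iff)
      ultimately show "\<bar>real k - real i - real N\<bar> \<le> real K + real n * real K" by simp
    qed simp
    finally show "cmod (?z i - 1) \<le> (1 + real n) * (real K / real N)" by (simp add: algebra_simps)
  qed simp
  finally show "cmod (falling_factorial n k / of_nat N ^ n - 1) \<le> 2 ^ n * real n * (1 + real n) * (real K / real N)"
    unfolding eq by (simp add: mult_ac)
qed

text \<open>
  With \<open>\<rho> m k = k (k-1) \<dots> (k-m+1) / N ^ m\<close> one has \<open>\<rho> (m+1) k - \<rho> m k = ((k - N) - m) / N * \<rho> m k\<close>, and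
  \<open>bernstein_window\<close> controls the multiplier \<open>k - N\<close>. Both bounds are needed at once in the induction.
\<close>

lemma bernstein_falling_factorial:
  fixes a :: "nat \<Rightarrow> complex"
  assumes r: "r > 0" and S: "\<And>z. cmod z = r \<Longrightarrow> cmod (\<Sum>k=N-K..N+K. a k * z ^ k) \<le> S0"
    and K: "1 \<le> K" "K \<le> N" and m: "m \<le> N" and x: "cmod x = r"
  shows "cmod (\<Sum>k=N-K..N+K. falling_factorial m k / of_nat N ^ m * a k * x ^ k) \<le> 9 ^ m * S0 \<and>
    cmod (\<Sum>k=N-K..N+K. (falling_factorial m k / of_nat N ^ m - 1) * a k * x ^ k) \<le> (\<Sum>i<m. (7 + real i) * 9 ^ i) * (real K / real N) * S0"
  using m x
proof (induction m arbitrary: x)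
  case 0
  thus ?case using S[of x] by (simp add: falling_factorial_def)
next
  case (Suc m)
  let ?J = "{N-K..N+K}"
  let ?\<rho> = "\<lambda>m k. falling_factorial m k / of_nat N ^ m"
  have N0: "real N > 0" using Suc.prems by simp
  have S00: "S0 \<ge> 0" using S[OF Suc.prems(2)] by (smt (verit) norm_ge_zero)
  have IH1: "cmod (\<Sum>k\<in>?J. ?\<rho> m k * a k * z ^ k) \<le> 9 ^ m * S0" if "cmod z = r" for z
    using Suc.IH[of z] that Suc.prems by simp
  have IH2: "cmod (\<Sum>k\<in>?J. (?\<rho> m k - 1) * a k * x ^ k) \<le> (\<Sum>i<m. (7 + real i) * 9 ^ i) * (real K / real N) * S0"
    using Suc.IH[of x] Suc.prems by simp
  have B: "cmod (\<Sum>k\<in>?J. (of_nat k - of_nat N) * (?\<rho> m k * a k) * x ^ k) \<le> 7 * real K * (9 ^ m * S0)"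
    by (rule bernstein_window[OF r _ Suc.prems(2) K(2)]) (use IH1 in auto)
  define d where "d = (\<Sum>k\<in>?J. (?\<rho> (Suc m) k - ?\<rho> m k) * a k * x ^ k)"
  have step: "?\<rho> (Suc m) k - ?\<rho> m k = ((of_nat k - of_nat N) * ?\<rho> m k - of_nat m * ?\<rho> m k) / of_nat N" for k
  proof -
    have e1: "?\<rho> (Suc m) k = ?\<rho> m k * ((of_nat k - of_nat m) / of_nat N)"
      by (simp add: falling_factorial_def)
    have e2: "R * ((u - v) / c) - R = ((u - c) * R - v * R) / c" if "c \<noteq> 0" for R u v c :: complex
      using that by (simp add: field_simps)
    show ?thesis unfolding e1 by (rule e2) (use N0 in simp)
  qed
  let ?X = "\<Sum>k\<in>?J. (of_nat k - of_nat N) * (?\<rho> m k * a k) * x ^ k"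
  let ?Y = "\<Sum>k\<in>?J. ?\<rho> m k * a k * x ^ k"
  have ring: "(p * R - q * R) / c * s * t = (p * (R * s) * t - q * (R * s * t)) / c" for p q R s t c :: complex
    by (simp add: left_diff_distrib mult.assoc)
  have deq: "d = ((\<Sum>k\<in>?J. (of_nat k - of_nat N) * (?\<rho> m k * a k) * x ^ k) - of_nat m * (\<Sum>k\<in>?J. ?\<rho> m k * a k * x ^ k)) / of_nat N"
    unfolding d_def step sum_distrib_left sum_subtractf[symmetric] sum_divide_distrib
    by (intro sum.cong refl) (rule ring)
  have "cmod d \<le> (7 * real K * (9 ^ m * S0) + real m * (9 ^ m * S0)) / real N"
  proof -
    have "cmod (?X - of_nat m * ?Y) \<le> cmod ?X + real m * cmod ?Y"
      using norm_triangle_ineq4[of ?X "of_nat m * ?Y"] by (simp only: norm_mult[of "of_nat m"] norm_of_nat)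
    also have "\<dots> \<le> 7 * real K * (9 ^ m * S0) + real m * (9 ^ m * S0)"
      by (intro add_mono B mult_left_mono IH1 Suc.prems) simp
    finally show ?thesis unfolding deq norm_divide norm_of_nat by (intro divide_right_mono) auto
  qed
  also have "\<dots> = (7 * real K + real m) / real N * (9 ^ m * S0)" by (simp add: field_simps)
  finally have d1: "cmod d \<le> (7 * real K + real m) / real N * (9 ^ m * S0)" .
  have "(7 * real K + real m) / real N \<le> (7 + real m) * (real K / real N)"
  proof -
    have "real m * 1 \<le> real m * real K" using K by (intro mult_left_mono) auto
    hence "(7 * real K + real m) / real N \<le> (7 * real K + real m * real K) / real N"
      using N0 by (intro divide_right_mono) auto
    also have "\<dots> = (7 + real m) * (real K / real N)" by (simp add: distrib_right add_divide_distrib)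
    finally show ?thesis .
  qed
  hence d2: "cmod d \<le> (7 + real m) * (real K / real N) * (9 ^ m * S0)"
    using d1 S00 by (meson mult_right_mono order_trans zero_le_mult_iff zero_le_numeral zero_le_power)
  have "(7 * real K + real m) / real N \<le> 8" using K Suc.prems(1) N0 by (simp add: field_simps)
  hence d3: "cmod d \<le> 8 * (9 ^ m * S0)"
    using d1 S00 by (meson mult_right_mono order_trans zero_le_mult_iff zero_le_numeral zero_le_power)
  have s1: "(\<Sum>k\<in>?J. ?\<rho> (Suc m) k * a k * x ^ k) = (\<Sum>k\<in>?J. ?\<rho> m k * a k * x ^ k) + d"
    unfolding d_def sum.distrib[symmetric] by (intro sum.cong refl) (simp only: algebra_simps)
  have s2: "(\<Sum>k\<in>?J. (?\<rho> (Suc m) k - 1) * a k * x ^ k) = (\<Sum>k\<in>?J. (?\<rho> m k - 1) * a k * x ^ k) + d"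
    unfolding d_def sum.distrib[symmetric] by (intro sum.cong refl) (simp only: algebra_simps)
  show ?case
  proof
    have nine: "9 ^ m * S0 + 8 * (9 ^ m * S0) = 9 ^ Suc m * S0" by simp
    have "cmod ((\<Sum>k\<in>?J. ?\<rho> m k * a k * x ^ k) + d) \<le> 9 ^ m * S0 + 8 * (9 ^ m * S0)"
      by (intro norm_triangle_mono IH1 d3 Suc.prems)
    thus "cmod (\<Sum>k\<in>?J. ?\<rho> (Suc m) k * a k * x ^ k) \<le> 9 ^ Suc m * S0"
      unfolding s1 by (simp only: nine)
    have "cmod ((\<Sum>k\<in>?J. (?\<rho> m k - 1) * a k * x ^ k) + d) \<le>
        (\<Sum>i<m. (7 + real i) * 9 ^ i) * (real K / real N) * S0 + (7 + real m) * (real K / real N) * (9 ^ m * S0)"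
      by (intro norm_triangle_mono IH2 d2)
    thus "cmod (\<Sum>k\<in>?J. (?\<rho> (Suc m) k - 1) * a k * x ^ k) \<le> (\<Sum>i<Suc m. (7 + real i) * 9 ^ i) * (real K / real N) * S0"
      unfolding s2 by (simp add: algebra_simps)
  qed
qed

section \<open>Weights and the decay away from the central index\<close>

text \<open>
  The logarithm of the weight at \<open>x\<close>. It increases to a finite limit, but only barely: its derivative
  \<open>log_weight_slope\<close> is of the order \<open>1 / (x ln x (ln ln x) powr (1 + d))\<close>. The shift by \<open>16\<close> makes
  the iterated logarithm positive for all \<open>x \<ge> 0\<close>.
\<close>

definition log_weight :: "real \<Rightarrow> real \<Rightarrow> real" where
  "log_weight d x = ln (ln 16) powr (- d) - ln (ln (x + 16)) powr (- d)"

definition log_weight_slope :: "real \<Rightarrow> real \<Rightarrow> real" where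
  "log_weight_slope d x = d * ln (ln (x + 16)) powr (- d - 1) / ((x + 16) * ln (x + 16))"

lemma one_less_ln_16: "x \<ge> 0 \<Longrightarrow> 1 < ln (x + 16 :: real)"
proof -
  assume "x \<ge> 0"
  hence "exp 1 < x + 16" using exp_le by linarith
  hence "ln (exp 1) < ln (x + 16)" using \<open>x \<ge> 0\<close> by (subst ln_less_cancel_iff) auto
  thus ?thesis by simp
qed

lemma log_weight_slope_pos: "d > 0 \<Longrightarrow> x \<ge> 0 \<Longrightarrow> log_weight_slope d x > 0"
  using one_less_ln_16[of x] unfolding log_weight_slope_def by (intro divide_pos_pos mult_pos_pos) auto

lemma log_weight_slope_antimono:
  assumes "d > 0" "0 \<le> x" "x \<le> y"
  shows "log_weight_slope d y \<le> log_weight_slope d x"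
proof -
  have l: "1 < ln (x + 16)" "ln (x + 16) \<le> ln (y + 16)" using assms one_less_ln_16[of x] by auto
  hence ll: "0 < ln (ln (x + 16))" "ln (ln (x + 16)) \<le> ln (ln (y + 16))" by auto
  show ?thesis
    unfolding log_weight_slope_def
  proof (rule frac_le)
    show "d * ln (ln (y + 16)) powr (- d - 1) \<le> d * ln (ln (x + 16)) powr (- d - 1)"
      using assms ll by (intro mult_left_mono powr_mono2') auto
    show "(x + 16) * ln (x + 16) \<le> (y + 16) * ln (y + 16)"
      using assms l by (intro mult_mono) auto
    show "0 < (x + 16) * ln (x + 16)" using assms l by simp
  qed (use assms in auto)
qed

lemma log_weight_diff_ge:
  assumes d: "d > 0" and xy: "0 \<le> x" "x \<le> y" "y \<le> z"
  shows "log_weight d y - log_weight d x \<ge> (y - x) * log_weight_slope d z"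
proof (cases "x = y")
  case False
  have der: "DERIV (log_weight d) t :> log_weight_slope d t" if "x \<le> t" for t
  proof -
    have t: "t + 16 > 0" "ln (t + 16) > 0" "ln (ln (t + 16)) > 0"
      using one_less_ln_16[of t] xy that by auto
    show ?thesis unfolding log_weight_def[abs_def] log_weight_slope_def
      using t by (auto intro!: derivative_eq_intros simp: field_simps)
  qed
  obtain t where t: "x < t" "t < y" "log_weight d y - log_weight d x = (y - x) * log_weight_slope d t"
    using MVT2[of x y "log_weight d" "log_weight_slope d"] der False xy by force
  have "log_weight_slope d z \<le> log_weight_slope d t"
    using t xy d by (intro log_weight_slope_antimono) auto
  thus ?thesis using t by simp
qed simp

lemma log_weight_mono: "d > 0 \<Longrightarrow> 0 \<le> x \<Longrightarrow> x \<le> y \<Longrightarrow> log_weight d x \<le> log_weight d y"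
  using log_weight_diff_ge[of d x y y] log_weight_slope_pos[of d y] mult_nonneg_nonneg[of "y - x" "log_weight_slope d y"]
  by linarith

text \<open>
  Partial sums grow like \<open>m * q / 2\<close>: quadratically up to \<open>q\<close> and linearly afterwards. This gives
  an exponential rate that serves near the central index and far away from it.
\<close>

lemma sum_min_ge:
  assumes "q \<le> m" "q \<le> N"
  shows "(\<Sum>i<m. real (min i N)) \<ge> real m * (real q - 1) / 2"
  using assms
proof (induction m rule: dec_induct)
  case base
  have "(\<Sum>i<p. real (min i N)) = real p * (real p - 1) / 2" if "p \<le> N" for p
    using that by (induction p) (auto simp: field_simps)
  thus ?case using base by simp
next
  case (step m)
  have "real (min m N) \<ge> (real q - 1) / 2" using step by (simp add: min_def)
  moreover have "real m * (real q - 1) / 2 \<le> (\<Sum>i<m. real (min i N))" using step by simp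
  ultimately have "real m * (real q - 1) / 2 + (real q - 1) / 2 \<le> (\<Sum>i<Suc m. real (min i N))"
    unfolding sum.lessThan_Suc by (intro add_mono)
  thus ?case by (simp add: algebra_simps add_divide_distrib diff_divide_distrib)
qed

text \<open>
  For \<open>j \<ge> N\<close>, \<open>ln (\<beta> N / \<beta> j)\<close> is at most \<open>- D * min (j - N) N\<close>: the slope is decreasing, so it is at least \<open>D\<close>
  as long as \<open>j \<le> 2 * N\<close>, and beyond that point monotonicity suffices. Below \<open>N\<close> the slope is at least \<open>D\<close> throughout.
\<close>

lemma prod_weight_ratio_le:
  fixes N q k :: nat
  assumes d: "d > 0" and qN: "q \<le> N"
  defines "\<beta> \<equiv> \<lambda>j::nat. exp (log_weight d (real j))"
    and "D \<equiv> log_weight_slope d (2 * real N)"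
  shows "k + q \<le> N \<Longrightarrow> (\<Prod>j=k..<N. \<beta> j / \<beta> N) \<le> exp (- D * (real q - 1) / 2 * \<bar>real k - real N\<bar>)"
    and "N + q \<le> k \<Longrightarrow> (\<Prod>j=N..<k. \<beta> N / \<beta> j) \<le> exp (- D * (real q - 1) / 2 * \<bar>real k - real N\<bar>)"
proof -
  have D0: "D > 0" unfolding D_def using d by (intro log_weight_slope_pos) auto
  show "(\<Prod>j=k..<N. \<beta> j / \<beta> N) \<le> exp (- D * (real q - 1) / 2 * \<bar>real k - real N\<bar>)" if k: "k + q \<le> N"
  proof -
    have "(\<Prod>j=k..<N. \<beta> j / \<beta> N) = exp (\<Sum>j=k..<N. log_weight d (real j) - log_weight d (real N))"
      unfolding \<beta>_def by (simp add: exp_sum exp_diff)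
    also have "\<dots> \<le> exp (\<Sum>j=k..<N. - (D * real (min (N - Suc j) N)))"
    proof (simp only: exp_le_cancel_iff, rule sum_mono)
      fix j assume j: "j \<in> {k..<N}"
      have "(real N - real j) * D \<le> log_weight d (real N) - log_weight d (real j)"
        unfolding D_def using j d by (intro log_weight_diff_ge) auto
      moreover have "D * real (min (N - Suc j) N) \<le> D * (real N - real j)"
        using j D0 by (intro mult_left_mono) auto
      ultimately show "log_weight d (real j) - log_weight d (real N) \<le> - (D * real (min (N - Suc j) N))"
        by (simp add: mult.commute)
    qed
    also have "(\<Sum>j=k..<N. - (D * real (min (N - Suc j) N))) = - D * (\<Sum>j=k..<N. real (min (N - Suc j) N))"
      by (simp add: sum_distrib_left sum_negf)
    also have "(\<Sum>j=k..<N. real (min (N - Suc j) N)) = (\<Sum>i<N-k. real (min i N))"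
      by (rule sum.reindex_bij_witness[of _ "\<lambda>i. N - Suc i" "\<lambda>j. N - Suc j"]) (use k in auto)
    also have "exp (- D * (\<Sum>i<N-k. real (min i N))) \<le> exp (- D * (real (N - k) * (real q - 1) / 2))"
      using sum_min_ge[of q "N - k" N] k qN D0 by simp
    also have "- D * (real (N - k) * (real q - 1) / 2) = - D * (real q - 1) / 2 * \<bar>real k - real N\<bar>"
      using k by (simp add: of_nat_diff)
    finally show ?thesis .
  qed
  show "(\<Prod>j=N..<k. \<beta> N / \<beta> j) \<le> exp (- D * (real q - 1) / 2 * \<bar>real k - real N\<bar>)" if k: "N + q \<le> k"
  proof -
    have "(\<Prod>j=N..<k. \<beta> N / \<beta> j) = exp (\<Sum>j=N..<k. log_weight d (real N) - log_weight d (real j))"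
      unfolding \<beta>_def by (simp add: exp_sum exp_diff)
    also have "\<dots> \<le> exp (\<Sum>j=N..<k. - (D * real (min (j - N) N)))"
    proof (simp only: exp_le_cancel_iff, rule sum_mono)
      fix j assume j: "j \<in> {N..<k}"
      define y where "y = real N + real (min (j - N) N)"
      have y: "y \<le> real j" "y \<le> 2 * real N" "real N \<le> y" unfolding y_def using j by (auto simp: min_def)
      have "(y - real N) * D \<le> log_weight d y - log_weight d (real N)"
        unfolding D_def using y d by (intro log_weight_diff_ge) auto
      also have "\<dots> \<le> log_weight d (real j) - log_weight d (real N)"
        using log_weight_mono[of d y "real j"] y d by simp
      finally show "log_weight d (real N) - log_weight d (real j) \<le> - (D * real (min (j - N) N))"
        unfolding y_def by (simp add: mult.commute)
    qed
    also have "(\<Sum>j=N..<k. - (D * real (min (j - N) N))) = - D * (\<Sum>j=N..<k. real (min (j - N) N))"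
      by (simp add: sum_distrib_left sum_negf)
    also have "(\<Sum>j=N..<k. real (min (j - N) N)) = (\<Sum>i<k-N. real (min i N))"
      by (rule sum.reindex_bij_witness[of _ "\<lambda>i. N + i" "\<lambda>j. j - N"]) (use k in auto)
    also have "exp (- D * (\<Sum>i<k-N. real (min i N))) \<le> exp (- D * (real (k - N) * (real q - 1) / 2))"
      using sum_min_ge[of q "k - N" N] k qN D0 by simp
    also have "- D * (real (k - N) * (real q - 1) / 2) = - D * (real q - 1) / 2 * \<bar>real k - real N\<bar>"
      using k by (simp add: of_nat_diff)
    finally show ?thesis .
  qed
qed

lemma tail_bound:
  fixes t :: "nat \<Rightarrow> complex"
  assumes t: "t sums T" and z: "z > 0" and c: "c \<ge> 0"
    and b: "\<And>k. k \<notin> {N-K..N+K} \<Longrightarrow> cmod (t k) \<le> c * exp (- z * \<bar>real k - real N\<bar>)"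
  shows "cmod (T - (\<Sum>k=N-K..N+K. t k)) \<le> c * (2 * (1 + 1 / z))"
proof -
  let ?q = "exp (- z)"
  let ?g = "\<lambda>k::nat. exp (- z * \<bar>real k - real N\<bar>)"
  have q: "?q < 1" "?q > 0" using z by auto
  have inv: "1 / (1 - ?q) \<le> 1 + 1 / z"
  proof -
    have "1 + z \<le> exp z" by (rule exp_ge_add_one_self)
    hence "?q \<le> 1 / (1 + z)" using z by (simp add: exp_minus inverse_eq_divide frac_le)
    hence "1 - ?q \<ge> z / (1 + z)" using z by (simp add: field_simps)
    hence "1 / (1 - ?q) \<le> 1 / (z / (1 + z))" using z by (intro divide_left_mono mult_pos_pos) (use q in auto)
    also have "\<dots> = 1 + 1 / z" using z by (simp add: field_simps)
    finally show ?thesis .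
  qed
  have geo: "summable (\<lambda>k. ?q ^ k)" "(\<Sum>k. ?q ^ k) = 1 / (1 - ?q)"
    using q by (auto intro!: summable_geometric suminf_geometric)
  have shift: "?g (k + N) = ?q ^ k" for k
    by (simp add: exp_of_nat_mult[symmetric] mult.commute)
  have sg: "summable ?g"
    using geo(1) unfolding shift[symmetric] by (rule summable_iff_shift[THEN iffD1])
  have "(\<Sum>k<N. ?g k) = (\<Sum>i<N. ?q ^ Suc i)"
  proof (rule sum.reindex_bij_witness[of _ "\<lambda>i. N - Suc i" "\<lambda>i. N - Suc i"])
    fix k assume "k \<in> {..<N}"
    hence "\<bar>real k - real N\<bar> = real (Suc (N - Suc k))" by auto
    thus "?q ^ Suc (N - Suc k) = ?g k"
      by (metis exp_of_nat_mult mult.commute)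
  qed auto
  also have "\<dots> \<le> (\<Sum>i<N. ?q ^ i)" using q by (intro sum_mono power_decreasing) auto
  also have "\<dots> \<le> 1 / (1 - ?q)" unfolding geo(2)[symmetric] by (rule sum_le_suminf[OF geo(1)]) auto
  finally have "(\<Sum>k<N. ?g k) \<le> 1 / (1 - ?q)" .
  hence "suminf ?g \<le> 2 * (1 / (1 - ?q))"
    using suminf_split_initial_segment[OF sg, of N] unfolding shift geo(2) by simp
  hence sum_g: "suminf ?g \<le> 2 * (1 + 1 / z)" using inv by simp
  let ?J = "{N-K..N+K}"
  have "(\<lambda>k. if k \<in> ?J then t k else 0) sums (\<Sum>k\<in>?J. t k)" by (rule sums_If_finite_set) simp
  from sums_diff[OF t this] have s: "(\<lambda>k. t k - (if k \<in> ?J then t k else 0)) sums (T - (\<Sum>k\<in>?J. t k))" .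
  have "cmod (suminf (\<lambda>k. t k - (if k \<in> ?J then t k else 0))) \<le> suminf (\<lambda>k. c * ?g k)"
  proof (rule norm_suminf_le)
    fix k show "cmod (t k - (if k \<in> ?J then t k else 0)) \<le> c * ?g k"
      using b[of k] c by (cases "k \<in> ?J") auto
  qed (intro summable_mult sg)
  also have "\<dots> = c * suminf ?g" by (rule suminf_mult[OF sg])
  also have "\<dots> \<le> c * (2 * (1 + 1 / z))" by (intro mult_left_mono sum_g c)
  finally show ?thesis using s by (simp add: sums_iff)
qed

text \<open>
  The exponent at the edge of the window is about \<open>slope * \<kappa>\<^sup>2\<close>. The weight has the exponent \<open>d / 2\<close>
  and \<open>\<kappa>\<^sup>2\<close> contains the exponent \<open>1 + d\<close>, which leaves the factor \<open>(ln (ln N)) powr (d / 2)\<close> over and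
  beats every multiple of \<open>ln N\<close>.
\<close>

lemma eventually_slope_large:
  assumes "d > 0"
  shows "eventually (\<lambda>N::real. log_weight_slope (d / 2) (2 * N) * (N * (ln N)\<^sup>2 * ln (ln N) powr (1 + d)) \<ge> 192 * ln N) at_top"
  using assms unfolding log_weight_slope_def by real_asymp

lemma eventually_slope_sqrt_large:
  assumes "d > 0"
  shows "eventually (\<lambda>N::real. log_weight_slope (d / 2) (2 * N) * sqrt (N * (ln N)\<^sup>2 * ln (ln N) powr (1 + d)) * N \<ge> c) at_top"
  using assms unfolding log_weight_slope_def by real_asymp

lemma eventually_kappa_le:
  assumes "d > 0" "\<eta> > 0"
  shows "eventually (\<lambda>N::real. N * (ln N)\<^sup>2 * ln (ln N) powr (1 + d) \<le> N powr (1 + \<eta>)) at_top"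
    and "eventually (\<lambda>N::real. sqrt (N * (ln N)\<^sup>2 * ln (ln N) powr (1 + d)) \<le> N / 2) at_top"
    and "eventually (\<lambda>N::real. sqrt (N * (ln N)\<^sup>2 * ln (ln N) powr (1 + d)) \<ge> 2) at_top"
  using assms by real_asymp+

section \<open>Normal radii and the exceptional set\<close>

text \<open>
  On \<open>{l n..u n} \<inter> {1..}\<close> the density is at most \<open>1 / max 1 (l n)\<close>.
\<close>

lemma log_measure_UN_less_top:
  fixes l u :: "nat \<Rightarrow> real"
  assumes le: "\<And>n. l n \<le> u n" and sm: "summable (\<lambda>n. (u n - l n) / max 1 (l n))"
  shows "log_measure ({1..} \<inter> (\<Union>n. {l n..u n})) < \<infinity>"
proof -
  let ?M = "density lebesgue (\<lambda>x::real. ennreal (1 / x))"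
  have meas: "(\<lambda>x::real. ennreal (1 / x)) \<in> borel_measurable lebesgue"
    by (intro measurable_completion) simp
  have eq: "emeasure ?M X = (\<integral>\<^sup>+x\<in>X. ennreal (1 / x) \<partial>lebesgue)" if "X \<in> sets lebesgue" for X
    using that meas by (simp add: emeasure_density)
  have sets: "{1..} \<inter> {l n..u n} \<in> sets lebesgue" for n by simp
  have piece: "emeasure ?M ({1..} \<inter> {l n..u n}) \<le> ennreal ((u n - l n) / max 1 (l n))" for n
  proof -
    have "emeasure ?M ({1..} \<inter> {l n..u n}) = (\<integral>\<^sup>+x\<in>{1..} \<inter> {l n..u n}. ennreal (1 / x) \<partial>lebesgue)"
      by (rule eq[OF sets])
    also have "\<dots> \<le> (\<integral>\<^sup>+x. ennreal (1 / max 1 (l n)) * indicator {l n..u n} x \<partial>lebesgue)"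
    proof (rule nn_integral_mono)
      fix x :: real
      show "ennreal (1 / x) * indicator ({1..} \<inter> {l n..u n}) x \<le> ennreal (1 / max 1 (l n)) * indicator {l n..u n} x"
        by (auto simp: indicator_def intro!: ennreal_leI frac_le)
    qed
    also have "\<dots> = ennreal (1 / max 1 (l n)) * ennreal (u n - l n)"
      using le[of n] by (subst nn_integral_cmult_indicator) auto
    also have "\<dots> = ennreal ((u n - l n) / max 1 (l n))"
      using le[of n] by (subst ennreal_mult[symmetric]) auto
    finally show ?thesis .
  qed
  have "log_measure ({1..} \<inter> (\<Union>n. {l n..u n})) = emeasure ?M (\<Union>n. {1..} \<inter> {l n..u n})"
    unfolding log_measure_def by (subst eq) (auto simp: Int_UN_distrib)
  also have "\<dots> \<le> (\<Sum>n. emeasure ?M ({1..} \<inter> {l n..u n}))"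
    by (rule emeasure_subadditive_countably) auto
  also have "\<dots> \<le> (\<Sum>n. ennreal ((u n - l n) / max 1 (l n)))"
    by (intro suminf_le piece) auto
  also have "\<dots> = ennreal (\<Sum>n. (u n - l n) / max 1 (l n))"
    by (rule suminf_ennreal2[OF _ sm]) (use le in \<open>auto intro!: divide_nonneg_pos\<close>)
  also have "\<dots> < \<infinity>" by simp
  finally show ?thesis .
qed

definition weighted_term :: "(nat \<Rightarrow> real) \<Rightarrow> (nat \<Rightarrow> real) \<Rightarrow> real \<Rightarrow> nat \<Rightarrow> real" where
  "weighted_term A \<beta> s k = A k * (\<Prod>j<k. \<beta> j * (s + (real j)\<^sup>2))"

definition last_maximum :: "(nat \<Rightarrow> real) \<Rightarrow> nat \<Rightarrow> bool" where
  "last_maximum c n \<longleftrightarrow> (\<forall>k<n. c k \<le> c n) \<and> (\<forall>k>n. c k < c n)"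

lemma last_maximum_ge: "last_maximum c n \<Longrightarrow> c k \<le> c n"
  unfolding last_maximum_def by (metis linorder_neqE_nat order.refl less_imp_le)

lemma last_maximum_exists:
  fixes c :: "nat \<Rightarrow> real"
  assumes "c k1 > 0" and "\<exists>k0. \<forall>k\<ge>k0. c k < c k1"
  shows "\<exists>n. last_maximum c n"
proof -
  obtain k0 where k0: "\<And>k. k \<ge> k0 \<Longrightarrow> c k < c k1" using assms(2) by blast
  define m where "m = Max (c ` {..k0 + k1})"
  have le: "c k \<le> m" if "k \<le> k0 + k1" for k unfolding m_def using that by (intro Max_ge) auto
  have "m \<in> c ` {..k0 + k1}" unfolding m_def by (intro Max_in) auto
  hence ne: "{k. k \<le> k0 + k1 \<and> c k = m} \<noteq> {}" by auto
  define n where "n = Max {k. k \<le> k0 + k1 \<and> c k = m}"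
  have "n \<in> {k. k \<le> k0 + k1 \<and> c k = m}" unfolding n_def using ne by (intro Max_in) auto
  hence n: "n \<le> k0 + k1" "c n = m" by auto
  have nmax: "k \<le> n" if "k \<le> k0 + k1" "c k = m" for k
    unfolding n_def by (rule Max_ge) (use that in auto)
  have m1: "c k1 \<le> m" by (rule le) simp
  have "last_maximum c n"
    unfolding last_maximum_def
  proof (intro conjI allI impI)
    fix k assume "k < n" thus "c k \<le> c n" using n le by simp
  next
    fix k assume k: "n < k"
    show "c k < c n"
    proof (cases "k \<le> k0 + k1")
      case True
      thus ?thesis using nmax[of k] le[of k] n k by fastforce
    next
      case False
      hence "c k < c k1" by (intro k0) simp
      thus ?thesis using m1 n by simp
    qed
  qed
  thus ?thesis ..
qed

lemma weighted_term_rescale: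
  assumes "s > 0"
  shows "weighted_term A \<beta> s' k = weighted_term A \<beta> s k * (\<Prod>j<k. (s' + (real j)\<^sup>2) / (s + (real j)\<^sup>2))"
proof -
  have "s + (real j)\<^sup>2 \<noteq> 0" for j using assms by (smt (verit) zero_le_power2)
  thus ?thesis unfolding weighted_term_def mult.assoc prod.distrib[symmetric] by simp
qed

text \<open>
  The ratio of the \<open>k\<close>-th terms at \<open>s'\<close> and at \<open>s\<close> is nondecreasing in \<open>k\<close>, so the maximum can only move to
  the right.
\<close>

lemma last_maximum_weighted_term_mono:
  assumes A: "\<And>k. A k \<ge> 0" and \<beta>: "\<And>k. \<beta> k \<ge> (1::real)" and s: "0 < s" "s < s'"
    and N: "last_maximum (weighted_term A \<beta> s) N" and N': "last_maximum (weighted_term A \<beta> s') N'"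
  shows "N \<le> N'"
proof (rule ccontr)
  assume "\<not> N \<le> N'"
  hence less: "N' < N" by simp
  define \<rho> where "\<rho> = (\<lambda>k. \<Prod>j<k. (s' + (real j)\<^sup>2) / (s + (real j)\<^sup>2))"
  have pos: "s + (real j)\<^sup>2 > 0" for j using s by (smt (verit) zero_le_power2)
  have ge1: "(s' + (real j)\<^sup>2) / (s + (real j)\<^sup>2) \<ge> 1" for j using pos[of j] s by simp
  have \<rho>0: "\<rho> k \<ge> 0" for k unfolding \<rho>_def by (intro prod_nonneg) (use ge1 in \<open>smt (verit)\<close>)
  have \<rho>m: "\<rho> N' \<le> \<rho> N" unfolding \<rho>_def
    by (rule prod_mono2) (use less ge1 in \<open>auto intro: order_trans[OF zero_le_one]\<close>)
  have nn: "weighted_term A \<beta> s N \<ge> 0" unfolding weighted_term_def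
    using A \<beta> pos by (intro mult_nonneg_nonneg prod_nonneg) (auto intro: order_trans[OF zero_le_one] less_imp_le)
  have "weighted_term A \<beta> s' N' = weighted_term A \<beta> s N' * \<rho> N'"
    unfolding \<rho>_def by (rule weighted_term_rescale) (use s in simp)
  also have "\<dots> \<le> weighted_term A \<beta> s N * \<rho> N"
    using last_maximum_ge[OF N, of N'] by (intro mult_mono \<rho>m \<rho>0 nn)
  also have "\<dots> = weighted_term A \<beta> s' N"
    unfolding \<rho>_def by (rule weighted_term_rescale[symmetric]) (use s in simp)
  finally show False using N' less unfolding last_maximum_def by (meson not_less)
qed

lemma le_weight_factor:
  fixes b s t :: real
  assumes "b \<ge> 1" "s \<ge> t" "t \<ge> 0"
  shows "t \<le> b * (s + (real j)\<^sup>2)"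
proof -
  have "t \<le> s + (real j)\<^sup>2" using assms by (simp add: add_increasing2)
  thus ?thesis using mult_mono[of 1 b t "s + (real j)\<^sup>2"] assms by simp
qed

text \<open>
  Let \<open>S n\<close> be the point at which the last maximum of the weighted terms reaches the index \<open>n\<close>, and
  \<open>\<phi> n s = \<beta> n * s + (\<beta> n - 1) * n\<^sup>2\<close>, so that \<open>r = \<phi> n s\<close> means \<open>r + n\<^sup>2 = \<beta> n * (s + n\<^sup>2)\<close>. While the
  maximum stays at \<open>n\<close>, \<open>r = \<phi> n s\<close> runs through \<open>[\<phi> n (S n), \<phi> n (S (n+1)))\<close>; the gaps are
  \<open>[\<phi> n (S (n+1)), \<phi> (n+1) (S (n+1))]\<close>, and their union is the exceptional set.

  For \<open>r = \<phi> N s\<close> the quantity \<open>\<beta> N * (s + j\<^sup>2) - (r + j\<^sup>2)\<close> equals \<open>(\<beta> N - 1) * (j\<^sup>2 - N\<^sup>2)\<close>, which has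
  the sign that is required on either side of \<open>N\<close>. For this reason \<open>r\<close> is not simply taken as \<open>\<beta> N * s\<close>,
  the choice that is right for power series.
\<close>

lemma exceptional_set:
  fixes A \<beta> :: "nat \<Rightarrow> real" and B \<theta> :: real
  assumes A: "\<And>k. A k \<ge> 0" and inf: "\<And>n. \<exists>k\<ge>n. A k > 0"
    and \<beta>1: "\<And>k. \<beta> k \<ge> 1" and \<beta>B: "\<And>k. \<beta> k \<le> B" and mono: "mono \<beta>" and \<theta>: "\<theta> \<ge> 3"
    and decay: "\<And>c. c > 0 \<Longrightarrow> \<exists>k0. \<forall>k\<ge>k0. \<forall>s. 0 \<le> s \<longrightarrow> s \<le> real k powr \<theta> \<longrightarrow> weighted_term A \<beta> s k < c"
  shows "\<exists>E. E \<subseteq> {1..} \<and> E \<in> sets lebesgue \<and> log_measure E < \<infinity> \<and>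
    (\<forall>n0. \<exists>R. \<forall>r\<ge>R. r \<notin> E \<longrightarrow> (\<exists>N\<ge>n0. real N powr \<theta> \<le> r \<and> A N > 0 \<and>
      (\<forall>k<N. A k * (\<Prod>j<k. r + (real j)\<^sup>2) \<le> A N * (\<Prod>j<N. r + (real j)\<^sup>2) * (\<Prod>j=k..<N. \<beta> j / \<beta> N)) \<and>
      (\<forall>k>N. A k * (\<Prod>j<k. r + (real j)\<^sup>2) < A N * (\<Prod>j<N. r + (real j)\<^sup>2) * (\<Prod>j=N..<k. \<beta> N / \<beta> j))))"
proof -
  let ?C = "weighted_term A \<beta>"
  define cen where "cen = (\<lambda>s. last_maximum (?C s))"
  obtain k1 where k1: "A k1 > 0" using inf by blast
  have \<beta>0: "\<beta> k > 0" for k using \<beta>1[of k] by linarith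
  have Cpos: "?C s k1 > 0" if "s > 0" for s
    unfolding weighted_term_def using that k1 \<beta>0 by (intro mult_pos_pos prod_pos) (auto intro: add_pos_nonneg)
  have ex: "\<exists>N. cen s N" if s: "s > 0" for s
  proof -
    obtain k0 where k0: "\<forall>k\<ge>k0. \<forall>t. 0 \<le> t \<longrightarrow> t \<le> real k powr \<theta> \<longrightarrow> ?C t k < ?C s k1"
      using decay[OF Cpos[OF s]] by blast
    have "?C s k < ?C s k1" if k: "k \<ge> max (max 1 k0) (nat \<lceil>s\<rceil>)" for k
    proof -
      have "s \<le> real k" using k by linarith
      also have "real k = real k powr 1" using k by simp
      also have "\<dots> \<le> real k powr \<theta>" using k \<theta> by (intro powr_mono) auto
      finally show ?thesis using k0 k s by simp
    qed
    thus ?thesis unfolding cen_def using last_maximum_exists[of "?C s" k1] Cpos[OF s] by blast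
  qed
  have cen_mono: "N \<le> N'" if "0 < s" "s < s'" "cen s N" "cen s' N'" for s s' N N'
    using last_maximum_weighted_term_mono[of A \<beta> s s' N N'] A \<beta>1 that unfolding cen_def by blast
  \<comment> \<open>The extra point \<open>0\<close> in \<open>J 0\<close> makes the first radius \<open>\<phi> 0 (S 0)\<close> equal to \<open>0\<close>, so that every \<open>r \<ge> 1\<close>
    lies beyond it.\<close>
  define J where "J = (\<lambda>n. {s. (n = 0 \<and> s = 0) \<or> (0 < s \<and> (\<exists>N\<ge>n. cen s N))})"
  have J0: "s \<ge> 0" if "s \<in> J n" for s n using that unfolding J_def by auto
  have Jbdd: "bdd_below (J n)" for n using J0 by (intro bdd_belowI[of _ 0]) auto
  have Jne: "J n \<noteq> {}" for n
  proof -
    obtain k where k: "k \<ge> n" "A k > 0" using inf by blast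
    \<comment> \<open>For such \<open>s\<close> the \<open>k\<close>-th weighted term exceeds all earlier ones of index below \<open>n\<close>.\<close>
    define s where "s = 1 + (\<Sum>j<n. A j / A k)"
    have sge: "s \<ge> 1" unfolding s_def using A k by (simp add: sum_nonneg)
    obtain N where N: "cen s N" using ex[of s] sge by auto
    have "N \<ge> n"
    proof (rule ccontr)
      assume "\<not> N \<ge> n"
      hence Nn: "N < n" by simp
      have "A N / A k \<le> (\<Sum>j<n. A j / A k)" using Nn A k by (intro member_le_sum) auto
      hence "A N / A k < s" unfolding s_def by simp
      hence 1: "A N \<le> A k * s" using k by (simp add: field_simps)
      have ge1: "\<beta> j * (s + (real j)\<^sup>2) \<ge> 1" for j
        using \<beta>1[of j] sge by (intro le_weight_factor) auto
      have ges: "\<beta> j * (s + (real j)\<^sup>2) \<ge> s" for j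
        using \<beta>1[of j] sge by (intro le_weight_factor) auto
      have "(\<Prod>j<N. \<beta> j * (s + (real j)\<^sup>2)) * s \<le> (\<Prod>j<N. \<beta> j * (s + (real j)\<^sup>2)) * (\<beta> N * (s + (real N)\<^sup>2))"
        using ge1 by (intro mult_left_mono ges prod_nonneg) (auto intro: order_trans[OF zero_le_one])
      also have "\<dots> = (\<Prod>j<Suc N. \<beta> j * (s + (real j)\<^sup>2))" by simp
      also have "\<dots> \<le> (\<Prod>j<k. \<beta> j * (s + (real j)\<^sup>2))"
        using Nn k ge1 by (intro prod_mono2) (auto intro: order_trans[OF zero_le_one] simp del: lessThan_Suc)
      finally have 2: "(\<Prod>j<N. \<beta> j * (s + (real j)\<^sup>2)) * s \<le> (\<Prod>j<k. \<beta> j * (s + (real j)\<^sup>2))" .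
      have "?C s N \<le> (A k * s) * (\<Prod>j<N. \<beta> j * (s + (real j)\<^sup>2))"
        unfolding weighted_term_def
        using 1 ge1 by (intro mult_right_mono prod_nonneg) (auto intro: order_trans[OF zero_le_one])
      also have "\<dots> = A k * ((\<Prod>j<N. \<beta> j * (s + (real j)\<^sup>2)) * s)" by (simp only: mult_ac)
      also have "\<dots> \<le> ?C s k" unfolding weighted_term_def using 2 k by (intro mult_left_mono) auto
      finally have "?C s N \<le> ?C s k" .
      moreover have "?C s k < ?C s N" using N k Nn unfolding cen_def last_maximum_def by simp
      ultimately show False by simp
    qed
    thus ?thesis using N sge unfolding J_def by force
  qed
  define S where "S = (\<lambda>n. Inf (J n))"
  have S0: "S n \<ge> 0" for n unfolding S_def using Jne J0 by (intro cInf_greatest) auto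
  have Szero: "S 0 = 0"
  proof -
    have "0 \<in> J 0" unfolding J_def by simp
    hence "S 0 \<le> 0" unfolding S_def using Jbdd by (intro cInf_lower)
    thus ?thesis using S0[of 0] by simp
  qed
  have above: "N \<ge> n" if sS: "s > S n" and sN: "cen s N" and n0: "n > 0" for s N n
  proof -
    obtain t where t: "t \<in> J n" "t < s" using cInf_lessD[OF Jne sS[unfolded S_def]] by blast
    then obtain N' where "0 < t" "N' \<ge> n" "cen t N'" using n0 unfolding J_def by auto
    thus ?thesis using cen_mono[of t s N' N] t sN by fastforce
  qed
  have below: "N < n" if "s < S n" "cen s N" "s > 0" for s N n
  proof (rule ccontr)
    assume "\<not> N < n"
    hence "n \<le> N" by simp
    hence "s \<in> J n" using that unfolding J_def by blast
    hence "S n \<le> s" unfolding S_def using Jbdd by (intro cInf_lower)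
    thus False using that by simp
  qed
  obtain n1 where n1: "\<And>k s. k \<ge> n1 \<Longrightarrow> 0 \<le> s \<Longrightarrow> s \<le> real k powr \<theta> \<Longrightarrow> ?C s k < A k1"
    using decay[OF k1] by blast
  obtain N1 where N1: "cen 1 N1" using ex[of 1] by auto
  define nn where "nn = max n1 (Suc N1)"
  have Sbig: "S n \<ge> real n powr \<theta>" if n: "n \<ge> nn" for n
    unfolding S_def
  proof (rule cInf_greatest[OF Jne])
    fix s assume s: "s \<in> J n"
    have "n > 0" using n unfolding nn_def by auto
    then obtain N where N: "s > 0" "N \<ge> n" "cen s N" using s unfolding J_def by auto
    have s1: "s \<ge> 1"
    proof (rule ccontr)
      assume "\<not> s \<ge> 1"
      hence "N \<le> N1" using cen_mono[of s 1 N N1] N N1 by simp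
      thus False using N n unfolding nn_def by simp
    qed
    have "A k1 * 1 \<le> ?C s k1"
      unfolding weighted_term_def
    proof (intro mult_left_mono prod_ge_1 A)
      fix j show "1 \<le> \<beta> j * (s + (real j)\<^sup>2)"
        using \<beta>1[of j] s1 by (intro le_weight_factor) auto
    qed
    also have "\<dots> \<le> ?C s N" using N(3) unfolding cen_def by (rule last_maximum_ge)
    finally have "\<not> ?C s N < A k1" by simp
    hence "s > real N powr \<theta>" using n1[of N s] N n unfolding nn_def by fastforce
    moreover have "real n powr \<theta> \<le> real N powr \<theta>" using N \<theta> by (intro powr_mono2) auto
    ultimately show "real n powr \<theta> \<le> s" by simp
  qed
  define \<phi> where "\<phi> = (\<lambda>n s. \<beta> n * s + (\<beta> n - 1) * (real n)\<^sup>2)"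
  have \<phi>ge: "\<phi> n s \<ge> s" if "s \<ge> 0" for n s
    using \<beta>1[of n] that mult_right_mono[of 1 "\<beta> n" s] unfolding \<phi>_def by (simp add: add_increasing2)
  have \<beta>Suc: "\<beta> n \<le> \<beta> (Suc n)" for n using mono by (simp add: monoD)
  have \<phi>Suc: "\<phi> n s \<le> \<phi> (Suc n) s" if "s \<ge> 0" for n s
    unfolding \<phi>_def using \<beta>Suc[of n] \<beta>1[of n] that by (intro add_mono mult_mono power_mono) auto
  define E where "E = {1..} \<inter> (\<Union>n. {\<phi> n (S (Suc n))..\<phi> (Suc n) (S (Suc n))})"
  have "log_measure E < \<infinity>"
    unfolding E_def
  proof (rule log_measure_UN_less_top)
    show "\<phi> n (S (Suc n)) \<le> \<phi> (Suc n) (S (Suc n))" for n by (intro \<phi>Suc S0)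
    have "summable (\<lambda>n. \<beta> (Suc n) - \<beta> n)"
    proof -
      obtain L where "\<beta> \<longlonglongrightarrow> L" using incseq_convergent[OF mono, of B] \<beta>B by blast
      thus ?thesis by (rule telescope_summable)
    qed
    moreover have "summable (\<lambda>n. inverse (real (Suc n) ^ 2))"
      by (subst summable_Suc_iff) (rule inverse_power_summable, simp)
    ultimately have sm: "summable (\<lambda>n. 2 * (\<beta> (Suc n) - \<beta> n) + (2 * B) * inverse (real (Suc n) ^ 2))"
      by (intro summable_add summable_mult)
    show "summable (\<lambda>n. (\<phi> (Suc n) (S (Suc n)) - \<phi> n (S (Suc n))) / max 1 (\<phi> n (S (Suc n))))"
    proof (rule summable_comparison_test'[OF sm])
      fix n assume n: "n \<ge> nn"
      let ?s = "S (Suc n)" and ?d = "\<beta> (Suc n) - \<beta> n" and ?m = "real (Suc n)"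
      have d: "?d \<ge> 0" using \<beta>Suc by simp
      have "?m ^ 3 = ?m powr 3" by (subst powr_realpow[symmetric]) auto
      also have "\<dots> \<le> ?m powr \<theta>" using \<theta> by (intro powr_mono) auto
      also have "\<dots> \<le> ?s" using n by (intro Sbig) simp
      finally have s3: "?m ^ 3 \<le> ?s" .
      have "1 \<le> ?m ^ 3" by (rule one_le_power) simp
      hence s1: "?s \<ge> 1" using s3 by linarith
      have den: "?s \<le> max 1 (\<phi> n ?s)" using \<phi>ge[of ?s n] s1 by simp
      have num: "\<phi> (Suc n) ?s - \<phi> n ?s = ?d * ?s + ?d * ?m ^ 2 + (\<beta> n - 1) * (2 * real n + 1)"
        unfolding \<phi>_def by (simp add: algebra_simps power2_eq_square)
      have "\<bar>(\<phi> (Suc n) ?s - \<phi> n ?s) / max 1 (\<phi> n ?s)\<bar> = (\<phi> (Suc n) ?s - \<phi> n ?s) / max 1 (\<phi> n ?s)"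
        using \<phi>Suc[of ?s n] s1 by (simp add: abs_of_nonneg)
      also have "\<dots> \<le> (\<phi> (Suc n) ?s - \<phi> n ?s) / ?s"
        using \<phi>Suc[of ?s n] s1 den by (intro divide_left_mono) auto
      also have "\<dots> = ?d + ?d * ?m ^ 2 / ?s + (\<beta> n - 1) * (2 * real n + 1) / ?s"
        unfolding num using s1 by (simp add: add_divide_distrib)
      also have "\<dots> \<le> ?d + ?d * ?m ^ 2 / ?m ^ 3 + (\<beta> n - 1) * (2 * real n + 1) / ?m ^ 3"
        using d \<beta>1[of n] s3 s1 by (intro add_mono divide_left_mono mult_nonneg_nonneg) auto
      also have "\<dots> \<le> ?d + ?d + B * (2 * ?m) / ?m ^ 3"
      proof (intro add_mono divide_right_mono mult_mono)
        have "?m ^ 2 / ?m ^ 3 \<le> 1" by (simp add: power_increasing)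
        thus "?d * ?m ^ 2 / ?m ^ 3 \<le> ?d" using d mult_left_mono[of "?m ^ 2 / ?m ^ 3" 1 ?d] by simp
      qed (use \<beta>B[of n] \<beta>1[of n] in auto)
      also have "B * (2 * ?m) / ?m ^ 3 = (2 * B) * inverse (?m ^ 2)"
        by (simp add: power3_eq_cube power2_eq_square field_simps del: of_nat_Suc)
      finally show "norm ((\<phi> (Suc n) ?s - \<phi> n ?s) / max 1 (\<phi> n ?s)) \<le> 2 * ?d + (2 * B) * inverse (?m ^ 2)"
        by simp
    qed
  qed
  moreover have "E \<in> sets lebesgue" unfolding E_def by (intro sets.Int sets.countable_UN) auto
  moreover have "\<exists>R. \<forall>r\<ge>R. r \<notin> E \<longrightarrow> (\<exists>N\<ge>n0. real N powr \<theta> \<le> r \<and> A N > 0 \<and>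
      (\<forall>k<N. A k * (\<Prod>j<k. r + (real j)\<^sup>2) \<le> A N * (\<Prod>j<N. r + (real j)\<^sup>2) * (\<Prod>j=k..<N. \<beta> j / \<beta> N)) \<and>
      (\<forall>k>N. A k * (\<Prod>j<k. r + (real j)\<^sup>2) < A N * (\<Prod>j<N. r + (real j)\<^sup>2) * (\<Prod>j=N..<k. \<beta> N / \<beta> j)))" for n0
  proof (intro exI[of _ "max 1 (\<phi> (max n0 nn) (S (max n0 nn)))"] allI impI)
    fix r assume r: "r \<ge> max 1 (\<phi> (max n0 nn) (S (max n0 nn)))" and rE: "r \<notin> E"
    have r1: "r \<ge> 1" using r by simp
    have gap: "r \<notin> {\<phi> n (S (Suc n))..\<phi> (Suc n) (S (Suc n))}" for n
      using rE r1 unfolding E_def by auto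
    define P where "P = {n. \<phi> n (S n) \<le> r}"
    have "P \<subseteq> {..max nn (nat \<lceil>r\<rceil>)}"
    proof
      fix n assume n: "n \<in> P"
      show "n \<in> {..max nn (nat \<lceil>r\<rceil>)}"
      proof (cases "n \<ge> nn \<and> n \<ge> 1")
        case True
        have "real n = real n powr 1" using True by simp
        also have "\<dots> \<le> real n powr \<theta>" using True \<theta> by (intro powr_mono) auto
        also have "\<dots> \<le> S n" using True by (intro Sbig) simp
        also have "\<dots> \<le> \<phi> n (S n)" by (intro \<phi>ge S0)
        also have "\<dots> \<le> r" using n unfolding P_def by simp
        finally show ?thesis by (simp add: le_max_iff_disj) linarith
      qed auto
    qed
    hence finP: "finite P" by (rule finite_subset) simp
    have mP: "max n0 nn \<in> P" unfolding P_def using r by simp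
    \<comment> \<open>The last index whose interval of radii starts at or before \<open>r\<close>; as \<open>r\<close> lies in no gap, it lies in that
      interval.\<close>
    define N where "N = Max P"
    have NP: "N \<in> P" unfolding N_def using finP mP by (intro Max_in) auto
    have Nge: "N \<ge> max n0 nn" unfolding N_def using finP mP by (intro Max_ge)
    have "Suc N \<notin> P" using Max_ge[OF finP, of "Suc N"] unfolding N_def by auto
    hence up: "r < \<phi> N (S (Suc N))" using gap[of N] unfolding P_def by auto
    have low: "r > \<phi> N (S N)" if N0: "N > 0"
    proof -
      obtain m where m: "N = Suc m" using N0 gr0_implies_Suc by blast
      have "\<phi> m (S N) \<le> \<phi> N (S N)" unfolding m by (intro \<phi>Suc S0)
      thus ?thesis using gap[of m] NP unfolding P_def m by force
    qed
    define s where "s = (r - (\<beta> N - 1) * (real N)\<^sup>2) / \<beta> N"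
    have rs: "r = \<phi> N s" unfolding \<phi>_def s_def using \<beta>0[of N] by (simp add: field_simps)
    have \<phi>less: "s < t" if "\<phi> N s < \<phi> N t" for s t using that \<beta>0[of N] unfolding \<phi>_def by simp
    have sS: "s < S (Suc N)" using up rs \<phi>less by simp
    have s0: "s > 0"
    proof (cases "N > 0")
      case True thus ?thesis using low rs \<phi>less S0[of N] by fastforce
    next
      case False thus ?thesis unfolding s_def using r1 \<beta>0 by simp
    qed
    obtain M where M: "cen s M" using ex[OF s0] by blast
    have "M < Suc N" by (rule below[OF sS M s0])
    moreover have "M \<ge> N"
      by (cases "N > 0") (use above[OF \<phi>less M] low rs in auto)
    ultimately have cN: "cen s N" using M by (simp add: le_antisym less_Suc_eq_le)
    have rN: "r + (real N)\<^sup>2 = \<beta> N * (s + (real N)\<^sup>2)" unfolding rs \<phi>_def by (simp add: algebra_simps)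
    have rj: "r + (real j)\<^sup>2 = \<beta> N * (s + (real j)\<^sup>2) + (\<beta> N - 1) * ((real N)\<^sup>2 - (real j)\<^sup>2)" for j
      unfolding rs \<phi>_def by (simp add: algebra_simps)
    have sj: "s + (real j)\<^sup>2 > 0" for j using s0 by (simp add: add_pos_nonneg)
    have rj0: "r + (real j)\<^sup>2 > 0" for j using r1 by (simp add: add_pos_nonneg)
    let ?w = "\<lambda>j. \<beta> j * (s + (real j)\<^sup>2)"
    have w0: "?w j > 0" for j using sj \<beta>0 by simp
    have split: "(\<Prod>j<n. h j) = (\<Prod>j<m. h j) * (\<Prod>j=m..<n. h j)" if "m \<le> n" for m n and h :: "nat \<Rightarrow> real"
    proof -
      have "{..<n} = {..<m} \<union> {m..<n}" using that by auto
      thus ?thesis by (simp add: prod.union_disjoint ivl_disj_int)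
    qed
    have kN: "A k * (\<Prod>j<k. r + (real j)\<^sup>2) \<le> A N * (\<Prod>j<N. r + (real j)\<^sup>2) * (\<Prod>j=k..<N. \<beta> j / \<beta> N)"
      if k: "k < N" for k
    proof -
      have "?C s k \<le> ?C s N" using cN unfolding cen_def by (rule last_maximum_ge)
      hence "A k * (\<Prod>j<k. ?w j) \<le> (A N * (\<Prod>j=k..<N. ?w j)) * (\<Prod>j<k. ?w j)"
        unfolding weighted_term_def using split[of k N ?w] k by (simp add: mult_ac)
      hence "A k \<le> A N * (\<Prod>j=k..<N. ?w j)"
        by (rule mult_right_le_imp_le) (intro prod_pos, use w0 in auto)
      also have "\<dots> \<le> A N * (\<Prod>j=k..<N. (r + (real j)\<^sup>2) * (\<beta> j / \<beta> N))"
      proof (intro mult_left_mono prod_mono conjI A)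
        fix j assume "j \<in> {k..<N}"
        hence "(real j)\<^sup>2 \<le> (real N)\<^sup>2" by (intro power_mono) auto
        hence "\<beta> N * (s + (real j)\<^sup>2) \<le> r + (real j)\<^sup>2" unfolding rj using \<beta>1[of N] by simp
        hence "\<beta> j * (\<beta> N * (s + (real j)\<^sup>2)) \<le> \<beta> j * (r + (real j)\<^sup>2)" using \<beta>0[of j] by simp
        thus "?w j \<le> (r + (real j)\<^sup>2) * (\<beta> j / \<beta> N)" using \<beta>0[of N] by (simp add: field_simps)
      qed (use w0 less_imp_le in blast)
      finally have 1: "A k \<le> A N * (\<Prod>j=k..<N. (r + (real j)\<^sup>2) * (\<beta> j / \<beta> N))" .
      have "A k * (\<Prod>j<k. r + (real j)\<^sup>2) \<le> A N * (\<Prod>j=k..<N. (r + (real j)\<^sup>2) * (\<beta> j / \<beta> N)) * (\<Prod>j<k. r + (real j)\<^sup>2)"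
        by (intro mult_right_mono 1 prod_nonneg) (use rj0 less_imp_le in blast)
      thus ?thesis unfolding split[OF less_imp_le[OF k], of "\<lambda>j. r + (real j)\<^sup>2"] prod.distrib
        by (simp only: mult_ac)
    qed
    have Nk: "A k * (\<Prod>j<k. r + (real j)\<^sup>2) < A N * (\<Prod>j<N. r + (real j)\<^sup>2) * (\<Prod>j=N..<k. \<beta> N / \<beta> j)"
      if k: "k > N" for k
    proof -
      have "?C s k < ?C s N" using cN k unfolding cen_def last_maximum_def by blast
      hence "A k * (\<Prod>j=N..<k. ?w j) * (\<Prod>j<N. ?w j) < A N * (\<Prod>j<N. ?w j)"
        unfolding weighted_term_def using split[of N k ?w] k by (simp add: mult_ac)
      hence 1: "A k * (\<Prod>j=N..<k. ?w j) < A N"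
        by (rule mult_right_less_imp_less) (intro prod_nonneg, use w0 less_imp_le in blast)
      have "(\<Prod>j=N..<k. r + (real j)\<^sup>2) \<le> (\<Prod>j=N..<k. ?w j * (\<beta> N / \<beta> j))"
      proof (intro prod_mono conjI)
        fix j assume "j \<in> {N..<k}"
        hence "(real N)\<^sup>2 \<le> (real j)\<^sup>2" by (intro power_mono) auto
        hence "(\<beta> N - 1) * ((real N)\<^sup>2 - (real j)\<^sup>2) \<le> 0" using \<beta>1[of N] by (intro mult_nonneg_nonpos) auto
        hence "r + (real j)\<^sup>2 \<le> \<beta> N * (s + (real j)\<^sup>2)" unfolding rj by simp
        moreover have "\<beta> N * (s + (real j)\<^sup>2) = ?w j * (\<beta> N / \<beta> j)" using \<beta>0[of j] by simp
        ultimately show "r + (real j)\<^sup>2 \<le> ?w j * (\<beta> N / \<beta> j)" by simp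
      qed (use rj0 less_imp_le in blast)
      hence "A k * (\<Prod>j=N..<k. r + (real j)\<^sup>2) \<le> A k * ((\<Prod>j=N..<k. ?w j) * (\<Prod>j=N..<k. \<beta> N / \<beta> j))"
        using A by (simp only: prod.distrib mult_left_mono)
      also have "\<dots> = A k * (\<Prod>j=N..<k. ?w j) * (\<Prod>j=N..<k. \<beta> N / \<beta> j)" by (simp only: mult_ac)
      also have "\<dots> < A N * (\<Prod>j=N..<k. \<beta> N / \<beta> j)"
        by (intro mult_strict_right_mono 1 prod_pos) (use \<beta>0 in auto)
      finally have "A k * (\<Prod>j=N..<k. r + (real j)\<^sup>2) * (\<Prod>j<N. r + (real j)\<^sup>2) < A N * (\<Prod>j=N..<k. \<beta> N / \<beta> j) * (\<Prod>j<N. r + (real j)\<^sup>2)"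
        by (intro mult_strict_right_mono prod_pos) (use rj0 in auto)
      thus ?thesis using split[of N k "\<lambda>j. r + (real j)\<^sup>2"] k by (simp add: mult_ac)
    qed
    have "?C s N > 0" using Cpos[OF s0] last_maximum_ge[of "?C s" N k1] cN unfolding cen_def by simp
    hence AN: "A N > 0" using A[of N] unfolding weighted_term_def by (cases "A N = 0") auto
    have "real N powr \<theta> \<le> S N" using Nge by (intro Sbig) simp
    also have "\<dots> \<le> \<phi> N (S N)" by (intro \<phi>ge S0)
    also have "\<dots> \<le> r" using NP unfolding P_def by simp
    finally show "\<exists>N\<ge>n0. real N powr \<theta> \<le> r \<and> A N > 0 \<and>
      (\<forall>k<N. A k * (\<Prod>j<k. r + (real j)\<^sup>2) \<le> A N * (\<Prod>j<N. r + (real j)\<^sup>2) * (\<Prod>j=k..<N. \<beta> j / \<beta> N)) \<and>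
      (\<forall>k>N. A k * (\<Prod>j<k. r + (real j)\<^sup>2) < A N * (\<Prod>j<N. r + (real j)\<^sup>2) * (\<Prod>j=N..<k. \<beta> N / \<beta> j))"
      using Nge AN kN Nk by (intro exI[of _ N]) auto
  qed
  ultimately show ?thesis by (intro exI[of _ E]) (auto simp: E_def)
qed

section \<open>Consequences of the order of growth\<close>

lemma norm_le_max_modulus:
  assumes "f holomorphic_on UNIV" "cmod z = r"
  shows "cmod (f z) \<le> max_modulus r f"
  unfolding max_modulus_def
proof (rule cSUP_upper)
  have "continuous_on (sphere 0 r) f"
    using holomorphic_on_imp_continuous_on[OF assms(1)] continuous_on_subset by blast
  hence "compact ((\<lambda>x. cmod (f x)) ` sphere 0 r)"
    by (intro compact_continuous_image continuous_on_norm compact_sphere)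
  thus "bdd_above ((\<lambda>x. cmod (f x)) ` sphere 0 r)" by (intro bounded_imp_bdd_above compact_imp_bounded)
qed (use assms in auto)

lemma order_of_growth_bound:
  assumes hol: "f holomorphic_on UNIV" and \<gamma>: "0 < \<gamma>" "ereal \<gamma> < 1 / order_of_growth f"
  shows "\<exists>R. \<forall>r\<ge>R. \<forall>z. cmod z = r \<longrightarrow> cmod (f z) \<le> exp (r powr (1 / \<gamma>))"
proof -
  have "order_of_growth f < ereal (1 / \<gamma>)"
  proof (cases "order_of_growth f")
    case (real \<sigma>)
    show ?thesis
    proof (cases "\<sigma> \<le> 0")
      case True thus ?thesis using real \<gamma> by (simp add: le_less_trans[of \<sigma> 0])
    next
      case False
      hence "\<gamma> < 1 / \<sigma>" using \<gamma> real by (simp add: one_ereal_def)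
      thus ?thesis using real False \<gamma> by (simp add: field_simps)
    qed
  qed (use \<gamma> in auto)
  hence "eventually (\<lambda>r. ereal (ln_plus (ln_plus (max_modulus r f)) / ln r) < ereal (1 / \<gamma>)) at_top"
    unfolding order_of_growth_def by (rule Limsup_lessD)
  then obtain R where R: "\<And>r. r \<ge> R \<Longrightarrow> ln_plus (ln_plus (max_modulus r f)) / ln r < 1 / \<gamma>"
    unfolding eventually_at_top_linorder by auto
  show ?thesis
  proof (intro exI[of _ "max R 2"] allI impI)
    fix r z assume r: "max R 2 \<le> r" and z: "cmod z = r"
    have ln0: "ln r > 0" using r by simp
    have M: "cmod (f z) \<le> max_modulus r f" by (rule norm_le_max_modulus[OF hol z])
    have "ln_plus (ln_plus (max_modulus r f)) < ln r / \<gamma>"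
      using R[of r] r ln0 by (simp add: field_simps)
    hence 1: "ln_plus (max_modulus r f) \<le> r powr (1 / \<gamma>)"
    proof (cases "ln_plus (max_modulus r f) > 0")
      case True
      have "ln (ln_plus (max_modulus r f)) \<le> ln_plus (ln_plus (max_modulus r f))"
        using True unfolding ln_plus_def[of "ln_plus _"] by simp
      also have "\<dots> < ln r / \<gamma>" by fact
      finally have "exp (ln (ln_plus (max_modulus r f))) \<le> exp (ln r / \<gamma>)" by simp
      thus ?thesis using True r by (simp add: powr_def)
    next
      case False thus ?thesis by (smt (verit) powr_ge_zero)
    qed
    show "cmod (f z) \<le> exp (r powr (1 / \<gamma>))"
    proof (cases "max_modulus r f > 0")
      case True
      have "ln (max_modulus r f) \<le> ln_plus (max_modulus r f)" using True unfolding ln_plus_def by simp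
      hence "exp (ln (max_modulus r f)) \<le> exp (r powr (1 / \<gamma>))" using 1 by simp
      thus ?thesis using True M by simp
    next
      case False thus ?thesis using M by (smt (verit) exp_ge_zero)
    qed
  qed
qed

text \<open>
  The Cauchy estimate on the circle of radius \<open>k powr \<gamma>\<close>, where \<open>f\<close> is at most \<open>exp k\<close>.
\<close>

lemma coefficient_decay:
  assumes f: "wilson_expansion f a" and \<gamma>: "3 \<le> \<gamma>"
    and R: "\<And>r z. r \<ge> R \<Longrightarrow> cmod z = r \<Longrightarrow> cmod (f z) \<le> exp (r powr (1 / \<gamma>))"
    and k: "k \<ge> 2" "real k \<ge> R"
  shows "cmod (a k) \<le> 2 * (2 * exp 1 / real k powr \<gamma>) ^ k"
proof -
  define \<rho> where "\<rho> = real k powr \<gamma>"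
  have "real k * real k ^ 2 = real k powr 3" using k by (simp add: powr_realpow[of "real k" 3, simplified] power3_eq_cube power2_eq_square)
  also have "\<dots> \<le> \<rho>" unfolding \<rho>_def using k \<gamma> by (intro powr_mono) auto
  finally have "real k * real k ^ 2 \<le> \<rho>" .
  moreover have "2 * real k ^ 2 \<le> real k * real k ^ 2" using k by (intro mult_right_mono) auto
  ultimately have \<rho>2: "2 * real k ^ 2 \<le> \<rho>" by simp
  have k2: "real k ^ 2 > 0" using k by simp
  have \<rho>0: "\<rho> > 0" using \<rho>2 k2 by linarith
  have k\<rho>: "real k ^ 2 < \<rho>" using \<rho>2 k2 by linarith
  have "real k = real k powr 1" using k by simp
  also have "\<dots> \<le> \<rho>" unfolding \<rho>_def using k \<gamma> by (intro powr_mono) auto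
  finally have \<rho>R: "\<rho> \<ge> R" using k by simp
  have root: "\<rho> powr (1 / \<gamma>) = real k" unfolding \<rho>_def using k \<gamma> by (simp add: powr_powr)
  have "cmod (a k) * (\<Prod>j\<le>k. \<rho> - (real j)\<^sup>2) \<le> \<rho> * exp (real k)"
    using R[OF \<rho>R] root by (intro wilson_coefficient_bound[OF f k\<rho>]) auto
  moreover have "(\<rho> / 2) ^ Suc k \<le> (\<Prod>j\<le>k. \<rho> - (real j)\<^sup>2)"
  proof -
    have "(\<Prod>j\<le>k. \<rho> / 2) \<le> (\<Prod>j\<le>k. \<rho> - (real j)\<^sup>2)"
    proof (intro prod_mono conjI)
      fix j assume "j \<in> {..k}"
      hence "(real j)\<^sup>2 \<le> real k ^ 2" by (intro power_mono) auto
      thus "\<rho> / 2 \<le> \<rho> - (real j)\<^sup>2" using \<rho>2 by linarith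
    qed (use \<rho>0 in auto)
    thus ?thesis by simp
  qed
  ultimately have "cmod (a k) * (\<rho> / 2) ^ Suc k \<le> \<rho> * exp (real k)"
    by (meson mult_left_mono norm_ge_zero order_trans)
  hence "cmod (a k) \<le> \<rho> * exp (real k) / (\<rho> / 2) ^ Suc k"
    using \<rho>0 by (subst pos_le_divide_eq) auto
  also have "\<dots> = 2 * (2 * exp 1 / \<rho>) ^ k"
    using \<rho>0 by (simp add: power_mult_distrib power_divide exp_of_nat_mult[symmetric])
  finally show ?thesis unfolding \<rho>_def .
qed

text \<open>
  Used twice: at fixed \<open>s\<close> it shows that the weighted terms have a last maximum, and with
  \<open>s = k powr \<theta>\<close> it shows that this maximum is attained at an index \<open>N\<close> with \<open>N powr \<theta> < s\<close>, once \<open>N\<close> is large.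
\<close>

lemma weighted_term_decay:
  fixes A \<beta> :: "nat \<Rightarrow> real"
  assumes \<theta>: "3 \<le> \<theta>" "\<theta> < \<gamma>" and A: "\<And>k. A k \<ge> 0"
    and dec: "\<And>k. k \<ge> k0 \<Longrightarrow> A k \<le> 2 * (2 * exp 1 / real k powr \<gamma>) ^ k"
    and \<beta>: "\<And>k. \<beta> k \<ge> 1" "\<And>k. \<beta> k \<le> B" and c: "c > 0"
  shows "\<exists>k0. \<forall>k\<ge>k0. \<forall>s. 0 \<le> s \<longrightarrow> s \<le> real k powr \<theta> \<longrightarrow> weighted_term A \<beta> s k < c"
proof -
  have B1: "B \<ge> 1" using \<beta>(1)[of 0] \<beta>(2)[of 0] by linarith
  have "((\<lambda>x. 4 * exp 1 * B * x powr (\<theta> - \<gamma>)) \<longlongrightarrow> 0) at_top"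
    using \<theta> by real_asymp
  hence "filterlim (\<lambda>k. 4 * exp 1 * B * real k powr (\<theta> - \<gamma>)) (nhds 0) sequentially"
    by (rule filterlim_compose[OF _ filterlim_real_sequentially])
  hence "eventually (\<lambda>k. 4 * exp 1 * B * real k powr (\<theta> - \<gamma>) < 1 / 2) sequentially"
    by (rule order_tendstoD) simp
  moreover have "(\<lambda>k. 2 * (1 / 2 :: real) ^ k) \<longlonglongrightarrow> 0" by real_asymp
  hence "eventually (\<lambda>k. 2 * (1 / 2 :: real) ^ k < c) sequentially"
    by (rule order_tendstoD) (rule c)
  ultimately have "eventually (\<lambda>k. 4 * exp 1 * B * real k powr (\<theta> - \<gamma>) < 1 / 2 \<and> 2 * (1 / 2 :: real) ^ k < c \<and> k \<ge> max k0 1) sequentially"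
    using eventually_ge_at_top[of "max k0 1"] by eventually_elim simp
  then obtain k1 where k1: "\<And>k. k \<ge> k1 \<Longrightarrow> 4 * exp 1 * B * real k powr (\<theta> - \<gamma>) < 1 / 2 \<and> 2 * (1 / 2 :: real) ^ k < c \<and> k \<ge> max k0 1"
    unfolding eventually_sequentially by blast
  show ?thesis
  proof (intro exI[of _ k1] allI impI)
    fix k s assume k: "k \<ge> k1" and s: "0 \<le> s" "s \<le> real k powr \<theta>"
    note K = k1[OF k]
    have kpos: "real k \<ge> 1" using K by simp
    have "real k ^ 2 = real k powr 2" using kpos by (simp add: powr_realpow[of "real k" 2, simplified])
    also have "\<dots> \<le> real k powr \<theta>" using kpos \<theta> by (intro powr_mono) auto
    finally have k2: "real k ^ 2 \<le> real k powr \<theta>" .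
    have "(\<Prod>j<k. \<beta> j * (s + (real j)\<^sup>2)) \<le> (\<Prod>j<k. B * (2 * real k powr \<theta>))"
    proof (intro prod_mono conjI mult_mono)
      fix j assume "j \<in> {..<k}"
      hence "(real j)\<^sup>2 \<le> real k ^ 2" by (intro power_mono) auto
      thus "s + (real j)\<^sup>2 \<le> 2 * real k powr \<theta>" using s k2 by linarith
      show "0 \<le> \<beta> j * (s + (real j)\<^sup>2)" using \<beta>(1)[of j] s by (intro mult_nonneg_nonneg) auto
    qed (use \<beta> B1 s in auto)
    hence "weighted_term A \<beta> s k \<le> 2 * (2 * exp 1 / real k powr \<gamma>) ^ k * (\<Prod>j<k. B * (2 * real k powr \<theta>))"
      unfolding weighted_term_def using K A dec[of k] s \<beta>(1)
      by (intro mult_mono prod_nonneg) (auto intro!: mult_nonneg_nonneg intro: order_trans[OF zero_le_one])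
    also have "\<dots> = 2 * (4 * exp 1 * B * (real k powr \<theta> / real k powr \<gamma>)) ^ k"
      by (simp add: power_mult_distrib[symmetric] mult_ac)
    also have "real k powr \<theta> / real k powr \<gamma> = real k powr (\<theta> - \<gamma>)" by (simp add: powr_diff)
    also have "2 * (4 * exp 1 * B * real k powr (\<theta> - \<gamma>)) ^ k \<le> 2 * (1 / 2) ^ k"
      using K B1 by (intro mult_left_mono power_mono) auto
    also have "\<dots> < c" using K by simp
    finally show "weighted_term A \<beta> s k < c" .
  qed
qed

text \<open>
  The Cauchy estimate loses only a factor \<open>r + j\<^sup>2\<close> over \<open>r - j\<^sup>2\<close> for each \<open>j \<le> N\<close>, and their product is bounded
  when \<open>N ^ 3 \<le> r\<close>.
\<close>

lemma wilson_term_le_max_modulus: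
  assumes f: "wilson_expansion f a" and N: "N \<ge> 3" and r: "real N ^ 3 \<le> r"
    and M: "\<And>z. cmod z = r \<Longrightarrow> cmod (f z) \<le> M"
  shows "wilson_term a r N \<le> 3 * exp 8 * M"
proof -
  have N0: "N > 0" "real N > 0" using N by auto
  have r0: "r > 0" using r N0 by (smt (verit) zero_less_power)
  have "real N ^ 2 * 1 < real N ^ 2 * real N" using N by (intro mult_strict_left_mono) auto
  hence Nr: "real N ^ 2 < r" using r by (simp add: power3_eq_cube power2_eq_square)
  have "cmod (a N) * (\<Prod>j\<le>N. r - (real j)\<^sup>2) \<le> r * M"
    by (rule wilson_coefficient_bound[OF f Nr M])
  moreover have "r ^ Suc N * (1 / 3) \<le> (\<Prod>j\<le>N. r - (real j)\<^sup>2)"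
  proof -
    have u: "0 \<le> (real j)\<^sup>2 / r \<and> (real j)\<^sup>2 / r \<le> 1" if "j < Suc N" for j
    proof -
      have "(real j)\<^sup>2 \<le> real N ^ 2" using that by (intro power_mono) auto
      hence "(real j)\<^sup>2 \<le> r" using Nr by linarith
      thus ?thesis using r0 by simp
    qed
    have "(\<Sum>j<Suc N. (real j)\<^sup>2) \<le> real N ^ 3 / 3 + real N ^ 2" using sum_squares_le[of N] by simp
    also have "3 * real N ^ 2 \<le> real N * real N ^ 2" using N by (intro mult_right_mono) auto
    hence "real N ^ 3 / 3 + real N ^ 2 \<le> 2 / 3 * real N ^ 3" by (simp add: power3_eq_cube power2_eq_square)
    also have "\<dots> \<le> 2 / 3 * r" using r by simp
    finally have "(\<Sum>j<Suc N. (real j)\<^sup>2) / r \<le> 2 / 3" using r0 by (simp add: field_simps)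
    moreover have "1 - (\<Sum>j<Suc N. (real j)\<^sup>2 / r) \<le> (\<Prod>j<Suc N. 1 - (real j)\<^sup>2 / r)"
      by (rule one_minus_sum_le_prod) (rule u)
    ultimately have "1 / 3 \<le> (\<Prod>j<Suc N. 1 - (real j)\<^sup>2 / r)" unfolding sum_divide_distrib by linarith
    hence "r ^ Suc N * (1 / 3) \<le> r ^ Suc N * (\<Prod>j<Suc N. 1 - (real j)\<^sup>2 / r)"
      using r0 by (intro mult_left_mono) auto
    also have "r ^ Suc N = (\<Prod>j<Suc N. r)" by simp
    also have "(\<Prod>j<Suc N. r) * (\<Prod>j<Suc N. 1 - (real j)\<^sup>2 / r) = (\<Prod>j<Suc N. r - (real j)\<^sup>2)"
      unfolding prod.distrib[symmetric] using r0 by (intro prod.cong) (auto simp: field_simps)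
    finally show ?thesis by (simp only: lessThan_Suc_atMost) (simp add: field_simps)
  qed
  ultimately have "cmod (a N) * (r ^ Suc N * (1 / 3)) \<le> r * M"
    by (meson mult_left_mono norm_ge_zero order_trans)
  hence aN: "cmod (a N) * r ^ N \<le> 3 * M" using r0 by (simp add: field_simps)
  have "(\<Prod>j<N. r + (real j)\<^sup>2) \<le> (\<Prod>j<N. r * (1 + 4 * real N ^ 2 / r))"
  proof (intro prod_mono conjI)
    fix j assume "j \<in> {..<N}"
    hence "(real j)\<^sup>2 \<le> real N ^ 2" by (intro power_mono) auto
    hence "(real j)\<^sup>2 \<le> 4 * real N ^ 2" using zero_le_power2[of "real N"] by linarith
    thus "r + (real j)\<^sup>2 \<le> r * (1 + 4 * real N ^ 2 / r)" using r0 by (simp add: distrib_left)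
  qed (use r0 in auto)
  also have "\<dots> = r ^ N * (1 + 4 * real N ^ 2 / r) ^ N" by (simp add: power_mult_distrib)
  also have "\<dots> \<le> r ^ N * (1 + 4 * real N ^ 2 / r) ^ (2 * N)"
    using r0 by (intro mult_left_mono power_increasing) auto
  also have "\<dots> \<le> r ^ N * exp 8"
    using r0 by (intro mult_left_mono one_plus_small_power_le[OF r N0(1)]) auto
  finally have "wilson_term a r N \<le> cmod (a N) * (r ^ N * exp 8)"
    unfolding wilson_term_def by (intro mult_left_mono) auto
  also have "\<dots> \<le> 3 * M * exp 8" using aN mult_right_mono[of "cmod (a N) * r ^ N" "3 * M" "exp 8"] by simp
  finally show ?thesis by (simp add: mult_ac)
qed

section \<open>The window around the central index\<close>

text \<open>
  The three summands belong to the three sums into which \<open>window_estimate\<close> splits the difference.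
\<close>

definition window_constant :: "nat \<Rightarrow> real" where
  "window_constant n = 3 * 2 ^ n * (exp 8 * (8 * real n + 2 * real n ^ 2))
     + 3 * (2 ^ n * real n * (1 + real n)) * (4 * exp 8)
     + exp 8 * (\<Sum>i<n. (7 + real i) * 9 ^ i) * (2 + 6 * (4 * exp 8))"

lemma window_constant_nonneg: "window_constant n \<ge> 0"
  unfolding window_constant_def by (intro add_nonneg_nonneg mult_nonneg_nonneg sum_nonneg) auto

lemma norm_window_sum_le:
  fixes b g :: "nat \<Rightarrow> complex"
  assumes b: "\<And>k. k \<in> {N-K..N+K} \<Longrightarrow> cmod (b k) \<le> \<mu>" and g: "\<And>k. k \<in> {N-K..N+K} \<Longrightarrow> cmod (g k) \<le> G"
    and K: "1 \<le> K" "K \<le> N" and \<mu>: "\<mu> \<ge> 0" and G: "G \<ge> 0"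
  shows "cmod (\<Sum>k=N-K..N+K. b k * g k) \<le> 3 * real K * \<mu> * G"
proof -
  have "cmod (\<Sum>k=N-K..N+K. b k * g k) \<le> (\<Sum>k=N-K..N+K. \<mu> * G)"
    by (rule sum_norm_le) (use b g \<mu> in \<open>auto simp: norm_mult intro!: mult_mono\<close>)
  also have "\<dots> = real (card {N-K..N+K}) * (\<mu> * G)" by simp
  also have "card {N-K..N+K} = 2 * K + 1" using K by simp
  also have "real (2 * K + 1) * (\<mu> * G) \<le> (3 * real K) * (\<mu> * G)"
    using K \<mu> G by (intro mult_right_mono) auto
  finally show ?thesis by (simp add: mult_ac)
qed

text \<open>
  Let \<open>\<rho> k = k (k-1) \<dots> (k-n+1) / N ^ n\<close>, and let \<open>p k\<close>, \<open>q k\<close> be the two reduced basis polynomials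
  that occur in the \<open>k\<close>-th summand. Then
  \<open>\<rho> k * p k - q k = \<rho> k * (p k - q k) + (\<rho> k - 1) * (q k - q N) + (\<rho> k - 1) * q N\<close>.
  The first two parts are \<open>O(1 / N)\<close> and \<open>O(K / N * K * N\<^sup>2 / r)\<close>, hence harmless after
  multiplication with the number \<open>2 * K + 1\<close> of summands. In the last part \<open>q N\<close> does not depend on \<open>k\<close>
  and Bernstein's inequality applies.
\<close>

lemma window_estimate:
  fixes a :: "nat \<Rightarrow> complex" and N K n :: nat and r \<mu> M :: real
  assumes K: "1 \<le> K" "2 * K \<le> N" and n: "2 * n \<le> N"
    and r: "real N ^ 3 \<le> r" and rK: "real K ^ 2 * real N ^ 2 \<le> r"
    and \<mu>: "\<And>k. k \<in> {N-K..N+K} \<Longrightarrow> cmod (a k) * r ^ k \<le> \<mu>"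
    and M: "\<And>z. cmod z = r \<Longrightarrow> cmod (\<Sum>k=N-K..N+K. a k * wilson_basis k z) \<le> M"
    and x: "cmod x = r"
  shows "cmod (\<Sum>k=N-K..N+K. (x / of_nat N) ^ n * (a k * ((-1) ^ n * falling_factorial n k * wilson_basis_at (of_nat n / 2) (k - n) x))
       - a k * wilson_basis k x) \<le> window_constant n * (real K / real N) * (M + \<mu>)"
proof -
  let ?J = "{N-K..N+K}"
  have N0: "N > 0" "real N > 0" using K by auto
  have r0: "r > 0" using r N0 by (smt (verit) zero_less_power)
  have KN: "K \<le> N" using K by simp
  have M0: "M \<ge> 0" using M[OF x] by (smt (verit) norm_ge_zero)
  have NJ: "N \<in> ?J" by simp
  have \<mu>0: "\<mu> \<ge> 0" using order_trans[OF _ \<mu>[OF NJ]] r0 by simp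
  have r2: "real N ^ 2 / r \<le> 1 / real N"
    using r r0 N0 by (simp add: field_simps power3_eq_cube power2_eq_square)
  have rK': "real K * (real K * real N ^ 2 / r) \<le> 1"
    using rK r0 by (simp add: field_simps power2_eq_square)
  define b where "b = (\<lambda>k. a k * (-1) ^ k)"
  have bz: "cmod (b k * z ^ k) \<le> \<mu>" if "k \<in> ?J" "cmod z = r" for k z
    using \<mu>[OF that(1)] that(2) by (simp add: b_def norm_mult norm_power)
  let ?\<rho> = "\<lambda>k. falling_factorial n k / of_nat N ^ n"
  let ?p = "\<lambda>k. reduced_basis (of_nat n / 2) (k - n) x"
  let ?q = "\<lambda>k z. reduced_basis 0 k z"
  define S where "S = (\<lambda>z. \<Sum>k\<in>?J. b k * z ^ k)"
  have basis: "a k * wilson_basis k z = b k * z ^ k * ?q k z" if "cmod z = r" for k z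
  proof -
    have "z \<noteq> 0" using that r0 by auto
    thus ?thesis unfolding wilson_basis_at_0[symmetric] b_def
      by (subst wilson_basis_at_reduced) (simp_all add: power_minus[of z])
  qed
  have qdiff: "cmod (?q k z - ?q N z) \<le> 4 * exp 8 * (real K * real N ^ 2 / r)" if "cmod z = r" "k \<in> ?J" for k z
    by (rule reduced_basis_diff_degree) (use that r N0 KN in auto)
  define S0 where "S0 = 2 * (M + 3 * (4 * exp 8) * \<mu>)"
  have S0: "cmod (S z) \<le> S0" if z: "cmod z = r" for z
  proof -
    have "?q N z * S z = (\<Sum>k\<in>?J. a k * wilson_basis k z) - (\<Sum>k\<in>?J. b k * z ^ k * (?q k z - ?q N z))"
      unfolding S_def basis[OF z] sum_distrib_left sum_subtractf[symmetric]
      by (intro sum.cong refl) (simp add: algebra_simps)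
    hence "cmod (?q N z * S z) \<le> cmod (\<Sum>k\<in>?J. a k * wilson_basis k z) + cmod (\<Sum>k\<in>?J. b k * z ^ k * (?q k z - ?q N z))"
      by (simp only: norm_triangle_ineq4)
    also have "\<dots> \<le> M + 3 * real K * \<mu> * (4 * exp 8 * (real K * real N ^ 2 / r))"
      by (intro add_mono M z norm_window_sum_le bz qdiff) (use K \<mu>0 r0 in auto)
    also have "3 * real K * \<mu> * (4 * exp 8 * (real K * real N ^ 2 / r)) = (3 * \<mu> * (4 * exp 8)) * (real K * (real K * real N ^ 2 / r))"
      by (simp only: mult_ac)
    also have "M + \<dots> \<le> M + (3 * \<mu> * (4 * exp 8)) * 1"
      by (intro add_left_mono mult_left_mono rK') (use \<mu>0 in auto)
    finally have 1: "cmod (?q N z) * cmod (S z) \<le> M + 3 * (4 * exp 8) * \<mu>" by (simp add: norm_mult mult_ac)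
    have "1 / 2 * cmod (S z) \<le> cmod (?q N z) * cmod (S z)"
      by (intro mult_right_mono norm_reduced_basis_bounds(2)[OF z r N0(1)]) simp
    thus ?thesis using 1 unfolding S0_def by simp
  qed
  have nk: "n \<le> k" if "k \<in> ?J" for k
  proof -
    have "N - K \<le> k" using that by simp
    thus ?thesis using K n by linarith
  qed
  have split_term: "(x / of_nat N) ^ n * (a k * ((-1) ^ n * falling_factorial n k * wilson_basis_at (of_nat n / 2) (k - n) x))
       - a k * wilson_basis k x =
      b k * x ^ k * (?\<rho> k * (?p k - ?q k x)) + b k * x ^ k * ((?\<rho> k - 1) * (?q k x - ?q N x)) + ?q N x * ((?\<rho> k - 1) * b k * x ^ k)"
    if k: "k \<in> ?J" for k
  proof -
    have x0: "x \<noteq> 0" using x r0 by auto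
    have kn: "k = n + (k - n)" using nk[OF k] by simp
    have "(x / of_nat N) ^ n * (a k * ((-1) ^ n * falling_factorial n k * wilson_basis_at (of_nat n / 2) (k - n) x))
        = a k * ((-1) ^ n * (-1) ^ (k - n)) * (x ^ n * x ^ (k - n)) * (?\<rho> k * ?p k)"
      unfolding wilson_basis_at_reduced[OF x0] power_minus[of x] power_divide by simp
    also have "(-1) ^ n * (-1) ^ (k - n) = ((-1) ^ k :: complex)" by (simp add: nk[OF k] flip: power_add)
    also have "x ^ n * x ^ (k - n) = x ^ k" by (simp add: nk[OF k] flip: power_add)
    finally have eq1: "(x / of_nat N) ^ n * (a k * ((-1) ^ n * falling_factorial n k * wilson_basis_at (of_nat n / 2) (k - n) x))
        = b k * x ^ k * (?\<rho> k * ?p k)" unfolding b_def .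
    have ring: "u * v * (R * p) - u * v * q = u * v * (R * (p - q)) + u * v * ((R - 1) * (q - P)) + P * ((R - 1) * u * v)"
      for u v R p q P :: complex by (simp add: algebra_simps)
    show ?thesis unfolding eq1 basis[OF x] by (rule ring)
  qed
  let ?A1 = "\<Sum>k\<in>?J. b k * x ^ k * (?\<rho> k * (?p k - ?q k x))"
  let ?A2 = "\<Sum>k\<in>?J. b k * x ^ k * ((?\<rho> k - 1) * (?q k x - ?q N x))"
  let ?A3 = "\<Sum>k\<in>?J. (?\<rho> k - 1) * b k * x ^ k"
  let ?C1 = "exp 8 * (8 * real n + 2 * real n ^ 2)" and ?C2 = "4 * exp 8 :: real" and ?C3 = "2 ^ n * real n * (1 + real n)"
  let ?C4 = "\<Sum>i<n. (7 + real i) * 9 ^ i"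
  let ?e = "real K / real N"
  have e0: "?e \<ge> 0" by simp
  have A1: "cmod ?A1 \<le> 3 * 2 ^ n * ?C1 * ?e * \<mu>"
  proof -
    have "cmod ?A1 \<le> 3 * real K * \<mu> * (2 ^ n * (?C1 * (1 / real N)))"
    proof (intro norm_window_sum_le bz x)
      fix k assume k: "k \<in> ?J"
      have "cmod (?p k - ?q k x) \<le> ?C1 * (real N ^ 2 / r)"
        by (rule reduced_basis_diff_shift) (use x r N0 k K nk in auto)
      also have "\<dots> \<le> ?C1 * (1 / real N)" by (intro mult_left_mono r2) auto
      finally show "cmod (?\<rho> k * (?p k - ?q k x)) \<le> 2 ^ n * (?C1 * (1 / real N))"
        unfolding norm_mult by (intro mult_mono falling_factorial_ratio(1)[OF k nk[OF k] K(1) KN]) auto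
    qed (use K \<mu>0 in auto)
    also have "3 * k * m * (p * (c * (1 / d))) = 3 * p * c * (k / d) * m" for k m p c d :: real by simp
    finally show ?thesis .
  qed
  have A2: "cmod ?A2 \<le> 3 * ?C3 * ?C2 * ?e * \<mu>"
  proof -
    have "cmod ?A2 \<le> 3 * real K * \<mu> * ((?C3 * ?e) * (?C2 * (real K * real N ^ 2 / r)))"
    proof (intro norm_window_sum_le bz x)
      fix k assume k: "k \<in> ?J"
      show "cmod ((?\<rho> k - 1) * (?q k x - ?q N x)) \<le> (?C3 * ?e) * (?C2 * (real K * real N ^ 2 / r))"
        unfolding norm_mult by (intro mult_mono falling_factorial_ratio(2)[OF k nk[OF k] K(1) KN] qdiff[OF x k]) auto
    qed (use K \<mu>0 r0 in auto)
    also have "\<dots> = (3 * ?C3 * ?C2 * ?e * \<mu>) * (real K * (real K * real N ^ 2 / r))" by (simp only: mult_ac)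
    also have "\<dots> \<le> (3 * ?C3 * ?C2 * ?e * \<mu>) * 1" by (intro mult_left_mono rK') (use \<mu>0 in auto)
    finally show ?thesis by simp
  qed
  have A3: "cmod ?A3 \<le> ?C4 * ?e * S0"
    by (rule conjunct2[OF bernstein_falling_factorial[OF r0]]) (use S0[unfolded S_def] K KN n x in auto)
  have "(\<Sum>k=N-K..N+K. (x / of_nat N) ^ n * (a k * ((-1) ^ n * falling_factorial n k * wilson_basis_at (of_nat n / 2) (k - n) x))
       - a k * wilson_basis k x) = ?A1 + ?A2 + ?q N x * ?A3"
    unfolding sum_distrib_left[of "?q N x"] sum.distrib[symmetric] by (intro sum.cong refl) (rule split_term)
  also have "cmod \<dots> \<le> 3 * 2 ^ n * ?C1 * ?e * \<mu> + 3 * ?C3 * ?C2 * ?e * \<mu> + exp 8 * (?C4 * ?e * S0)"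
    unfolding norm_mult
    by (intro norm_triangle_mono A1 A2, subst norm_mult, intro mult_mono A3 norm_reduced_basis_bounds(1)[OF x r N0(1)]) auto
  also have "\<dots> = (3 * 2 ^ n * ?C1 * ?e) * \<mu> + (3 * ?C3 * ?C2 * ?e) * \<mu> + (exp 8 * ?C4 * ?e) * (2 * M + 6 * ?C2 * \<mu>)"
    unfolding S0_def by (simp add: algebra_simps)
  also have "\<dots> \<le> (3 * 2 ^ n * ?C1 * ?e) * (M + \<mu>) + (3 * ?C3 * ?C2 * ?e) * (M + \<mu>) + (exp 8 * ?C4 * ?e) * ((2 + 6 * ?C2) * (M + \<mu>))"
    using M0 \<mu>0 by (intro add_mono mult_left_mono mult_nonneg_nonneg sum_nonneg) (auto simp: algebra_simps add_nonneg_nonneg)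
  also have "\<dots> = window_constant n * ?e * (M + \<mu>)"
  proof -
    have "(c1 * e) * s + (c2 * e) * s + (c3 * e) * (c4 * s) = (c1 + c2 + c3 * c4) * e * s"
      for c1 c2 c3 c4 e s :: real by (simp add: algebra_simps)
    thus ?thesis unfolding window_constant_def .
  qed
  finally show ?thesis .
qed

section \<open>The asymptotic formula\<close>

text \<open>
  Here \<open>y\<close> is the exponential rate of decay. By the two conditions on it, half of the decay
  absorbs the factor \<open>(k / N) ^ n\<close>, and a quarter of it at the edge of the window produces \<open>1 / N\<^sup>2\<close>;
  the last quarter is left to sum the series.
\<close>

lemma estimate_at_normal_radius:
  fixes a :: "nat \<Rightarrow> complex" and N K n :: nat and r y M :: real
  assumes f: "wilson_expansion f a" and M: "\<And>z. cmod z = r \<Longrightarrow> cmod (f z) \<le> M"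
    and K: "1 \<le> K" "2 * K \<le> N" and n: "1 \<le> n" "2 * n \<le> N" and N3: "3 \<le> N"
    and r: "real N ^ 3 \<le> r" and rK: "real K ^ 2 * real N ^ 2 \<le> r"
    and y: "2 * real n \<le> y * real N" "24 * ln (real N) \<le> y * real K"
    and le: "\<And>k. wilson_term a r k \<le> wilson_term a r N"
    and decay: "\<And>k. k \<notin> {N-K..N+K} \<Longrightarrow> wilson_term a r k \<le> wilson_term a r N * exp (- y * \<bar>real k - real N\<bar>)"
    and x: "cmod x = r"
  shows "cmod ((x / of_nat N) ^ n * (wilson_op ^^ n) f x - f x)
     \<le> (window_constant n * (1 + 39 * exp 8) + 36 * exp 8) * (real K / real N * M)"
proof -
  let ?J = "{N-K..N+K}"
  let ?t = "wilson_term a r"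
  define \<mu> where "\<mu> = ?t N"
  have N0: "real N > 0" "real N \<ge> 1" using N3 by auto
  have r0: "r > 0" using r N0 by (smt (verit) zero_less_power)
  have M0: "M \<ge> 0" using M[OF x] by (smt (verit) norm_ge_zero)
  have \<mu>0: "\<mu> \<ge> 0" unfolding \<mu>_def wilson_term_def using r0 by (intro mult_nonneg_nonneg prod_nonneg) auto
  have \<mu>M: "\<mu> \<le> 3 * exp 8 * M" unfolding \<mu>_def by (rule wilson_term_le_max_modulus[OF f N3 r M])
  have y0: "y > 0"
  proof -
    have "y * real N > 0" using y(1) n by simp
    thus ?thesis using N0 by (simp add: zero_less_mult_iff)
  qed
  define c where "c = 2 * \<mu> / real N ^ 2"
  have c0: "c \<ge> 0" unfolding c_def using \<mu>0 by simp
  have total: "c * (2 * (1 + 1 / (y / 4))) \<le> 12 * \<mu> / real N"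
  proof -
    have "2 \<le> y * real N" using y(1) n by simp
    hence "1 / (y / 4) \<le> 2 * real N" using y0 by (simp add: field_simps)
    hence "2 * (1 + 1 / (y / 4)) \<le> 6 * real N" using N0 by simp
    hence "c * (2 * (1 + 1 / (y / 4))) \<le> c * (6 * real N)" using c0 by (intro mult_left_mono)
    also have "\<dots> = 12 * \<mu> / real N" unfolding c_def using N0 by (simp add: power2_eq_square)
    finally show ?thesis .
  qed
  have tail: "?t k * (1 + (real k / real N) ^ n) \<le> c * exp (- (y / 4) * \<bar>real k - real N\<bar>)" if k: "k \<notin> ?J" for k
  proof -
    define m where "m = \<bar>real k - real N\<bar>"
    have m: "m \<ge> real K" unfolding m_def using k by auto
    have "real k / real N \<le> 1 + m / real N" unfolding m_def using N0 by (simp add: field_simps)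
    also have "\<dots> \<le> exp (m / real N)" by (rule exp_ge_add_one_self)
    finally have "(real k / real N) ^ n \<le> exp (m / real N) ^ n" by (intro power_mono) auto
    also have "\<dots> = exp (real n * (m / real N))" by (rule exp_of_nat_mult[symmetric])
    also have "\<dots> \<le> exp (y / 2 * m)"
    proof -
      have "real n / real N \<le> y / 2" using y(1) N0 by (simp add: field_simps)
      hence "real n / real N * m \<le> y / 2 * m" using m by (intro mult_right_mono) auto
      thus ?thesis by simp
    qed
    finally have 1: "(real k / real N) ^ n \<le> exp (y / 2 * m)" .
    have 2: "1 \<le> exp (y / 2 * m)" using y0 m by simp
    have "exp (- (y / 4) * m) \<le> 1 / real N ^ 2"
    proof -
      have "y * real K \<le> y * m" using m y0 by (intro mult_left_mono) auto
      moreover have "ln (real N) \<ge> 0" using N0 by simp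
      ultimately have "- (y / 4) * m \<le> - (2 * ln (real N))" using y(2) by simp
      hence "exp (- (y / 4) * m) \<le> exp (- (2 * ln (real N)))" by simp
      also have "\<dots> = 1 / real N ^ 2" using N0 by (simp add: exp_minus exp_double inverse_eq_divide)
      finally show ?thesis .
    qed
    note 3 = this
    have "?t k * (1 + (real k / real N) ^ n) \<le> (\<mu> * exp (- y * m)) * (exp (y / 2 * m) + exp (y / 2 * m))"
      using decay[OF k] 1 2 \<mu>0 unfolding m_def[symmetric] \<mu>_def[symmetric]
      by (intro mult_mono add_mono) auto
    also have "\<dots> = 2 * \<mu> * (exp (- (y / 4) * m) * exp (- (y / 4) * m))"
    proof -
      have "- y * m + y / 2 * m = - (y / 4) * m + - (y / 4) * m" by (simp add: algebra_simps)
      hence "exp (- y * m) * exp (y / 2 * m) = exp (- (y / 4) * m) * exp (- (y / 4) * m)"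
        by (simp only: exp_add[symmetric])
      moreover have "(p * u) * (v + v) = 2 * p * (u * v)" for p u v :: real by simp
      ultimately show ?thesis by simp
    qed
    also have "\<dots> \<le> 2 * \<mu> * (1 / real N ^ 2 * exp (- (y / 4) * m))"
      using \<mu>0 3 by (intro mult_left_mono mult_right_mono) auto
    finally show ?thesis unfolding c_def m_def by simp
  qed
  have nonneg: "?t k \<ge> 0" for k unfolding wilson_term_def using r0 by (intro mult_nonneg_nonneg prod_nonneg) auto
  have v: "cmod (a k * wilson_basis k z) \<le> ?t k" if "cmod z = r" for k z
    unfolding wilson_term_def norm_mult using norm_wilson_basis_le[of k z] that by (intro mult_left_mono) auto
  let ?u = "\<lambda>k. (x / of_nat N) ^ n * (a k * ((-1) ^ n * falling_factorial n k * wilson_basis_at (of_nat n / 2) (k - n) x))"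
  have u: "cmod (?u k) \<le> ?t k * (real k / real N) ^ n" for k
  proof (cases "k < n")
    case True thus ?thesis using nonneg[of k] by (simp add: falling_factorial_eq_0)
  next
    case False
    have "cmod (?u k) = cmod (a k) * (cmod (falling_factorial n k) / real N ^ n) * (cmod x ^ n * cmod (wilson_basis_at (of_nat n / 2) (k - n) x))"
      by (simp add: norm_mult norm_power norm_divide power_divide)
    also have "\<dots> \<le> cmod (a k) * (real k ^ n / real N ^ n) * (\<Prod>j<k. cmod x + (real j)\<^sup>2)"
      using False by (intro mult_mono divide_right_mono norm_falling_factorial_le norm_wilson_basis_at_le) auto
    also have "\<dots> = ?t k * (real k / real N) ^ n" unfolding wilson_term_def x by (simp add: power_divide)
    finally show ?thesis .
  qed
  have window: "cmod (\<Sum>k=N-K..N+K. a k * wilson_basis k z) \<le> M + 12 * \<mu>" if z: "cmod z = r" for z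
  proof -
    have "cmod (f z - (\<Sum>k=N-K..N+K. a k * wilson_basis k z)) \<le> c * (2 * (1 + 1 / (y / 4)))"
    proof (rule tail_bound[OF wilson_expansion_sums[OF f]])
      fix k assume k: "k \<notin> ?J"
      have "cmod (a k * wilson_basis k z) \<le> ?t k * (1 + (real k / real N) ^ n)"
        using v[OF z, of k] mult_left_mono[of 1 "1 + (real k / real N) ^ n" "?t k"] nonneg[of k] by simp
      also note tail[OF k]
      finally show "cmod (a k * wilson_basis k z) \<le> c * exp (- (y / 4) * \<bar>real k - real N\<bar>)" .
    qed (use y0 c0 in auto)
    also note total
    also have "12 * \<mu> / real N \<le> 12 * \<mu>" using \<mu>0 N0 by (simp add: divide_le_eq mult_le_cancel_left1)
    finally have "cmod (f z - (\<Sum>k=N-K..N+K. a k * wilson_basis k z)) \<le> 12 * \<mu>" .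
    moreover have "cmod (\<Sum>k=N-K..N+K. a k * wilson_basis k z) \<le> cmod (f z) + cmod (f z - (\<Sum>k=N-K..N+K. a k * wilson_basis k z))"
      unfolding norm_minus_commute[of "f z"] by (rule norm_triangle_sub)
    ultimately show ?thesis using M[OF z] by linarith
  qed
  define w where "w = csqrt x"
  have w2: "w\<^sup>2 = x" unfolding w_def by simp
  have wn: "cmod w > real n / 2"
  proof -
    have "real n \<le> real N" using n by simp
    moreover have "real n \<ge> 1" using n by simp
    ultimately have "real n * real n \<le> real N * real N" by (intro mult_mono) auto
    also have "\<dots> \<le> real N ^ 3" using N0 mult_left_mono[of 1 "real N" "real N * real N"] by (simp add: power3_eq_cube)
    also have "\<dots> \<le> cmod w ^ 2" using r x w2 norm_power[of w 2] by simp
    finally have "(real n) ^ 2 \<le> cmod w ^ 2" by (simp add: power2_eq_square)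
    hence "real n \<le> cmod w" by (rule power2_le_imp_le) simp
    thus ?thesis using n by simp
  qed
  have s: "(\<lambda>k. ?u k - a k * wilson_basis k x) sums ((x / of_nat N) ^ n * (wilson_op ^^ n) f x - f x)"
    using sums_diff[OF sums_mult[OF wilson_op_iterate_sums[OF f wn], of "(x / of_nat N) ^ n"] wilson_expansion_sums[OF f, of x]]
    unfolding w2 .
  have t1: "cmod ((x / of_nat N) ^ n * (wilson_op ^^ n) f x - f x - (\<Sum>k=N-K..N+K. ?u k - a k * wilson_basis k x))
      \<le> c * (2 * (1 + 1 / (y / 4)))"
  proof (rule tail_bound[OF s])
    fix k assume k: "k \<notin> ?J"
    have "cmod (?u k - a k * wilson_basis k x) \<le> cmod (?u k) + cmod (a k * wilson_basis k x)"
      by (rule norm_triangle_ineq4)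
    also have "\<dots> \<le> ?t k * (real k / real N) ^ n + ?t k" by (intro add_mono u v x)
    also have "\<dots> = ?t k * (1 + (real k / real N) ^ n)" by (simp add: distrib_left)
    also note tail[OF k]
    finally show "cmod (?u k - a k * wilson_basis k x) \<le> c * exp (- (y / 4) * \<bar>real k - real N\<bar>)" .
  qed (use y0 c0 in auto)
  also note total
  finally have t1: "cmod ((x / of_nat N) ^ n * (wilson_op ^^ n) f x - f x - (\<Sum>k=N-K..N+K. ?u k - a k * wilson_basis k x)) \<le> 12 * \<mu> / real N" .
  have coeff: "cmod (a k) * r ^ k \<le> \<mu>" for k
  proof -
    have "(\<Prod>j<k. r) \<le> (\<Prod>j<k. r + (real j)\<^sup>2)" using r0 by (intro prod_mono) auto
    hence "cmod (a k) * r ^ k \<le> ?t k" unfolding wilson_term_def by (intro mult_left_mono) auto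
    thus ?thesis using le[of k] unfolding \<mu>_def by simp
  qed
  have t2: "cmod (\<Sum>k=N-K..N+K. ?u k - a k * wilson_basis k x) \<le> window_constant n * (real K / real N) * ((M + 12 * \<mu>) + \<mu>)"
    by (rule window_estimate[OF K n(2) r rK coeff window x])
  have "cmod ((x / of_nat N) ^ n * (wilson_op ^^ n) f x - f x) \<le> 12 * \<mu> / real N + window_constant n * (real K / real N) * ((M + 12 * \<mu>) + \<mu>)"
    using t1 t2 norm_triangle_sub[of "(x / of_nat N) ^ n * (wilson_op ^^ n) f x - f x" "\<Sum>k=N-K..N+K. ?u k - a k * wilson_basis k x"]
    by linarith
  also have "\<dots> \<le> 36 * exp 8 * (real K / real N * M) + window_constant n * (real K / real N) * ((1 + 39 * exp 8) * M)"
  proof (intro add_mono mult_left_mono)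
    have "12 * \<mu> \<le> 36 * exp 8 * M * 1" using \<mu>M by linarith
    also have "\<dots> \<le> 36 * exp 8 * M * real K" using K M0 by (intro mult_left_mono) auto
    finally have "12 * \<mu> / real N \<le> 36 * exp 8 * M * real K / real N" by (rule divide_right_mono) simp
    thus "12 * \<mu> / real N \<le> 36 * exp 8 * (real K / real N * M)" by (simp add: mult_ac)
    have "(1 + 39 * exp 8) * M = M + 13 * (3 * exp 8 * M)" by (simp add: algebra_simps)
    thus "M + 12 * \<mu> + \<mu> \<le> (1 + 39 * exp 8) * M" using \<mu>M by linarith
  qed (use window_constant_nonneg[of n] in auto)
  also have "\<dots> = (window_constant n * (1 + 39 * exp 8) + 36 * exp 8) * (real K / real N * M)"
    by (simp add: algebra_simps)
  finally show ?thesis .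
qed

lemma wilson_central_index_eqI:
  assumes "\<And>k. wilson_term a r k \<le> wilson_term a r N" "\<And>k. k > N \<Longrightarrow> wilson_term a r k < wilson_term a r N"
  shows "wilson_central_index a r = N"
proof -
  have "wilson_max_term a r = wilson_term a r N"
    unfolding wilson_max_term_def by (rule cSup_eq_maximum) (use assms(1) in auto)
  hence eq: "{n. wilson_term a r n = wilson_max_term a r} = {n. wilson_term a r n = wilson_term a r N}" by simp
  have le: "k \<le> N" if "wilson_term a r k = wilson_term a r N" for k
    using assms(2)[of k] that by (cases "k > N") auto
  have "finite {n. wilson_term a r n = wilson_term a r N}"
    by (rule finite_subset[of _ "{..N}"]) (use le in auto)
  thus ?thesis unfolding wilson_central_index_def eq by (intro Max_eqI) (use le in auto)
qed

lemma transcendental_coefficients: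
  assumes "transcendental_entire f" "wilson_expansion f a"
  shows "\<exists>k\<ge>n. cmod (a k) > 0"
proof (rule ccontr)
  assume "\<not> (\<exists>k\<ge>n. cmod (a k) > 0)"
  hence zero: "a k = 0" if "k \<ge> n" for k using that by simp
  define p where "p = (\<Sum>k<n. smult (a k) (\<Prod>j<k. [:- (of_nat j)\<^sup>2, -1:]))"
  have "f x = poly p x" for x
  proof -
    have "(\<lambda>k. a k * wilson_basis k x) sums (\<Sum>k<n. a k * wilson_basis k x)"
      by (rule sums_finite) (use zero in auto)
    hence "f x = (\<Sum>k<n. a k * wilson_basis k x)"
      using wilson_expansion_sums[OF assms(2)] sums_unique2 by blast
    thus ?thesis unfolding p_def by (simp add: poly_sum poly_prod wilson_basis_def)
  qed
  thus False using assms(1) unfolding transcendental_entire_def by blast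
qed

text \<open>
  The lower bound \<open>\<theta> > 3\<close> enters in \<open>K\<^sup>2 * N\<^sup>2 \<le> N powr \<theta>\<close>, since \<open>K\<^sup>2\<close> exceeds \<open>N\<close> by powers
  of logarithms.
\<close>

lemma eventually_kappa_conditions:
  assumes \<delta>: "\<delta> > 0" and \<theta>: "\<theta> > 3"
  shows "eventually (\<lambda>N::nat. let K = nat (wilson_kappa \<delta> N); y = log_weight_slope (\<delta> / 2) (2 * real N) * real K / 2 in
      3 \<le> N \<and> 2 * n \<le> N \<and> 1 \<le> K \<and> 2 * K \<le> N \<and> real N ^ 3 \<le> real N powr \<theta> \<and> real K ^ 2 * real N ^ 2 \<le> real N powr \<theta> \<and>
      2 * real n \<le> y * real N \<and> 24 * ln (real N) \<le> y * real K \<and> real_of_int (wilson_kappa \<delta> N) = real K) sequentially"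
proof -
  define X where "X = (\<lambda>N::real. N * (ln N)\<^sup>2 * ln (ln N) powr (1 + \<delta>))"
  define D where "D = (\<lambda>N::real. log_weight_slope (\<delta> / 2) (2 * N))"
  have "eventually (\<lambda>N. D N * X N \<ge> 192 * ln N \<and> D N * sqrt (X N) * N \<ge> 8 * real n \<and>
      X N \<le> N powr (1 + (\<theta> - 3)) \<and> sqrt (X N) \<le> N / 2 \<and> sqrt (X N) \<ge> 2 \<and> N \<ge> max 3 (2 * real n)) at_top"
    unfolding D_def X_def
    using eventually_slope_large[OF \<delta>] eventually_slope_sqrt_large[OF \<delta>, of "8 * real n"]
      eventually_kappa_le[OF \<delta>, of "\<theta> - 3"] \<theta> eventually_ge_at_top[of "max 3 (2 * real n)"]
    by (intro eventually_conj) auto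
  hence "eventually (\<lambda>N::nat. D (real N) * X (real N) \<ge> 192 * ln (real N) \<and> D (real N) * sqrt (X (real N)) * real N \<ge> 8 * real n \<and>
      X (real N) \<le> real N powr (1 + (\<theta> - 3)) \<and> sqrt (X (real N)) \<le> real N / 2 \<and> sqrt (X (real N)) \<ge> 2 \<and> real N \<ge> max 3 (2 * real n)) sequentially"
    by (rule eventually_compose_filterlim[OF _ filterlim_real_sequentially])
  thus ?thesis
  proof eventually_elim
    case (elim N)
    define s where "s = sqrt (X (real N))"
    define K where "K = nat (wilson_kappa \<delta> N)"
    have kap: "wilson_kappa \<delta> N = \<lfloor>s\<rfloor>" unfolding s_def X_def wilson_kappa_def by simp
    have s2: "s \<ge> 2" using elim s_def by simp
    have Kr: "real_of_int (wilson_kappa \<delta> N) = real K" unfolding K_def kap using s2 by simp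
    have Ks: "real K \<le> s" "real K \<ge> s / 2" using s2 unfolding Kr[symmetric] kap by linarith+
    have X0: "X (real N) = s ^ 2"
    proof -
      have "X (real N) \<ge> 0" unfolding X_def by simp
      thus ?thesis unfolding s_def by simp
    qed
    have N3: "N \<ge> 3" "2 * n \<le> N" using elim by auto
    have D0: "D (real N) > 0" unfolding D_def using \<delta> by (intro log_weight_slope_pos) auto
    have "real K \<ge> 1" using Ks s2 by simp
    moreover have "2 * real K \<le> real N" using Ks elim s_def by simp
    moreover have "real N ^ 3 \<le> real N powr \<theta>"
    proof -
      have "real N ^ 3 = real N powr 3" using N3 by (simp add: powr_realpow[of "real N" 3, simplified])
      also have "\<dots> \<le> real N powr \<theta>" using N3 \<theta> by (intro powr_mono) auto
      finally show ?thesis .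
    qed
    moreover have "real K ^ 2 * real N ^ 2 \<le> real N powr \<theta>"
    proof -
      have "real K ^ 2 \<le> s ^ 2" using Ks by (intro power_mono) auto
      also have "\<dots> \<le> real N powr (\<theta> - 2)" using elim X0 by (simp add: algebra_simps)
      finally have "real K ^ 2 * real N ^ 2 \<le> real N powr (\<theta> - 2) * real N ^ 2"
        by (rule mult_right_mono) simp
      moreover have "real N powr (\<theta> - 2) * real N powr 2 = real N powr \<theta>" by (simp only: powr_add[symmetric]) simp
      moreover have "real N powr 2 = real N ^ 2" using N3 by simp
      ultimately show ?thesis by simp
    qed
    moreover have "2 * real n \<le> D (real N) * real K / 2 * real N"
    proof -
      have "8 * real n \<le> D (real N) * s * real N" using elim s_def by simp
      also have "\<dots> \<le> D (real N) * (2 * real K) * real N"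
        using D0 Ks by (intro mult_right_mono mult_left_mono) auto
      finally show ?thesis by (simp add: mult_ac)
    qed
    moreover have "24 * ln (real N) \<le> D (real N) * real K / 2 * real K"
    proof -
      have "192 * ln (real N) \<le> D (real N) * s ^ 2" using elim X0 by simp
      also have "\<dots> \<le> D (real N) * (2 * real K) ^ 2"
        using D0 Ks s2 by (intro mult_left_mono power_mono) auto
      finally show ?thesis by (simp add: power2_eq_square mult_ac)
    qed
    ultimately show ?case using N3 Kr unfolding Let_def K_def[symmetric] D_def[symmetric]
      by (simp add: D_def)
  qed
qed

theorem theorem3p3:
  fixes f :: "complex \<Rightarrow> complex" and a :: "nat \<Rightarrow> complex" and \<gamma> \<delta> :: real
  assumes "transcendental_entire f"
    and "order_of_growth f < 1 / 3"
    and "wilson_expansion f a"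
    and "3 < \<gamma>" and "ereal \<gamma> < 1 / order_of_growth f"
    and "\<delta> > 0"
  shows "\<exists>E :: real set. E \<subseteq> {1..} \<and> E \<in> sets lebesgue \<and> log_measure E < \<infinity> \<and>
    (\<forall>n\<ge>1.
      (\<lambda>x. (x / of_nat (wilson_central_index a (cmod x))) ^ n * (wilson_op ^^ n) f x - f x)
      \<in> O[inf at_infinity (principal {x. cmod x \<notin> E})](
        \<lambda>x. of_real (real_of_int (wilson_kappa \<delta> (wilson_central_index a (cmod x)))
                / real (wilson_central_index a (cmod x)) * max_modulus (cmod x) f)))"
proof -
  note f = \<open>wilson_expansion f a\<close>
  have hol: "f holomorphic_on UNIV"
    using assms(1) unfolding transcendental_entire_def entire_def by blast
  have d: "\<delta> / 2 > 0" using assms(6) by simp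
  define A where "A = (\<lambda>k. cmod (a k))"
  define \<beta> where "\<beta> = (\<lambda>j::nat. exp (log_weight (\<delta> / 2) (real j)))"
  define \<theta> where "\<theta> = (3 + \<gamma>) / 2"
  have \<theta>: "3 < \<theta>" "\<theta> < \<gamma>" unfolding \<theta>_def using assms(4) by auto
  have mono: "mono \<beta>" unfolding \<beta>_def by (intro monoI) (simp add: log_weight_mono[OF d])
  have lw0: "log_weight (\<delta> / 2) 0 = 0" by (simp add: log_weight_def)
  have \<beta>1: "\<beta> k \<ge> 1" for k using log_weight_mono[OF d, of 0 "real k"] lw0 unfolding \<beta>_def by simp
  have \<beta>B: "\<beta> k \<le> exp (ln (ln 16) powr (- (\<delta> / 2)))" for k unfolding \<beta>_def log_weight_def by simp
  obtain R where R: "\<And>r z. r \<ge> R \<Longrightarrow> cmod z = r \<Longrightarrow> cmod (f z) \<le> exp (r powr (1 / \<gamma>))"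
    using order_of_growth_bound[OF hol _ assms(5)] assms(4) by auto
  have dec: "A k \<le> 2 * (2 * exp 1 / real k powr \<gamma>) ^ k" if "k \<ge> max 2 (nat \<lceil>R\<rceil>)" for k
    unfolding A_def
  proof (rule coefficient_decay[OF f _ R])
    show "real k \<ge> R" using that by linarith
  qed (use that assms(4) in auto)
  have "\<exists>E. E \<subseteq> {1..} \<and> E \<in> sets lebesgue \<and> log_measure E < \<infinity> \<and>
    (\<forall>n0. \<exists>R. \<forall>r\<ge>R. r \<notin> E \<longrightarrow> (\<exists>N\<ge>n0. real N powr \<theta> \<le> r \<and> A N > 0 \<and>
      (\<forall>k<N. A k * (\<Prod>j<k. r + (real j)\<^sup>2) \<le> A N * (\<Prod>j<N. r + (real j)\<^sup>2) * (\<Prod>j=k..<N. \<beta> j / \<beta> N)) \<and>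
      (\<forall>k>N. A k * (\<Prod>j<k. r + (real j)\<^sup>2) < A N * (\<Prod>j<N. r + (real j)\<^sup>2) * (\<Prod>j=N..<k. \<beta> N / \<beta> j))))"
  proof (rule exceptional_set)
    show "\<exists>k\<ge>n. A k > 0" for n
      unfolding A_def by (rule transcendental_coefficients[OF assms(1) f])
    show "\<exists>k0. \<forall>k\<ge>k0. \<forall>s. 0 \<le> s \<longrightarrow> s \<le> real k powr \<theta> \<longrightarrow> weighted_term A \<beta> s k < c" if "c > 0" for c
    proof (rule weighted_term_decay)
      show "3 \<le> \<theta>" "\<theta> < \<gamma>" "c > 0" using \<theta> that by auto
      show "A k \<ge> 0" for k by (simp add: A_def)
    qed (fact dec \<beta>1 \<beta>B)+
  qed (use \<theta> \<beta>1 \<beta>B mono in \<open>auto simp: A_def\<close>)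
  then obtain E where E: "E \<subseteq> {1..}" "E \<in> sets lebesgue" "log_measure E < \<infinity>"
    and normal: "\<And>n0. \<exists>R. \<forall>r\<ge>R. r \<notin> E \<longrightarrow> (\<exists>N\<ge>n0. real N powr \<theta> \<le> r \<and> A N > 0 \<and>
      (\<forall>k<N. A k * (\<Prod>j<k. r + (real j)\<^sup>2) \<le> A N * (\<Prod>j<N. r + (real j)\<^sup>2) * (\<Prod>j=k..<N. \<beta> j / \<beta> N)) \<and>
      (\<forall>k>N. A k * (\<Prod>j<k. r + (real j)\<^sup>2) < A N * (\<Prod>j<N. r + (real j)\<^sup>2) * (\<Prod>j=N..<k. \<beta> N / \<beta> j)))"
    by blast
  have "(\<lambda>x. (x / of_nat (wilson_central_index a (cmod x))) ^ n * (wilson_op ^^ n) f x - f x)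
      \<in> O[inf at_infinity (principal {x. cmod x \<notin> E})](
        \<lambda>x. of_real (real_of_int (wilson_kappa \<delta> (wilson_central_index a (cmod x)))
                / real (wilson_central_index a (cmod x)) * max_modulus (cmod x) f))" if n: "n \<ge> 1" for n
  proof -
    define y where "y = (\<lambda>N. log_weight_slope (\<delta> / 2) (2 * real N) * real (nat (wilson_kappa \<delta> N)) / 2)"
    obtain n0 where n0: "\<And>N K. N \<ge> n0 \<Longrightarrow> K = nat (wilson_kappa \<delta> N) \<Longrightarrow>
      3 \<le> N \<and> 2 * n \<le> N \<and> 1 \<le> K \<and> 2 * K \<le> N \<and> real N ^ 3 \<le> real N powr \<theta> \<and> real K ^ 2 * real N ^ 2 \<le> real N powr \<theta> \<and>
      2 * real n \<le> y N * real N \<and> 24 * ln (real N) \<le> y N * real K \<and> real_of_int (wilson_kappa \<delta> N) = real K"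
      using eventually_kappa_conditions[OF assms(6) \<theta>(1), of n]
      unfolding eventually_sequentially Let_def y_def by blast
    obtain R1 where R1: "\<And>r. r \<ge> R1 \<Longrightarrow> r \<notin> E \<Longrightarrow> \<exists>N\<ge>n0. real N powr \<theta> \<le> r \<and> A N > 0 \<and>
      (\<forall>k<N. A k * (\<Prod>j<k. r + (real j)\<^sup>2) \<le> A N * (\<Prod>j<N. r + (real j)\<^sup>2) * (\<Prod>j=k..<N. \<beta> j / \<beta> N)) \<and>
      (\<forall>k>N. A k * (\<Prod>j<k. r + (real j)\<^sup>2) < A N * (\<Prod>j<N. r + (real j)\<^sup>2) * (\<Prod>j=N..<k. \<beta> N / \<beta> j))"
      using normal[of n0] by blast
    define C where "C = window_constant n * (1 + 39 * exp 8) + 36 * exp 8"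
    have est: "cmod ((x / of_nat (wilson_central_index a (cmod x))) ^ n * (wilson_op ^^ n) f x - f x)
        \<le> C * cmod (of_real (real_of_int (wilson_kappa \<delta> (wilson_central_index a (cmod x)))
                / real (wilson_central_index a (cmod x)) * max_modulus (cmod x) f))"
      if x: "cmod x \<ge> R1" "cmod x \<notin> E" for x
    proof -
      define r where "r = cmod x"
      let ?t = "wilson_term a r"
      obtain N where N: "N \<ge> n0" "real N powr \<theta> \<le> r" "A N > 0"
        and low: "\<And>k. k < N \<Longrightarrow> ?t k \<le> ?t N * (\<Prod>j=k..<N. \<beta> j / \<beta> N)"
        and high: "\<And>k. k > N \<Longrightarrow> ?t k < ?t N * (\<Prod>j=N..<k. \<beta> N / \<beta> j)"
        using R1[OF x] unfolding r_def[symmetric] wilson_term_def A_def by blast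
      define K where "K = nat (wilson_kappa \<delta> N)"
      note cond = n0[OF N(1) K_def]
      have r0: "r \<ge> 0" unfolding r_def by simp
      have t0: "?t N \<ge> 0" unfolding wilson_term_def using r0 by (intro mult_nonneg_nonneg prod_nonneg) auto
      have \<beta>0: "\<beta> j > 0" for j unfolding \<beta>_def by simp
      have le1: "(\<Prod>j=k..<N. \<beta> j / \<beta> N) \<le> 1" "(\<Prod>j=N..<k. \<beta> N / \<beta> j) \<le> 1" for k
        using monoD[OF mono] \<beta>0 by (auto intro!: prod_le_1 simp: less_imp_le)
      have lt: "?t k < ?t N" if "k > N" for k
        using high[OF that] mult_left_mono[OF le1(2)[of k] t0] by simp
      have le: "?t k \<le> ?t N" for k
        using low[of k] mult_left_mono[OF le1(1)[of k] t0] lt[of k] by (cases k N rule: linorder_cases) auto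
      have idx: "wilson_central_index a r = N" by (rule wilson_central_index_eqI[OF le lt])
      have decay: "?t k \<le> ?t N * exp (- y N * \<bar>real k - real N\<bar>)" if k: "k \<notin> {N-K..N+K}" for k
      proof -
        have q: "K + 1 \<le> N" using cond by linarith
        have "k + (K + 1) \<le> N \<or> N + (K + 1) \<le> k" using k by auto
        thus ?thesis
        proof
          assume k': "k + (K + 1) \<le> N"
          have "?t k \<le> ?t N * (\<Prod>j=k..<N. \<beta> j / \<beta> N)" using k' by (intro low) simp
          also have "\<dots> \<le> ?t N * exp (- y N * \<bar>real k - real N\<bar>)"
            using prod_weight_ratio_le(1)[OF d q k'] unfolding \<beta>_def y_def K_def[symmetric]
            by (intro mult_left_mono t0) simp
          finally show ?thesis .
        next
          assume k': "N + (K + 1) \<le> k"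
          have "?t k \<le> ?t N * (\<Prod>j=N..<k. \<beta> N / \<beta> j)" using k' by (intro less_imp_le[OF high]) simp
          also have "\<dots> \<le> ?t N * exp (- y N * \<bar>real k - real N\<bar>)"
            using prod_weight_ratio_le(2)[OF d q k'] unfolding \<beta>_def y_def K_def[symmetric]
            by (intro mult_left_mono t0) simp
          finally show ?thesis .
        qed
      qed
      have M: "cmod (f z) \<le> max_modulus r f" if "cmod z = r" for z by (rule norm_le_max_modulus[OF hol that])
      have "cmod ((x / of_nat N) ^ n * (wilson_op ^^ n) f x - f x) \<le> C * (real K / real N * max_modulus r f)"
        unfolding C_def
        by (rule estimate_at_normal_radius[OF f M, where y = "y N"])
           (use cond N n le decay in \<open>auto simp: r_def intro: order_trans\<close>)
      also have "real K / real N * max_modulus r f = cmod (of_real (real_of_int (wilson_kappa \<delta> N) / real N * max_modulus r f))"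
      proof -
        have "max_modulus r f \<ge> 0" using M[of x] norm_ge_zero[of "f x"] unfolding r_def by linarith
        thus ?thesis using cond by (simp only: norm_of_real) simp
      qed
      finally show ?thesis unfolding r_def[symmetric] idx .
    qed
    show ?thesis
    proof (rule bigoI[where c = C])
      show "eventually (\<lambda>x. cmod ((x / of_nat (wilson_central_index a (cmod x))) ^ n * (wilson_op ^^ n) f x - f x)
        \<le> C * cmod (of_real (real_of_int (wilson_kappa \<delta> (wilson_central_index a (cmod x)))
                / real (wilson_central_index a (cmod x)) * max_modulus (cmod x) f)))
        (inf at_infinity (principal {x. cmod x \<notin> E}))"
        unfolding eventually_inf_principal eventually_at_infinity using est by blast
    qed
  qed
  thus ?thesis using E by blast
qed

end
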